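(* Let $(E,\mathcal P(E))$ be a measurable space and let $S(t)=(n(t),x(t))$ be a Markov jump process with state space $E$ driven by a set $\Xi$ of Poisson clocks as described in the context. Let $f:E\to\mathbb{R}^d$, for some $d\in\mathbb{N}$, be a measurable bounded function. For $j\in\mathbb{N}$ let $F_j(t)=\mathbb{E}[f(S(t))\mid n(t)=j]$ and $\pi_j(t)=P[n(t)=j]$. Suppose that for every $\epsilon\in\Xi$ there exist $A_\epsilon\in\mathbb{R}^{d\times d}$ and $b_\epsilon\in\mathbb{R}^d$ such that (componentwise) $$\mathbb{E}\left[f(S(t^+))\mid f(S(t)),\epsilon\right]\le A_\epsilon f(S(t))+b_\epsilon,$$ where $S(t^+)$ denotes the state after an event of $\epsilon$ at time $t$. Then, for every $j\in\mathbb{N}$ (componentwise), $$\frac{d}{dt}\big(F_j(t)\pi_j(t)\big)\le\sum_{\epsilon:\,a(\epsilon)=j}\lambda_\epsilon\,\pi_{s(\epsilon)}(t)\big(A_\epsilon F_{s(\epsilon)}(t)+b_\epsilon\big)-\sum_{\epsilon:\,s(\epsilon)=j}\lambda_\epsilon\,\pi_j(t)F_j(t).$$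
   Context: General model. The state is $S(t)=(n(t),x(t))$ with $n(t)\in\mathbb{N}$ (the system size, $0\in\mathbb N$) and $x(t)\in\mathbb{R}^{n(t)}$; $E$ is the set of such states, and $\mathcal P(E)$ is its $\sigma$-algebra of measurable sets. $S(t)$ is a (time-homogeneous) continuous-time Markov jump process, i.e. it evolves only by instantaneous changes ("jumps") at random times. To each value of the size is associated a finite set of independent Poisson clocks; $\Xi$ is the set of all clocks (over all values of the size). Each clock $\epsilon\in\Xi$ has a rate $\lambda_\epsilon\ge0$, a source size $s(\epsilon)\in\mathbb{N}$ and an arrival size $a(\epsilon)\in\mathbb{N}$: when the current size is $s(\epsilon)$, the clock $\epsilon$ activates with rate $\lambda_\epsilon$ (an "event of $\epsilon$"), and this triggers a jump which changes the size deterministically from $s(\epsilon)$ to $a(\epsilon)$ and modifies $x(t)$ randomly, according to a distribution depending on the values of $n(t)$ and $x(t)$ just before the event (and on $\epsilon$). Conditioning on $\epsilon$ means conditioning on an event of $\epsilon$ occurring at time $t$ (in particular $n(t)=s(\epsilon)$ just before it). When $\pi_j(t)=0$, the product $F_j(t)\pi_j(t)$ is understood as $\mathbb{E}[f(S(t))\mathbf 1_{\{n(t)=j\}}]=0$.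
   Formalization: Added assumption: the sum over clocks ε with a(ε)=j of λ_ε π_{s(ε)}(u) converges uniformly on compact time intervals (automatic if finitely many clocks arrive in j); without it the derivative may fail to exist or the inequality may fail. *)

theory Defs
  imports "HOL-Probability.Probability"
begin

(* A vector of R^n is a function nat => real, normalised to undefined outside {..<n}. *)

type_synonym state = "nat \<times> (nat \<Rightarrow> real)"

definition state_set :: "state set" where
  "state_set = (SIGMA n:UNIV. {..<n} \<rightarrow>\<^sub>E UNIV)"

(* S t is the state just before a possible event at time t (left-continuous paths); post_state S t
   is the state S(t+) just after it. Paths are piecewise constant, so this is an eventual value
   rather than a limit, and no topology on the states is involved. *)

definition post_state :: "(real \<Rightarrow> 'w \<Rightarrow> state) \<Rightarrow> real \<Rightarrow> 'w \<Rightarrow> state" where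
  "post_state S t \<omega> = (THE y. \<forall>\<^sub>F u in at_right t. S u \<omega> = y)"

(* tick \<epsilon> m is the time of the m-th ring (from m = 0) of the clock \<epsilon>, and \<infinity> if there is none. *)

definition tick_count :: "('c \<Rightarrow> nat \<Rightarrow> 'w \<Rightarrow> ereal) \<Rightarrow> 'c \<Rightarrow> real \<Rightarrow> real \<Rightarrow> 'w \<Rightarrow> nat" where
  "tick_count tick \<epsilon> t v \<omega> = card {m. ereal t < tick \<epsilon> m \<omega> \<and> tick \<epsilon> m \<omega> \<le> ereal v}"

definition history ::
  "'w measure \<Rightarrow> state measure \<Rightarrow> 'c set \<Rightarrow> (real \<Rightarrow> 'w \<Rightarrow> state) \<Rightarrow>
   ('c \<Rightarrow> nat \<Rightarrow> 'w \<Rightarrow> ereal) \<Rightarrow> real \<Rightarrow> 'w set set" where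
  "history M E \<Xi> S tick t = sigma_sets (space M)
     ({S u -` B \<inter> space M |u B. 0 \<le> u \<and> u \<le> t \<and> B \<in> sets E} \<union>
      {{\<omega> \<in> space M. tick \<epsilon> m \<omega> \<le> ereal u} |\<epsilon> m u. \<epsilon> \<in> \<Xi> \<and> 0 \<le> u \<and> u \<le> t})"

(* The m-th ring of \<epsilon> is an event of \<epsilon>, occurring after time t: at that time the size is src \<epsilon>. *)

definition event_after ::
  "'w measure \<Rightarrow> ('c \<Rightarrow> nat) \<Rightarrow> (real \<Rightarrow> 'w \<Rightarrow> state) \<Rightarrow> ('c \<Rightarrow> nat \<Rightarrow> 'w \<Rightarrow> ereal) \<Rightarrow>
   'c \<Rightarrow> nat \<Rightarrow> real \<Rightarrow> 'w set" where
  "event_after M src S tick \<epsilon> m t =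
     {\<omega> \<in> space M. ereal t < tick \<epsilon> m \<omega> \<and> tick \<epsilon> m \<omega> < \<infinity> \<and>
        fst (S (real_of_ereal (tick \<epsilon> m \<omega>)) \<omega>) = src \<epsilon>}"

(* The clocks are independent Poisson processes relative to the common history. A ring of \<epsilon> has an
   effect only if it finds the system in size src \<epsilon>; the new state is then drawn from K \<epsilon> y, where y
   is the state just before (post_law says that K is the conditional law given the strict past of
   the ring). The Markov property and homogeneity in time follow, as the rates and K do not depend
   on time and post_law and the independence are relative to the whole past. The sigma-algebra
   on the states is arbitrary, subject to the size being measurable. The path conditions exclude
   explosion: they leave only finitely many jumps in bounded time. *)

locale clock_jump_process = prob_space M
  for M :: "'w measure"
    and E :: "state measure"
    and \<Xi> :: "'c set"
    and rate :: "'c \<Rightarrow> real"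
    and src arr :: "'c \<Rightarrow> nat"
    and K :: "'c \<Rightarrow> state \<Rightarrow> state measure"
    and S :: "real \<Rightarrow> 'w \<Rightarrow> state"
    and tick :: "'c \<Rightarrow> nat \<Rightarrow> 'w \<Rightarrow> ereal" +
  assumes space_E: "space E = state_set"
    and size_measurable: "fst \<in> E \<rightarrow>\<^sub>M count_space UNIV"
    and finite_clocks: "finite {\<epsilon> \<in> \<Xi>. src \<epsilon> = n}"
    and rate_nonneg: "\<epsilon> \<in> \<Xi> \<Longrightarrow> 0 \<le> rate \<epsilon>"
    and kernel: "\<epsilon> \<in> \<Xi> \<Longrightarrow> K \<epsilon> \<in> E \<rightarrow>\<^sub>M prob_algebra E"
    and kernel_size:
      "\<epsilon> \<in> \<Xi> \<Longrightarrow> y \<in> space E \<Longrightarrow> fst y = src \<epsilon> \<Longrightarrow> AE z in K \<epsilon> y. fst z = arr \<epsilon>"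
    and S_measurable: "0 \<le> t \<Longrightarrow> S t \<in> M \<rightarrow>\<^sub>M E"
    and tick_measurable: "\<epsilon> \<in> \<Xi> \<Longrightarrow> tick \<epsilon> m \<in> borel_measurable M"
    and tick_pos: "\<epsilon> \<in> \<Xi> \<Longrightarrow> \<omega> \<in> space M \<Longrightarrow> 0 < tick \<epsilon> m \<omega>"
    and tick_mono: "\<epsilon> \<in> \<Xi> \<Longrightarrow> \<omega> \<in> space M \<Longrightarrow> incseq (\<lambda>m. tick \<epsilon> m \<omega>)"
    and tick_strict:
      "\<epsilon> \<in> \<Xi> \<Longrightarrow> \<omega> \<in> space M \<Longrightarrow> tick \<epsilon> m \<omega> < \<infinity> \<Longrightarrow> tick \<epsilon> m \<omega> < tick \<epsilon> (Suc m) \<omega>"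
    and tick_tendsto: "\<epsilon> \<in> \<Xi> \<Longrightarrow> \<omega> \<in> space M \<Longrightarrow> (\<lambda>m. tick \<epsilon> m \<omega>) \<longlonglongrightarrow> \<infinity>"
    and poisson_increments:
      "\<epsilon> \<in> \<Xi> \<Longrightarrow> 0 \<le> t \<Longrightarrow> t \<le> v \<Longrightarrow>
       prob {\<omega> \<in> space M. tick_count tick \<epsilon> t v \<omega> = k} =
         (rate \<epsilon> * (v - t)) ^ k / fact k * exp (- (rate \<epsilon> * (v - t)))"
    and clocks_indep:
      "0 \<le> t \<Longrightarrow> t \<le> v \<Longrightarrow>
       indep_vars (\<lambda>_. count_space UNIV) (\<lambda>\<epsilon>. tick_count tick \<epsilon> t v) \<Xi>"
    and history_indep:
      "0 \<le> t \<Longrightarrow> t \<le> v \<Longrightarrow>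
       indep_set (history M E \<Xi> S tick t)
         (sigma_sets (space M)
            {{\<omega> \<in> space M. tick_count tick \<epsilon> t v \<omega> = k} |\<epsilon> k. \<epsilon> \<in> \<Xi>})"
    and left_constant:
      "\<omega> \<in> space M \<Longrightarrow> 0 < t \<Longrightarrow> \<forall>\<^sub>F u in at_left t. S u \<omega> = S t \<omega>"
    and right_constant:
      "\<omega> \<in> space M \<Longrightarrow> 0 \<le> t \<Longrightarrow> \<exists>y. \<forall>\<^sub>F u in at_right t. S u \<omega> = y"
    and jumps_at_events:
      "\<omega> \<in> space M \<Longrightarrow> 0 \<le> t \<Longrightarrow> post_state S t \<omega> \<noteq> S t \<omega> \<Longrightarrow>
       \<exists>\<epsilon>\<in>\<Xi>. fst (S t \<omega>) = src \<epsilon> \<and> (\<exists>m. tick \<epsilon> m \<omega> = ereal t)"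
    and post_law:
      "\<epsilon> \<in> \<Xi> \<Longrightarrow> 0 \<le> t \<Longrightarrow> H \<in> history M E \<Xi> S tick t \<Longrightarrow> B \<in> sets E \<Longrightarrow>
       prob {\<omega> \<in> H \<inter> event_after M src S tick \<epsilon> m t.
               post_state S (real_of_ereal (tick \<epsilon> m \<omega>)) \<omega> \<in> B} =
       (LINT \<omega>|M. indicator (H \<inter> event_after M src S tick \<epsilon> m t) \<omega> *
          measure (K \<epsilon> (S (real_of_ereal (tick \<epsilon> m \<omega>)) \<omega>)) B)"

definition size_event :: "'w measure \<Rightarrow> (real \<Rightarrow> 'w \<Rightarrow> state) \<Rightarrow> nat \<Rightarrow> real \<Rightarrow> 'w set" where
  "size_event M S j t = {\<omega> \<in> space M. fst (S t \<omega>) = j}"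

definition size_prob :: "'w measure \<Rightarrow> (real \<Rightarrow> 'w \<Rightarrow> state) \<Rightarrow> nat \<Rightarrow> real \<Rightarrow> real" where
  "size_prob M S j t = measure M (size_event M S j t)"

(* E[f(S(t)) | n(t) = j]; equal to 0 if the size is almost surely not j, uniform_measure then being
   the null measure. *)

definition size_mean ::
  "'w measure \<Rightarrow> (real \<Rightarrow> 'w \<Rightarrow> state) \<Rightarrow> (state \<Rightarrow> real ^ 'd) \<Rightarrow> nat \<Rightarrow> real \<Rightarrow> real ^ 'd" where
  "size_mean M S f j t = (LINT \<omega>|uniform_measure M (size_event M S j t). f (S t \<omega>))"

(* The joint law of (S(t), S(t+)) given an event of \<epsilon> at time t. The state just before is
   independent of the clock, so the conditioning only imposes n(t) = src \<epsilon> on it, and S(t+) is then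
   drawn from K \<epsilon>. Meaningful if size_prob M S (src \<epsilon>) t > 0. *)

definition event_law ::
  "'w measure \<Rightarrow> state measure \<Rightarrow> ('c \<Rightarrow> nat) \<Rightarrow> ('c \<Rightarrow> state \<Rightarrow> state measure) \<Rightarrow>
   (real \<Rightarrow> 'w \<Rightarrow> state) \<Rightarrow> 'c \<Rightarrow> real \<Rightarrow> (state \<times> state) measure" where
  "event_law M E src K S \<epsilon> t =
     distr (uniform_measure M (size_event M S (src \<epsilon>) t)) E (S t) \<bind>
       (\<lambda>y. distr (K \<epsilon> y) (E \<Otimes>\<^sub>M E) (Pair y))"

(* E[f(S(t+)) | f(S(t)), \<epsilon>], as a function of the pair (S(t), S(t+)). *)

definition event_cond_exp ::
  "'w measure \<Rightarrow> state measure \<Rightarrow> ('c \<Rightarrow> nat) \<Rightarrow> ('c \<Rightarrow> state \<Rightarrow> state measure) \<Rightarrow>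
   (real \<Rightarrow> 'w \<Rightarrow> state) \<Rightarrow> (state \<Rightarrow> real ^ 'd) \<Rightarrow> 'c \<Rightarrow> real \<Rightarrow> state \<times> state \<Rightarrow> real ^ 'd" where
  "event_cond_exp M E src K S f \<epsilon> t p =
     (let Q = event_law M E src K S \<epsilon> t in
      \<chi> i. real_cond_exp Q (vimage_algebra (space Q) (\<lambda>(y, z). f y) borel) (\<lambda>(y, z). f z $ i) p)"

end

theory Submission
  imports Defs
begin

text \<open>
  For bounded measurable \<open>g\<close> vanishing off the size \<open>j\<close>, the difference \<open>g(S(v)) - g(S(0))\<close> telescopes over
  the jumps in \<open>(0, v]\<close>, and almost surely each jump is an event of exactly one clock. Since \<open>S\<close> is
  left-continuous and the rings of a clock after time \<open>t\<close> are independent of the history up to \<open>t\<close>,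
  approximating the time of a ring from below on a grid shows that the expected sum of \<open>h(S)\<close> over
  the rings of \<open>\<epsilon>\<close> is \<open>\<lambda>\<^sub>\<epsilon> \<integral> E[h(S(u))] du\<close>. The arrivals are replaced by the kernel through the law of
  the state after an event. This gives an integrated balance of gain and loss, whose integrands are
  continuous in time: for the loss and each gain term because almost surely no clock rings at a
  given time, for the sum of the gain terms by the uniform convergence of the inflow. Differentiating
  the balance gives an exact equation, and averaging the bound on the conditional expectation over the law
  of an event bounds each gain term.
\<close>

section \<open>Piecewise constant paths\<close>

text \<open>Only finitely many clocks leave a given size, but infinitely many may arrive at
  \<open>j\<close>, and nothing bounds the mean number of events in a bounded time. The balance is
  therefore derived in \<open>ennreal\<close>, where sums over clocks and integrals can be exchanged
  freely; the restriction to size \<open>j\<close> keeps the loss a finite sum. Signs return only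
  afterwards, by shifting a bounded function by a constant. Uniform convergence of the inflow enters
  where an integrated identity has to become a derivative at every single time: it makes the
  infinite gain finite and continuous. Independence of the clocks from the past is given for
  deterministic windows only, so everything about the random times of rings has to be reached
  through grids. The states carry no topology, so these approximations end in eventual equality of
  states rather than in limits.\<close>

lemma measurable_eventually_const:
  assumes X: "\<And>n. X n \<in> M \<rightarrow>\<^sub>M N"
    and ev: "\<And>\<omega>. \<omega> \<in> space M \<Longrightarrow> \<forall>\<^sub>F n in sequentially. X n \<omega> = Y \<omega>"
  shows "Y \<in> M \<rightarrow>\<^sub>M N"
proof (rule measurableI)
  fix \<omega> assume \<omega>: "\<omega> \<in> space M"
  obtain n where "X n \<omega> = Y \<omega>"
    using eventually_happens[OF ev[OF \<omega>]] by auto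
  then show "Y \<omega> \<in> space N"
    using measurable_space[OF X \<omega>, of n] by simp
next
  \<comment> \<open>With eventual equality the preimage of \<open>B\<close> under \<open>Y\<close>
    is the lower limit of its preimages under \<open>X n\<close>; no limit is taken in the space of
    states.\<close>
  fix B assume B: "B \<in> sets N"
  have "Y -` B \<inter> space M = (\<Union>k. \<Inter>n\<in>{k..}. X n -` B \<inter> space M)"
  proof (intro set_eqI iffI)
    fix \<omega> assume \<omega>: "\<omega> \<in> Y -` B \<inter> space M"
    then obtain k where "\<And>n. n \<ge> k \<Longrightarrow> X n \<omega> = Y \<omega>"
      using ev[of \<omega>] by (auto simp: eventually_sequentially)
    with \<omega> show "\<omega> \<in> (\<Union>k. \<Inter>n\<in>{k..}. X n -` B \<inter> space M)"
      by (intro UN_I[of k]) auto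
  next
    fix \<omega> assume "\<omega> \<in> (\<Union>k. \<Inter>n\<in>{k..}. X n -` B \<inter> space M)"
    then obtain k where k: "\<And>n. n \<ge> k \<Longrightarrow> \<omega> \<in> X n -` B \<inter> space M"
      by auto
    then have \<omega>: "\<omega> \<in> space M"
      by auto
    obtain n where "n \<ge> k" "X n \<omega> = Y \<omega>"
      using ev[OF \<omega>] by (auto simp: eventually_sequentially) (meson nat_le_linear)
    then show "\<omega> \<in> Y -` B \<inter> space M"
      using k[of n] \<omega> by auto
  qed
  also have "\<dots> \<in> sets M"
    using X B by (intro sets.countable_UN'' sets.countable_INT') (auto simp: measurable_sets)
  finally show "Y -` B \<inter> space M \<in> sets M" .
qed

text \<open>Bisection reduces all three claims to short intervals around one point, on which the
  path takes at most two values. Jumps are collected on \<open>{a..<b}\<close> because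
  \<open>x\<close> is left-continuous: \<open>x b\<close> does not yet include a jump at
  \<open>b\<close>, and adjacent intervals then have disjoint sets of jumps.\<close>

lemma piecewise_constant_path:
  fixes x y :: "real \<Rightarrow> 'a" and g :: "'a \<Rightarrow> real"
  assumes left: "\<And>u. 0 < u \<Longrightarrow> \<forall>\<^sub>F w in at_left u. x w = x u"
    and right: "\<And>u. 0 \<le> u \<Longrightarrow> \<forall>\<^sub>F w in at_right u. x w = y u"
    and "0 \<le> a" "a \<le> b"
  shows "finite {u \<in> {a..<b}. y u \<noteq> x u} \<and> finite (x ` {a..b}) \<and>
    g (x b) - g (x a) = (\<Sum>u\<in>{u \<in> {a..<b}. y u \<noteq> x u}. g (y u) - g (x u))"
proof -
  \<comment> \<open>The condition \<open>0 \<le> a\<close> sits inside the claim because the short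
    intervals around a point may reach below 0, where nothing is known about the path.\<close>
  have "0 \<le> a \<longrightarrow> finite {u \<in> {a..<b}. y u \<noteq> x u} \<and> finite (x ` {a..b}) \<and>
    g (x b) - g (x a) = (\<Sum>u\<in>{u \<in> {a..<b}. y u \<noteq> x u}. g (y u) - g (x u))"
    using \<open>a \<le> b\<close>
  proof (induction rule: Bolzano)
    case (trans a b c)
    show ?case
    proof
      assume "0 \<le> a"
      have *: "{u \<in> {a..<c}. y u \<noteq> x u} = {u \<in> {a..<b}. y u \<noteq> x u} \<union> {u \<in> {b..<c}. y u \<noteq> x u}"
        and **: "x ` {a..c} = x ` {a..b} \<union> x ` {b..c}"
        unfolding ivl_disj_un_two_touch(4)[OF trans(3,4), symmetric] image_Un
          ivl_disj_un_two(3)[OF trans(3,4), symmetric] by blast+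
      have "0 \<le> b"
        using \<open>0 \<le> a\<close> trans(3) by simp
      note A = trans(1)[rule_format, OF \<open>0 \<le> a\<close>] and B = trans(2)[rule_format, OF \<open>0 \<le> b\<close>]
      have "(\<Sum>u\<in>{u \<in> {a..<c}. y u \<noteq> x u}. g (y u) - g (x u)) =
          (\<Sum>u\<in>{u \<in> {a..<b}. y u \<noteq> x u}. g (y u) - g (x u)) +
          (\<Sum>u\<in>{u \<in> {b..<c}. y u \<noteq> x u}. g (y u) - g (x u))"
        unfolding * using A B by (intro sum.union_disjoint) auto
      then show "finite {u \<in> {a..<c}. y u \<noteq> x u} \<and> finite (x ` {a..c}) \<and>
          g (x c) - g (x a) = (\<Sum>u\<in>{u \<in> {a..<c}. y u \<noteq> x u}. g (y u) - g (x u))"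
        unfolding ** using A B unfolding * by auto
    qed
  next
    case (local p)
    show ?case
    proof (cases "0 \<le> p")
      case False
      then show ?thesis
        by (intro exI[of _ 1]) auto
    next
      case True
      obtain d1 where d1: "d1 > 0" "\<And>w. p < w \<Longrightarrow> w < p + d1 \<Longrightarrow> x w = y p"
      proof -
        obtain c where "p < c" "\<And>w. p < w \<Longrightarrow> w < c \<Longrightarrow> x w = y p"
          using right[OF True] unfolding eventually_at_right_field by auto
        then show thesis
          by (intro that[of "c - p"]) auto
      qed
      obtain d2 where d2: "d2 > 0" "\<And>w. 0 \<le> w \<Longrightarrow> p - d2 < w \<Longrightarrow> w \<le> p \<Longrightarrow> x w = x p"
      proof (cases "p = 0")
        case True
        then show thesis
          by (intro that[of 1]) auto
      next
        case False
        with True have "0 < p" by simp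
        then obtain c where "c < p" "\<And>w. c < w \<Longrightarrow> w < p \<Longrightarrow> x w = x p"
          using left[OF \<open>0 < p\<close>] unfolding eventually_at_left_field by auto
        then show thesis
          by (intro that[of "p - c"]) (auto simp: order_le_less)
      qed
      \<comment> \<open>The value after \<open>u\<close> is determined by the path just to the right
        of \<open>u\<close>; on both sides of \<open>p\<close> the path is constant, so
        \<open>p\<close> is the only possible jump.\<close>
      have y_eq: "y u = z" if "0 \<le> u" "u < c" "\<And>w. u < w \<Longrightarrow> w < c \<Longrightarrow> x w = z" for u c z
      proof -
        have "\<forall>\<^sub>F w in at_right u. x w = z"
          using that unfolding eventually_at_right_field by auto
        with right[OF \<open>0 \<le> u\<close>] have "\<forall>\<^sub>F w in at_right u. y u = z"
          by eventually_elim simp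
        then show ?thesis
          by simp
      qed
      define d where "d = min d1 d2"
      have "finite {u \<in> {a..<b}. y u \<noteq> x u} \<and> finite (x ` {a..b}) \<and>
          g (x b) - g (x a) = (\<Sum>u\<in>{u \<in> {a..<b}. y u \<noteq> x u}. g (y u) - g (x u))"
        if "a \<le> p" "p \<le> b" "b - a < d" "0 \<le> a" for a b
      proof -
        have left_part: "x w = x p" if "a \<le> w" "w \<le> p" for w
          using that \<open>0 \<le> a\<close> \<open>b - a < d\<close> \<open>p \<le> b\<close> unfolding d_def by (intro d2) auto
        have right_part: "x w = y p" if "p < w" "w \<le> b" for w
          using that \<open>b - a < d\<close> \<open>a \<le> p\<close> unfolding d_def by (intro d1) auto
        have "y u = x u" if "a \<le> u" "u < b" "u \<noteq> p" for u
        proof (cases "u < p")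
          case True
          then have "y u = x p"
            using that(1) \<open>0 \<le> a\<close> by (intro y_eq[of u p "x p"] left_part) linarith+
          then show ?thesis
            using left_part[of u] that(1) True by simp
        next
          case False
          then have "y u = y p"
            using that \<open>0 \<le> a\<close> by (intro y_eq[of u b "y p"] right_part) linarith+
          then show ?thesis
            using right_part[of u] that False by simp
        qed
        then have J: "{u \<in> {a..<b}. y u \<noteq> x u} = (if p < b \<and> y p \<noteq> x p then {p} else {})"
          using \<open>a \<le> p\<close> by (auto split: if_splits)
        have "x w \<in> {x p, y p}" if "w \<in> {a..b}" for w
          using that left_part[of w] right_part[of w] by (cases "w \<le> p") auto
        then have "x ` {a..b} \<subseteq> {x p, y p}"
          by blast
        then have "finite (x ` {a..b})"
          by (rule finite_subset) simp
        moreover have "x a = x p"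
          using left_part[of a] \<open>a \<le> p\<close> by simp
        moreover have "x b = (if p < b then y p else x p)"
          using right_part[of b] \<open>p \<le> b\<close> by auto
        ultimately show ?thesis
          unfolding J by auto
      qed
      then show ?thesis
        using d1(1) d2(1) by (intro exI[of _ d]) (auto simp: d_def)
    qed
  qed
  then show ?thesis
    using \<open>0 \<le> a\<close> by blast
qed

lemma (in prob_space) nn_integral_indep_mult:
  fixes X :: "'a \<Rightarrow> ennreal"
  assumes "indep_var borel X borel Y"
  shows "(\<integral>\<^sup>+\<omega>. X \<omega> * Y \<omega> \<partial>M) = (\<integral>\<^sup>+\<omega>. X \<omega> \<partial>M) * (\<integral>\<^sup>+\<omega>. Y \<omega> \<partial>M)"
proof -
  have "indep_vars (\<lambda>_. borel) (case_bool X Y) UNIV"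
    using assms unfolding indep_var_def by (rule back_subst[of "\<lambda>p. indep_vars p _ _"]) (auto split: bool.split)
  from indep_vars_nn_integral[OF _ this] show ?thesis
    by (simp add: UNIV_bool mult.commute)
qed

section \<open>Rings of the clocks\<close>

text \<open>The cells are open on the left and closed on the right, like the windows of
  \<open>tick_count\<close>. The ceiling, rather than the floor, assigns a grid point to the cell
  that it closes.\<close>

lemma grid_cell:
  fixes v u :: real
  assumes "0 < u" "u \<le> v" "0 < n"
  obtains k where "k < n" "real k * v / real n < u" "u \<le> real (Suc k) * v / real n"
proof -
  define c where "c = \<lceil>u * real n / v\<rceil>"
  have "0 < v"
    using assms by simp
  have "0 < u * real n / v"
    using assms by simp
  then have "0 < c"
    unfolding c_def by simp
  have "u * real n / v \<le> real n"
    using assms by (simp add: field_simps)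
  then have "c \<le> int n"
    unfolding c_def by (simp add: ceiling_le_iff)
  have 1: "real_of_int c - 1 < u * real n / v" "u * real n / v \<le> real_of_int c"
    unfolding c_def by linarith+
  define k where "k = nat (c - 1)"
  have "real k = real_of_int c - 1"
    using \<open>0 < c\<close> by (simp add: k_def)
  then show thesis
    using 1 \<open>0 < c\<close> \<open>c \<le> int n\<close> assms \<open>0 < v\<close>
    by (intro that[of k]) (auto simp: field_simps k_def)
qed

context clock_jump_process
begin

text \<open>As \<open>real_of_ereal \<infinity> = 0\<close>, a ring that never happens has time \<open>0\<close>, which lies outside every \<open>(0, v]\<close>.\<close>

abbreviation ring_time :: "'c \<Rightarrow> nat \<Rightarrow> 'w \<Rightarrow> real" where
  "ring_time \<epsilon> m \<omega> \<equiv> real_of_ereal (tick \<epsilon> m \<omega>)"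

text \<open>Countability is what allows null sets to be united over all clocks and sums over clocks
  to be exchanged with integrals.\<close>

lemma countable_clocks: "countable \<Xi>"
proof -
  have "\<Xi> = (\<Union>n. {\<epsilon> \<in> \<Xi>. src \<epsilon> = n})"
    by auto
  moreover have "countable (\<Union>n. {\<epsilon> \<in> \<Xi>. src \<epsilon> = n})"
    using finite_clocks by (intro countable_UN) (auto intro: countable_finite)
  ultimately show ?thesis
    by simp
qed

lemma finite_rings:
  assumes "\<epsilon> \<in> \<Xi>" "\<omega> \<in> space M"
  shows "finite {m. tick \<epsilon> m \<omega> \<le> ereal v}"
proof -
  have "\<forall>\<^sub>F m in sequentially. ereal v < tick \<epsilon> m \<omega>"
    using tick_tendsto[OF assms] by (rule order_tendstoD(1)) simp
  then obtain N where "\<And>m. m \<ge> N \<Longrightarrow> ereal v < tick \<epsilon> m \<omega>"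
    unfolding eventually_sequentially by blast
  then have "{m. tick \<epsilon> m \<omega> \<le> ereal v} \<subseteq> {..<N}"
    by (auto simp: not_le[symmetric] intro!: not_le_imp_less)
  then show ?thesis
    by (rule finite_subset) simp
qed

lemma tick_eq_ring:
  assumes "\<epsilon> \<in> \<Xi>" "\<omega> \<in> space M" "tick \<epsilon> m \<omega> < \<infinity>"
  shows "tick \<epsilon> m \<omega> = ereal (ring_time \<epsilon> m \<omega>)"
  using tick_pos[OF assms(1,2), of m] assms(3) by (cases "tick \<epsilon> m \<omega>") auto

lemma ring_nonneg:
  assumes "\<epsilon> \<in> \<Xi>" "\<omega> \<in> space M"
  shows "0 \<le> ring_time \<epsilon> m \<omega>"
  using tick_pos[OF assms, of m] by (cases "tick \<epsilon> m \<omega>") auto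

lemma ring_pos_iff:
  assumes "\<epsilon> \<in> \<Xi>" "\<omega> \<in> space M"
  shows "0 < ring_time \<epsilon> m \<omega> \<longleftrightarrow> tick \<epsilon> m \<omega> < \<infinity>"
  using tick_pos[OF assms, of m] by (cases "tick \<epsilon> m \<omega>") auto

lemma ring_interval_iff:
  assumes "\<epsilon> \<in> \<Xi>" "\<omega> \<in> space M" "0 \<le> t"
  shows "ring_time \<epsilon> m \<omega> \<in> {t<..v} \<longleftrightarrow> ereal t < tick \<epsilon> m \<omega> \<and> tick \<epsilon> m \<omega> \<le> ereal v"
  using tick_pos[OF assms(1,2), of m] assms(3) by (cases "tick \<epsilon> m \<omega>") auto

lemma ring_measurable [measurable]:
  assumes [measurable]: "\<epsilon> \<in> \<Xi>"
  shows "ring_time \<epsilon> m \<in> borel_measurable M"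
  using tick_measurable[OF assms, of m] by measurable

lemma finite_rings_interval:
  assumes "\<epsilon> \<in> \<Xi>" "\<omega> \<in> space M" "0 \<le> t"
  shows "finite {m. ring_time \<epsilon> m \<omega> \<in> {t<..v}}"
  using finite_rings[OF assms(1,2), of v] ring_interval_iff[OF assms]
  by (auto elim!: finite_subset[rotated])

text \<open>Turns the number of rings into a sum over ring indices, the form in which it appears as
  a factor in sums of state functions over rings.\<close>

lemma tick_count_eq_suminf:
  assumes "\<epsilon> \<in> \<Xi>" "\<omega> \<in> space M" "0 \<le> t"
  shows "ennreal (real (tick_count tick \<epsilon> t v \<omega>)) = (\<Sum>m. indicator {t<..v} (ring_time \<epsilon> m \<omega>))"
proof -
  have "(\<Sum>m. indicator {t<..v} (ring_time \<epsilon> m \<omega>) :: ennreal) =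
      (\<Sum>m\<in>{m. ring_time \<epsilon> m \<omega> \<in> {t<..v}}. indicator {t<..v} (ring_time \<epsilon> m \<omega>))"
    by (rule suminf_finite[OF finite_rings_interval[OF assms]]) auto
  also have "\<dots> = of_nat (card {m. ring_time \<epsilon> m \<omega> \<in> {t<..v}})"
    by simp
  also have "\<dots> = ennreal (real (tick_count tick \<epsilon> t v \<omega>))"
    unfolding tick_count_def ring_interval_iff[OF assms] by (simp add: ennreal_of_nat_eq_real_of_nat)
  finally show ?thesis ..
qed

lemma tick_count_measurable:
  assumes "\<epsilon> \<in> \<Xi>" "0 \<le> t" "t \<le> v"
  shows "tick_count tick \<epsilon> t v \<in> M \<rightarrow>\<^sub>M count_space UNIV"
  using clocks_indep[OF assms(2,3)] assms(1) by (auto simp: indep_vars_def)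

lemma nn_integral_tick_count:
  assumes "\<epsilon> \<in> \<Xi>" "0 \<le> t" "t \<le> v"
  shows "(\<integral>\<^sup>+\<omega>. ennreal (real (tick_count tick \<epsilon> t v \<omega>)) \<partial>M) = ennreal (rate \<epsilon> * (v - t))"
proof -
  note [measurable] = tick_count_measurable[OF assms]
  define N where "N = tick_count tick \<epsilon> t v"
  have [measurable]: "N \<in> M \<rightarrow>\<^sub>M count_space UNIV"
    unfolding N_def by simp
  define r where "r = rate \<epsilon> * (v - t)"
  have "0 \<le> r"
    using rate_nonneg[OF assms(1)] assms(3) by (simp add: r_def)
  \<comment> \<open>The series for the mean is the exponential series shifted by one index:
    \<open>k * r^k / k!\<close> equals \<open>r * r^(k-1) / (k-1)!\<close>, and the term for
    \<open>k = 0\<close> vanishes.\<close>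
  have "(\<lambda>k. r * (inverse (fact k) *\<^sub>R r ^ k) * exp (- r)) sums (r * exp r * exp (- r))"
    by (intro sums_mult sums_mult2 exp_converges)
  then have "(\<lambda>k. real (Suc k) * (r ^ Suc k / fact (Suc k) * exp (- r))) sums r"
    by (simp add: exp_minus field_simps del: of_nat_Suc)
  then have sums: "(\<lambda>k. real k * (r ^ k / fact k * exp (- r))) sums r"
    by (subst (asm) sums_Suc_iff) simp
  have "ennreal (real (N \<omega>)) = (\<Sum>k. ennreal (real k) * indicator {\<omega> \<in> space M. N \<omega> = k} \<omega>)"
    if "\<omega> \<in> space M" for \<omega>
    using that by (subst suminf_finite[of "{N \<omega>}"]) auto
  then have "(\<integral>\<^sup>+\<omega>. ennreal (real (N \<omega>)) \<partial>M) =
      (\<integral>\<^sup>+\<omega>. (\<Sum>k. ennreal (real k) * indicator {\<omega> \<in> space M. N \<omega> = k} \<omega>) \<partial>M)"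
    by (intro nn_integral_cong)
  also have "\<dots> = (\<Sum>k. ennreal (real k) * emeasure M {\<omega> \<in> space M. N \<omega> = k})"
    by (simp add: nn_integral_suminf nn_integral_cmult_indicator)
  also have "\<dots> = (\<Sum>k. ennreal (real k * (r ^ k / fact k * exp (- r))))"
  proof (rule suminf_cong)
    fix k
    have "emeasure M {\<omega> \<in> space M. N \<omega> = k} = ennreal (r ^ k / fact k * exp (- r))"
      unfolding emeasure_eq_measure N_def r_def poisson_increments[OF assms] ..
    then show "ennreal (real k) * emeasure M {\<omega> \<in> space M. N \<omega> = k} =
        ennreal (real k * (r ^ k / fact k * exp (- r)))"
      using \<open>0 \<le> r\<close> by (subst ennreal_mult) auto
  qed
  also have "\<dots> = ennreal (\<Sum>k. real k * (r ^ k / fact k * exp (- r)))"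
    using \<open>0 \<le> r\<close> sums by (intro suminf_ennreal2) (auto dest: sums_summable)
  also have "\<dots> = ennreal r"
    using sums by (simp add: sums_iff)
  finally show ?thesis
    by (simp add: N_def r_def)
qed

lemma prob_tick_count_pos:
  assumes "\<epsilon> \<in> \<Xi>" "0 \<le> t" "t \<le> v"
  shows "prob {\<omega> \<in> space M. 0 < tick_count tick \<epsilon> t v \<omega>} \<le> rate \<epsilon> * (v - t)"
proof -
  note [measurable] = tick_count_measurable[OF assms]
  have "prob {\<omega> \<in> space M. 0 < tick_count tick \<epsilon> t v \<omega>} =
      1 - prob {\<omega> \<in> space M. tick_count tick \<epsilon> t v \<omega> = 0}"
    by (subst prob_compl[symmetric]) (auto intro!: arg_cong[where f=prob])
  also have "\<dots> = 1 - exp (- (rate \<epsilon> * (v - t)))"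
    unfolding poisson_increments[OF assms] by simp
  also have "\<dots> \<le> rate \<epsilon> * (v - t)"
    using exp_ge_add_one_self[of "- (rate \<epsilon> * (v - t))"] by simp
  finally show ?thesis .
qed

lemma tick_count_pos:
  assumes "\<epsilon> \<in> \<Xi>" "\<omega> \<in> space M" "0 \<le> t" "ereal t < tick \<epsilon> m \<omega>" "tick \<epsilon> m \<omega> \<le> ereal v"
  shows "0 < tick_count tick \<epsilon> t v \<omega>"
  unfolding tick_count_def
  using assms(4,5) finite_rings[OF assms(1,2), of v]
  by (subst card_gt_0_iff) (auto elim!: finite_subset[rotated])

text \<open>A ring at \<open>t > 0\<close> forces a positive count in every window that ends at
  \<open>t\<close>, and this has probability at most the rate times the length of the
  window.\<close>

lemma AE_no_ring_at:
  assumes "0 \<le> t"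
  shows "AE \<omega> in M. \<forall>\<epsilon>\<in>\<Xi>. \<forall>m. tick \<epsilon> m \<omega> \<noteq> ereal t"
proof (cases "t = 0")
  case True
  then show ?thesis
    using tick_pos by (intro AE_I2) (metis order_less_irrefl zero_ereal_def)
next
  case False
  with assms have "0 < t" by simp
  have "AE \<omega> in M. tick \<epsilon> m \<omega> \<noteq> ereal t" if \<epsilon>: "\<epsilon> \<in> \<Xi>" for \<epsilon> m
  proof -
    note [measurable] = tick_measurable[OF \<epsilon>]
    let ?A = "{\<omega> \<in> space M. tick \<epsilon> m \<omega> = ereal t}"
    have "prob ?A \<le> rate \<epsilon> * (t / real (Suc n))" for n
    proof -
      \<comment> \<open>The length of the window is \<open>t / (n + 1)\<close>, a fraction of
        \<open>t\<close>, so that the window starts at a nonnegative time for every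
        \<open>n\<close>.\<close>
      define s where "s = t - t / real (Suc n)"
      have s: "0 \<le> s" "s < t"
        using \<open>0 < t\<close> by (auto simp: s_def field_simps)
      note [measurable] = tick_count_measurable[OF \<epsilon> s(1) less_imp_le[OF s(2)]]
      have "prob ?A \<le> prob {\<omega> \<in> space M. 0 < tick_count tick \<epsilon> s t \<omega>}"
        using s by (intro finite_measure_mono) (auto intro!: tick_count_pos[OF \<epsilon> _ s(1), of _ m])
      also have "\<dots> \<le> rate \<epsilon> * (t - s)"
        using s by (intro prob_tick_count_pos[OF \<epsilon>]) auto
      finally show ?thesis
        by (simp add: s_def)
    qed
    moreover have "(\<lambda>n. rate \<epsilon> * (t / real (Suc n))) \<longlonglongrightarrow> rate \<epsilon> * 0"
      by (intro tendsto_mult_left LIMSEQ_Suc[OF lim_const_over_n])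
    ultimately have "prob ?A \<le> rate \<epsilon> * 0"
      by (intro LIMSEQ_le_const) auto
    then have "prob ?A = 0"
      using measure_nonneg[of M ?A] by simp
    then show ?thesis
      by (subst AE_iff_measurable[of ?A]) (auto simp: emeasure_eq_measure)
  qed
  then show ?thesis
    using countable_clocks by (simp add: AE_ball_countable AE_all_countable)
qed

text \<open>
  In each of \<open>n\<close> cells of length \<open>v/n\<close>, two given independent clocks both ring with probability
  \<open>O(1/n\<^sup>2)\<close>.
\<close>

lemma AE_rings_distinct:
  "AE \<omega> in M. \<forall>\<epsilon>\<in>\<Xi>. \<forall>\<epsilon>'\<in>\<Xi>. \<forall>m m'. tick \<epsilon> m \<omega> = tick \<epsilon>' m' \<omega> \<longrightarrow> tick \<epsilon> m \<omega> < \<infinity> \<longrightarrow> \<epsilon> = \<epsilon>'"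
proof -
  \<comment> \<open>The integer horizon \<open>V\<close> makes the grid finite; countably many
    horizons exhaust all finite ring times.\<close>
  have "AE \<omega> in M. tick \<epsilon> m \<omega> = tick \<epsilon>' m' \<omega> \<longrightarrow> \<not> tick \<epsilon> m \<omega> \<le> ereal (real V)"
    if \<epsilon>: "\<epsilon> \<in> \<Xi>" and \<epsilon>': "\<epsilon>' \<in> \<Xi>" and neq: "\<epsilon> \<noteq> \<epsilon>'" for \<epsilon> \<epsilon>' m m' V
  proof -
    note [measurable] = tick_measurable[OF \<epsilon>] tick_measurable[OF \<epsilon>']
    define v where "v = real V"
    let ?A = "{\<omega> \<in> space M. tick \<epsilon> m \<omega> = tick \<epsilon>' m' \<omega> \<and> tick \<epsilon> m \<omega> \<le> ereal v}"
    have "0 \<le> v"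
      by (simp add: v_def)
    \<comment> \<open>A cell of length \<open>v / (n + 1)\<close> contributes at most
      \<open>c / (n + 1)^2\<close>, so the \<open>n + 1\<close> cells together contribute
      \<open>c / (n + 1)\<close>.\<close>
    define c where "c = rate \<epsilon> * rate \<epsilon>' * v\<^sup>2"
    have bound: "prob ?A \<le> c / real (Suc n)" for n
    proof -
      define s where "s k = real k * v / real (Suc n)" for k
      let ?C = "\<lambda>k. {\<omega> \<in> space M. 0 < tick_count tick \<epsilon> (s k) (s (Suc k)) \<omega>}"
      let ?C' = "\<lambda>k. {\<omega> \<in> space M. 0 < tick_count tick \<epsilon>' (s k) (s (Suc k)) \<omega>}"
      have s: "0 \<le> s k" "s k \<le> s (Suc k)" "s (Suc k) - s k = v / real (Suc n)" for k
        using \<open>0 \<le> v\<close> unfolding s_def diff_divide_distrib[symmetric] left_diff_distrib[symmetric]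
        by (auto intro!: divide_right_mono mult_right_mono)
      note [measurable] = tick_count_measurable[OF \<epsilon> s(1,2)] tick_count_measurable[OF \<epsilon>' s(1,2)]
      have "?A \<subseteq> (\<Union>k\<in>{..<Suc n}. ?C k \<inter> ?C' k)"
      proof
        fix \<omega> assume \<omega>: "\<omega> \<in> ?A"
        then have r: "0 < ring_time \<epsilon> m \<omega>" "ring_time \<epsilon> m \<omega> \<le> v" and fin: "tick \<epsilon> m \<omega> < \<infinity>"
          using ring_interval_iff[OF \<epsilon>, of \<omega> 0 m v] tick_pos[OF \<epsilon>, of \<omega> m] by (auto simp: zero_ereal_def)
        obtain k where k: "k < Suc n" "s k < ring_time \<epsilon> m \<omega>" "ring_time \<epsilon> m \<omega> \<le> s (Suc k)"
          unfolding s_def by (rule grid_cell[OF r, of "Suc n"]) auto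
        then have "ereal (s k) < tick \<epsilon> m \<omega>" "tick \<epsilon> m \<omega> \<le> ereal (s (Suc k))"
          using tick_eq_ring[OF \<epsilon> _ fin] \<omega> by (metis (lifting) mem_Collect_eq ereal_less_eq(3) less_ereal.simps(1))+
        with \<omega> show "\<omega> \<in> (\<Union>k\<in>{..<Suc n}. ?C k \<inter> ?C' k)"
          using tick_count_pos[OF \<epsilon> _ s(1), of \<omega> k m] tick_count_pos[OF \<epsilon>' _ s(1), of \<omega> k m'] k(1) by auto
      qed
      then have "prob ?A \<le> prob (\<Union>k\<in>{..<Suc n}. ?C k \<inter> ?C' k)"
        by (intro finite_measure_mono) auto
      also have "\<dots> \<le> (\<Sum>k\<in>{..<Suc n}. prob (?C k \<inter> ?C' k))"
        by (intro finite_measure_subadditive_finite) auto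
      also have "\<dots> \<le> (\<Sum>k\<in>{..<Suc n}. c / (real (Suc n))\<^sup>2)"
      proof (rule sum_mono)
        fix k
        have "indep_vars (\<lambda>_. count_space UNIV) (\<lambda>\<epsilon>. tick_count tick \<epsilon> (s k) (s (Suc k))) {\<epsilon>, \<epsilon>'}"
          using clocks_indep[OF s(1,2)] by (rule indep_vars_subset) (use \<epsilon> \<epsilon>' in auto)
        then have "prob (\<Inter>e\<in>{\<epsilon>, \<epsilon>'}. tick_count tick e (s k) (s (Suc k)) -` {0<..} \<inter> space M) =
            (\<Prod>e\<in>{\<epsilon>, \<epsilon>'}. prob (tick_count tick e (s k) (s (Suc k)) -` {0<..} \<inter> space M))"
          by (rule indep_varsD) auto
        then have "prob (?C k \<inter> ?C' k) = prob (?C k) * prob (?C' k)"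
          using neq by (simp add: vimage_def Int_def conj_commute)
        also have "\<dots> \<le> (rate \<epsilon> * (v / real (Suc n))) * (rate \<epsilon>' * (v / real (Suc n)))"
          using prob_tick_count_pos[OF \<epsilon> s(1,2)[of k]] prob_tick_count_pos[OF \<epsilon>' s(1,2)[of k]]
            rate_nonneg[OF \<epsilon>] \<open>0 \<le> v\<close>
          unfolding s(3) by (intro mult_mono) auto
        also have "\<dots> = c / (real (Suc n))\<^sup>2"
          by (simp add: c_def power2_eq_square)
        finally show "prob (?C k \<inter> ?C' k) \<le> c / (real (Suc n))\<^sup>2" .
      qed
      also have "\<dots> = c / real (Suc n)"
        by (simp add: power2_eq_square)
      finally show ?thesis .
    qed
    have "prob ?A \<le> 0"
      by (rule LIMSEQ_le_const[OF LIMSEQ_Suc[OF lim_const_over_n[of c]]]) (use bound in auto)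
    then have "prob ?A = 0"
      using measure_nonneg[of M ?A] by simp
    then show ?thesis
      unfolding v_def by (subst AE_iff_measurable[of ?A]) (auto simp: emeasure_eq_measure v_def)
  qed
  then have "AE \<omega> in M. \<epsilon> \<noteq> \<epsilon>' \<longrightarrow> (tick \<epsilon> m \<omega> = tick \<epsilon>' m' \<omega> \<longrightarrow> \<not> tick \<epsilon> m \<omega> \<le> ereal (real V))"
    if "\<epsilon> \<in> \<Xi>" "\<epsilon>' \<in> \<Xi>" for \<epsilon> \<epsilon>' m m' V
    using that by (cases "\<epsilon> = \<epsilon>'") auto
  then have "AE \<omega> in M. \<forall>\<epsilon>\<in>\<Xi>. \<forall>\<epsilon>'\<in>\<Xi>. \<forall>m m' V.
      \<epsilon> \<noteq> \<epsilon>' \<longrightarrow> (tick \<epsilon> m \<omega> = tick \<epsilon>' m' \<omega> \<longrightarrow> \<not> tick \<epsilon> m \<omega> \<le> ereal (real V))"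
    by (simp only: AE_ball_countable[OF countable_clocks] AE_all_countable) blast
  then show ?thesis
  proof eventually_elim
    case (elim \<omega>)
    show ?case
    proof (intro ballI allI impI, rule ccontr)
      fix \<epsilon> \<epsilon>' m m'
      assume *: "\<epsilon> \<in> \<Xi>" "\<epsilon>' \<in> \<Xi>" "tick \<epsilon> m \<omega> = tick \<epsilon>' m' \<omega>" "\<epsilon> \<noteq> \<epsilon>'" and "tick \<epsilon> m \<omega> < \<infinity>"
      then obtain V :: nat where "tick \<epsilon> m \<omega> < ereal (real V)"
        using less_PInf_Ex_of_nat[of "tick \<epsilon> m \<omega>"] by auto
      moreover have "\<not> tick \<epsilon> m \<omega> \<le> ereal (real V)"
        using elim * by blast
      ultimately show False
        by simp
    qed
  qed
qed

end

section \<open>The state before and after a ring\<close>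

text \<open>Ceiling minus one gives the largest integer strictly below \<open>u * 2 ^ n\<close>.
  Strictness matters: a path is known to be constant to the left of \<open>u\<close>, and the
  approximants must enter that punctured neighbourhood.\<close>

lemma dyadic_below:
  fixes u :: real
  assumes "0 < u"
  shows "filterlim (\<lambda>n. max 0 (real_of_int (\<lceil>u * 2 ^ n\<rceil> - 1) / 2 ^ n)) (at_left u) sequentially"
proof -
  have *: "real_of_int (\<lceil>u * 2 ^ n\<rceil> - 1) / 2 ^ n < u" "u - (1/2) ^ n \<le> real_of_int (\<lceil>u * 2 ^ n\<rceil> - 1) / 2 ^ n" for n
  proof -
    have "real_of_int (\<lceil>u * 2 ^ n\<rceil> - 1) < u * 2 ^ n" "u * 2 ^ n - 1 \<le> real_of_int (\<lceil>u * 2 ^ n\<rceil> - 1)"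
      by linarith+
    then show "real_of_int (\<lceil>u * 2 ^ n\<rceil> - 1) / 2 ^ n < u"
        "u - (1/2) ^ n \<le> real_of_int (\<lceil>u * 2 ^ n\<rceil> - 1) / 2 ^ n"
      by (simp_all add: field_simps power_divide)
  qed
  define q where "q n = max 0 (real_of_int (\<lceil>u * 2 ^ n\<rceil> - 1) / 2 ^ n)" for n :: nat
  have q: "q n < u" "u - (1/2) ^ n \<le> q n" for n
    using *[of n] assms unfolding q_def by linarith+
  have "(\<lambda>n. u - (1/2) ^ n) \<longlonglongrightarrow> u - 0"
    by (intro tendsto_intros LIMSEQ_power_zero) auto
  then have "q \<longlonglongrightarrow> u"
    by (intro tendsto_sandwich[of "\<lambda>n. u - (1/2) ^ n" q _ "\<lambda>_. u"] always_eventually allI q less_imp_le[OF q(1)])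
      simp_all
  then have "filterlim q (at_left u) sequentially"
    using q(1) by (simp add: filterlim_at less_imp_neq)
  then show ?thesis
    by (simp add: q_def[abs_def])
qed

text \<open>Floor plus one is strictly above \<open>u * 2 ^ n\<close> even when that number is an
  integer, so the approximants never hit \<open>u\<close>, where the state may still be the one
  before a jump.\<close>

lemma dyadic_above:
  fixes u :: real
  assumes "0 \<le> u"
  shows "filterlim (\<lambda>n. max 0 (real_of_int (\<lfloor>u * 2 ^ n\<rfloor> + 1) / 2 ^ n)) (at_right u) sequentially"
proof -
  have *: "u < real_of_int (\<lfloor>u * 2 ^ n\<rfloor> + 1) / 2 ^ n" "real_of_int (\<lfloor>u * 2 ^ n\<rfloor> + 1) / 2 ^ n \<le> u + (1/2) ^ n" for n
  proof -
    have "u * 2 ^ n < real_of_int (\<lfloor>u * 2 ^ n\<rfloor> + 1)" "real_of_int (\<lfloor>u * 2 ^ n\<rfloor> + 1) \<le> u * 2 ^ n + 1"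
      by linarith+
    then show "u < real_of_int (\<lfloor>u * 2 ^ n\<rfloor> + 1) / 2 ^ n"
        "real_of_int (\<lfloor>u * 2 ^ n\<rfloor> + 1) / 2 ^ n \<le> u + (1/2) ^ n"
      by (simp_all add: field_simps power_divide)
  qed
  then have pos: "0 < real_of_int (\<lfloor>u * 2 ^ n\<rfloor> + 1) / 2 ^ n" for n
    using assms le_less_trans by blast
  define q where "q n = max 0 (real_of_int (\<lfloor>u * 2 ^ n\<rfloor> + 1) / 2 ^ n)" for n :: nat
  have q: "u < q n" "q n \<le> u + (1/2) ^ n" for n
    using *[of n] pos[of n] unfolding q_def by linarith+
  have "(\<lambda>n. u + (1/2) ^ n) \<longlonglongrightarrow> u + 0"
    by (intro tendsto_intros LIMSEQ_power_zero) auto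
  then have "q \<longlonglongrightarrow> u"
    by (intro tendsto_sandwich[of "\<lambda>_. u" q _ "\<lambda>n. u + (1/2) ^ n"] always_eventually allI q less_imp_le[OF q(1)])
      simp_all
  then have "filterlim q (at_right u) sequentially"
    using q(1) less_imp_neq[OF q(1), symmetric] by (simp add: filterlim_at)
  then show ?thesis
    by (simp add: q_def[abs_def])
qed

context clock_jump_process
begin

lemma eventually_post_state:
  assumes "\<omega> \<in> space M" "0 \<le> t"
  shows "\<forall>\<^sub>F u in at_right t. S u \<omega> = post_state S t \<omega>"
proof -
  obtain y where y: "\<forall>\<^sub>F u in at_right t. S u \<omega> = y"
    using right_constant[OF assms] by blast
  have "post_state S t \<omega> = y"
    unfolding post_state_def
  proof (rule the_equality, rule y)
    fix z assume "\<forall>\<^sub>F u in at_right t. S u \<omega> = z"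
    with y have "\<forall>\<^sub>F u in at_right t. z = y"
      by eventually_elim simp
    then show "z = y"
      by simp
  qed
  with y show ?thesis
    by simp
qed

lemma S_space: "0 \<le> t \<Longrightarrow> \<omega> \<in> space M \<Longrightarrow> S t \<omega> \<in> space E"
  using S_measurable[of t] by (auto dest: measurable_space)

text \<open>A time with countably many values reduces measurability to fixed times. The maximum with
  0 turns every integer into an admissible time.\<close>

lemma S_discretized_measurable:
  fixes k :: "'w \<Rightarrow> int" and c :: real
  assumes "k \<in> M \<rightarrow>\<^sub>M count_space UNIV"
  shows "(\<lambda>\<omega>. S (max 0 (real_of_int (k \<omega>) / c)) \<omega>) \<in> M \<rightarrow>\<^sub>M E"
  by (rule measurable_compose_countable[OF _ assms, of "\<lambda>i. S (max 0 (real_of_int i / c))"])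
    (intro S_measurable, simp)

text \<open>Dyadic times strictly below \<open>R\<close> see a state that is eventually the state at
  \<open>R\<close>, since paths are constant just before any positive time.\<close>

lemma S_random_time_measurable:
  assumes [measurable]: "R \<in> borel_measurable M" and nonneg: "\<And>\<omega>. \<omega> \<in> space M \<Longrightarrow> 0 \<le> R \<omega>"
  shows "(\<lambda>\<omega>. S (R \<omega>) \<omega>) \<in> M \<rightarrow>\<^sub>M E"
proof (rule measurable_eventually_const)
  fix n :: nat
  have [measurable]: "(\<lambda>\<omega>. \<lceil>R \<omega> * 2 ^ n\<rceil> - 1) \<in> M \<rightarrow>\<^sub>M count_space UNIV"
    by measurable
  show "(\<lambda>\<omega>. S (max 0 (real_of_int (\<lceil>R \<omega> * 2 ^ n\<rceil> - 1) / 2 ^ n)) \<omega>) \<in> M \<rightarrow>\<^sub>M E"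
    by (rule S_discretized_measurable) measurable
next
  fix \<omega> assume \<omega>: "\<omega> \<in> space M"
  show "\<forall>\<^sub>F n in sequentially. S (max 0 (real_of_int (\<lceil>R \<omega> * 2 ^ n\<rceil> - 1) / 2 ^ n)) \<omega> = S (R \<omega>) \<omega>"
  proof (cases "R \<omega> = 0")
    case True
    \<comment> \<open>There is nothing to the left of time 0; here the maximum makes every
      approximant equal to 0, so the state is exact from the start.\<close>
    have "max 0 (- 1 / 2 ^ n) = (0::real)" for n :: nat
      by (simp add: max_def not_le)
    with True show ?thesis
      by simp
  next
    case False
    with nonneg[OF \<omega>] have "0 < R \<omega>"
      by simp
    from left_constant[OF \<omega> this] dyadic_below[OF this] show ?thesis
      by (rule eventually_compose_filterlim)
  qed
qed

text \<open>Approximation from above replaces the one from below: the states strictly after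
  \<open>R\<close> are eventually the state after the jump. Time 0 needs no special case on this
  side.\<close>

lemma post_state_random_time_measurable:
  assumes [measurable]: "R \<in> borel_measurable M" and nonneg: "\<And>\<omega>. \<omega> \<in> space M \<Longrightarrow> 0 \<le> R \<omega>"
  shows "(\<lambda>\<omega>. post_state S (R \<omega>) \<omega>) \<in> M \<rightarrow>\<^sub>M E"
proof (rule measurable_eventually_const)
  fix n :: nat
  have [measurable]: "(\<lambda>\<omega>. \<lfloor>R \<omega> * 2 ^ n\<rfloor> + 1) \<in> M \<rightarrow>\<^sub>M count_space UNIV"
    by measurable
  show "(\<lambda>\<omega>. S (max 0 (real_of_int (\<lfloor>R \<omega> * 2 ^ n\<rfloor> + 1) / 2 ^ n)) \<omega>) \<in> M \<rightarrow>\<^sub>M E"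
    by (rule S_discretized_measurable) measurable
next
  fix \<omega> assume \<omega>: "\<omega> \<in> space M"
  from eventually_post_state[OF \<omega> nonneg[OF \<omega>]] dyadic_above[OF nonneg[OF \<omega>]]
  show "\<forall>\<^sub>F n in sequentially. S (max 0 (real_of_int (\<lfloor>R \<omega> * 2 ^ n\<rfloor> + 1) / 2 ^ n)) \<omega> = post_state S (R \<omega>) \<omega>"
    by (rule eventually_compose_filterlim)
qed

lemma AE_post_state_eq:
  assumes "0 \<le> t"
  shows "AE \<omega> in M. post_state S t \<omega> = S t \<omega>"
  using AE_no_ring_at[OF assms] AE_space
  by eventually_elim (use jumps_at_events[OF _ assms] in blast)

lemma AE_eventually_state_eq:
  assumes "0 \<le> t"
  shows "AE \<omega> in M. \<forall>\<^sub>F u in at t within {0..}. S u \<omega> = S t \<omega>"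
  using AE_post_state_eq[OF assms] AE_space
proof eventually_elim
  case (elim \<omega>)
  have right: "\<forall>\<^sub>F u in at_right t. S u \<omega> = S t \<omega>"
    using eventually_post_state[OF elim(2) assms] elim(1) by simp
  show ?case
  proof (cases "t = 0")
    case True
    then show ?thesis
      using right by (simp add: at_within_Ici_at_right)
  next
    case False
    with assms have "0 < t" by simp
    have "\<forall>\<^sub>F u in at t. S u \<omega> = S t \<omega>"
      using left_constant[OF elim(2) \<open>0 < t\<close>] right by (simp add: eventually_at_split)
    then show ?thesis
      by (rule filter_leD[OF at_le, rotated]) simp
  qed
qed

text \<open>Individual paths do jump, but almost none of them at the given time \<open>t\<close>, so
  dominated convergence applies at each \<open>t\<close> with a null set that depends on
  \<open>t\<close>.\<close>

lemma continuous_on_expectation: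
  fixes h :: "state \<Rightarrow> real"
  assumes [measurable]: "h \<in> borel_measurable E" and bound: "\<And>y. y \<in> space E \<Longrightarrow> \<bar>h y\<bar> \<le> C"
  shows "continuous_on {0..} (\<lambda>u. LINT \<omega>|M. h (S u \<omega>))"
proof (rule continuous_on_sequentiallyI)
  fix x :: "nat \<Rightarrow> real" and t
  assume x: "\<forall>n. x n \<in> {0..}" "t \<in> {0..}" "x \<longlonglongrightarrow> t"
  have [measurable]: "S t \<in> M \<rightarrow>\<^sub>M E" "S (x n) \<in> M \<rightarrow>\<^sub>M E" for n
    using x by (auto intro: S_measurable)
  show "(\<lambda>n. LINT \<omega>|M. h (S (x n) \<omega>)) \<longlonglongrightarrow> (LINT \<omega>|M. h (S t \<omega>))"
  proof (rule integral_dominated_convergence[where w="\<lambda>_. C"])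
    show "AE \<omega> in M. (\<lambda>n. h (S (x n) \<omega>)) \<longlonglongrightarrow> h (S t \<omega>)"
      using AE_eventually_state_eq[OF atLeast_iff[THEN iffD1, OF x(2)]]
    proof eventually_elim
      case (elim \<omega>)
      then have "\<forall>\<^sub>F u in nhds t. u \<in> {0..} \<longrightarrow> S u \<omega> = S t \<omega>"
        unfolding eventually_at_filter by (rule eventually_mono) auto
      with x(3) have "\<forall>\<^sub>F n in sequentially. x n \<in> {0..} \<longrightarrow> S (x n) \<omega> = S t \<omega>"
        by (rule eventually_compose_filterlim[rotated])
      then show ?case
        using x(1) by (intro tendsto_eventually) (auto elim: eventually_mono)
    qed
    show "AE \<omega> in M. norm (h (S (x n) \<omega>)) \<le> C" for n
      using x(1) by (intro AE_I2) (simp add: bound S_space)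
  qed auto
qed

end

text \<open>The cells partition \<open>(0, v]\<close>, so only the one containing \<open>u\<close>
  contributes. Its left end \<open>c\<close> is strictly below \<open>u\<close> and at most one mesh
  away, and it is the same for all \<open>H\<close>, hence later the same for all paths.\<close>

lemma grid_sum:
  fixes u v :: real
  assumes "0 < u" "u \<le> v"
  obtains c where "0 \<le> c" "c < u" "u - v / real (Suc n) \<le> c"
    "\<And>H :: real \<Rightarrow> ennreal.
      (\<Sum>k<Suc n. indicator {real k * v / real (Suc n)<..real (Suc k) * v / real (Suc n)} u *
        H (real k * v / real (Suc n))) = H c"
proof -
  obtain k where k: "k < Suc n" "real k * v / real (Suc n) < u" "u \<le> real (Suc k) * v / real (Suc n)"
    using grid_cell[OF assms, of "Suc n"] by blast
  have "0 \<le> v"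
    using assms by simp
  define c where "c = real k * v / real (Suc n)"
  have Suc_c: "real (Suc k) * v / real (Suc n) = c + v / real (Suc n)"
    unfolding c_def add_divide_distrib[symmetric] by (simp add: algebra_simps)
  have "indicator {real k' * v / real (Suc n)<..real (Suc k') * v / real (Suc n)} u = (0::ennreal)"
    if "k' \<noteq> k" for k'
  proof (cases "k' < k")
    case True
    then have "real (Suc k') * v / real (Suc n) \<le> real k * v / real (Suc n)"
      using \<open>0 \<le> v\<close> by (intro divide_right_mono mult_right_mono) auto
    then show ?thesis
      using k(2) by (auto simp: indicator_def)
  next
    case False
    then have "real (Suc k) * v / real (Suc n) \<le> real k' * v / real (Suc n)"
      using \<open>0 \<le> v\<close> that by (intro divide_right_mono mult_right_mono) auto
    then show ?thesis
      using k(3) by (auto simp: indicator_def)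
  qed
  then have "(\<Sum>k<Suc n. indicator {real k * v / real (Suc n)<..real (Suc k) * v / real (Suc n)} u *
        H (real k * v / real (Suc n))) = H c" for H :: "real \<Rightarrow> ennreal"
    using k by (subst sum.remove[of _ k]) (auto simp: c_def simp del: of_nat_Suc)
  then show thesis
    using k \<open>0 \<le> v\<close> Suc_c by (intro that[of c]) (auto simp: c_def simp del: of_nat_Suc)
qed

section \<open>Expected sums over the rings of one clock\<close>

context clock_jump_process
begin

text \<open>The state at \<open>t\<close> belongs to the history up to \<open>t\<close>, and the
  count on \<open>(t, v]\<close> to the sigma-algebra that \<open>history_indep\<close> declares
  independent of it; two inclusions of generated sigma-algebras suffice.\<close>

lemma indep_var_state_tick_count:
  fixes h :: "state \<Rightarrow> ennreal"
  assumes "\<epsilon> \<in> \<Xi>" "0 \<le> t" "t \<le> v" and h [measurable]: "h \<in> borel_measurable E"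
  shows "indep_var borel (\<lambda>\<omega>. h (S t \<omega>)) borel (\<lambda>\<omega>. ennreal (real (tick_count tick \<epsilon> t v \<omega>)))"
proof -
  note [measurable] = tick_count_measurable[OF assms(1-3)] S_measurable[OF assms(2)]
  let ?N = "\<lambda>\<omega>. ennreal (real (tick_count tick \<epsilon> t v \<omega>))"
  let ?G = "{{\<omega> \<in> space M. tick_count tick \<epsilon> t v \<omega> = k} |\<epsilon> k. \<epsilon> \<in> \<Xi>}"
  have "sigma_sets (space M) {(\<lambda>\<omega>. h (S t \<omega>)) -` A \<inter> space M |A. A \<in> sets borel} \<subseteq> history M E \<Xi> S tick t"
    unfolding history_def
  proof (rule sigma_sets_mono', rule subsetI)
    fix X assume "X \<in> {(\<lambda>\<omega>. h (S t \<omega>)) -` A \<inter> space M |A. A \<in> sets borel}"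
    then obtain A where "A \<in> sets borel" and X: "X = (\<lambda>\<omega>. h (S t \<omega>)) -` A \<inter> space M"
      by blast
    then have "h -` A \<inter> space E \<in> sets E"
      by measurable
    moreover have "(\<lambda>\<omega>. h (S t \<omega>)) -` A \<inter> space M = S t -` (h -` A \<inter> space E) \<inter> space M"
      using S_space[OF assms(2)] by auto
    ultimately have "(\<lambda>\<omega>. h (S t \<omega>)) -` A \<inter> space M \<in> {S u -` B \<inter> space M |u B. 0 \<le> u \<and> u \<le> t \<and> B \<in> sets E}"
      using assms(2) by blast
    then show "X \<in> {S u -` B \<inter> space M |u B. 0 \<le> u \<and> u \<le> t \<and> B \<in> sets E} \<union>
        {{\<omega> \<in> space M. tick \<epsilon> m \<omega> \<le> ereal u} |\<epsilon> m u. \<epsilon> \<in> \<Xi> \<and> 0 \<le> u \<and> u \<le> t}"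
      unfolding X by blast
  qed
  moreover have "sigma_sets (space M) {?N -` A \<inter> space M |A. A \<in> sets borel} \<subseteq> sigma_sets (space M) ?G"
  proof (rule sigma_sets_mono, clarify)
    fix A :: "ennreal set"
    have "?N -` A \<inter> space M = (\<Union>k\<in>{k. ennreal (real k) \<in> A}. {\<omega> \<in> space M. tick_count tick \<epsilon> t v \<omega> = k})"
      by auto
    also have "\<dots> \<in> sigma_sets (space M) ?G"
      using assms(1) by (intro sigma_sets_UNION) (auto intro!: sigma_sets.Basic)
    finally show "?N -` A \<inter> space M \<in> sigma_sets (space M) ?G" .
  qed
  moreover have "random_variable borel (\<lambda>\<omega>. h (S t \<omega>))" "random_variable borel ?N"
    by measurable
  ultimately show ?thesis
    unfolding indep_var_eq indep_sets2_eq using history_indep[OF assms(2,3), unfolded indep_sets2_eq]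
    by (meson subset_iff)
qed

lemma nn_integral_state_tick_count:
  fixes h :: "state \<Rightarrow> ennreal"
  assumes "\<epsilon> \<in> \<Xi>" "0 \<le> t" "t \<le> v" and [measurable]: "h \<in> borel_measurable E"
  shows "(\<integral>\<^sup>+\<omega>. h (S t \<omega>) * ennreal (real (tick_count tick \<epsilon> t v \<omega>)) \<partial>M) =
    (\<integral>\<^sup>+\<omega>. h (S t \<omega>) \<partial>M) * ennreal (rate \<epsilon> * (v - t))"
proof -
  from nn_integral_indep_mult[OF indep_var_state_tick_count[OF assms]] show ?thesis
    by (simp add: nn_integral_tick_count[OF assms(1-3)])
qed

text \<open>
  Evaluating \<open>h(S)\<close> at the left end of the grid cell that contains a ring makes it independent of the number
  of rings in the cell; by left-continuity the value is eventually the one at the ring itself.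
\<close>

lemma nn_integral_sum_over_rings:
  fixes h :: "state \<Rightarrow> ennreal"
  assumes \<epsilon>: "\<epsilon> \<in> \<Xi>" and "0 < v" and [measurable]: "h \<in> borel_measurable E"
    and bound: "\<And>y. y \<in> space E \<Longrightarrow> h y \<le> ennreal C"
  shows "(\<integral>\<^sup>+\<omega>. (\<Sum>m. indicator {0<..v} (ring_time \<epsilon> m \<omega>) * h (S (ring_time \<epsilon> m \<omega>) \<omega>)) \<partial>M) =
    ennreal (rate \<epsilon>) * (\<integral>\<^sup>+u. indicator {0<..v} u * (\<integral>\<^sup>+\<omega>. h (S u \<omega>) \<partial>M) \<partial>lborel)"
proof -
  define s where "s n k = real k * v / real (Suc n)" for n k
  define cell where "cell n k = {s n k<..s n (Suc k)}" for n k
  \<comment> \<open>\<open>\<phi> n u \<omega>\<close> freezes \<open>h(S)\<close> at the left end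
    of the cell containing \<open>u\<close> and vanishes off \<open>(0, v]\<close>. Both sides of
    the claim are limits of the same expressions with \<open>\<phi> n\<close> in place of the true
    value.\<close>
  define \<phi> where "\<phi> n u \<omega> = (\<Sum>k<Suc n. indicator (cell n k) u * h (S (s n k) \<omega>))" for n u \<omega>
  have s: "0 \<le> s n k" "s n k \<le> s n (Suc k)" "s n (Suc k) - s n k = v / real (Suc n)" for n k
    using \<open>0 < v\<close> unfolding s_def diff_divide_distrib[symmetric] left_diff_distrib[symmetric]
    by (auto intro!: divide_right_mono mult_right_mono)
  have s_le: "s n (Suc k) \<le> v" if "k < Suc n" for n k
  proof -
    have "real (Suc k) * v / real (Suc n) \<le> real (Suc n) * v / real (Suc n)"
      using that \<open>0 < v\<close> by (intro divide_right_mono mult_right_mono) auto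
    then show ?thesis
      by (simp add: s_def)
  qed
  have [measurable]: "S (s n k) \<in> M \<rightarrow>\<^sub>M E" for n k
    by (intro S_measurable s)
  have [measurable]: "cell n k \<in> sets borel" for n k
    unfolding cell_def by simp
  have [measurable]: "ring_time \<epsilon> m \<in> borel_measurable M" for m
    using \<epsilon> by (rule ring_measurable)
  have [measurable]: "(\<lambda>\<omega>. S (ring_time \<epsilon> m \<omega>) \<omega>) \<in> M \<rightarrow>\<^sub>M E" for m
    by (intro S_random_time_measurable ring_nonneg \<epsilon>) measurable
  have \<phi>_outside: "\<phi> n u \<omega> = 0" if "u \<notin> {0<..v}" for n u \<omega>
  proof -
    have "u \<notin> cell n k" if "k < Suc n" for k
      using s(1)[of n k] s_le[OF that] \<open>u \<notin> {0<..v}\<close> by (auto simp: cell_def)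
    then show ?thesis
      unfolding \<phi>_def by (intro sum.neutral) auto
  qed
  have \<phi>_grid: "\<exists>c. 0 \<le> c \<and> c < u \<and> u - v / real (Suc n) \<le> c \<and> (\<forall>\<omega>. \<phi> n u \<omega> = h (S c \<omega>))"
    if "u \<in> {0<..v}" for n u
  proof -
    have "0 < u" "u \<le> v"
      using that by auto
    then obtain c where c: "0 \<le> c" "c < u" "u - v / real (Suc n) \<le> c"
      "\<And>H :: real \<Rightarrow> ennreal.
        (\<Sum>k<Suc n. indicator {real k * v / real (Suc n)<..real (Suc k) * v / real (Suc n)} u *
          H (real k * v / real (Suc n))) = H c"
      using grid_sum[of u v n] by blast
    have "\<phi> n u \<omega> = h (S c \<omega>)" for \<omega>
      using c(4)[of "\<lambda>w. h (S w \<omega>)"] unfolding \<phi>_def cell_def s_def .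
    with c(1-3) show ?thesis
      by blast
  qed
  have \<phi>_eventually: "\<forall>\<^sub>F n in sequentially. \<phi> n u \<omega> = indicator {0<..v} u * h (S u \<omega>)" if \<omega>: "\<omega> \<in> space M" for u \<omega>
  proof (cases "u \<in> {0<..v}")
    case True
    then obtain b where b: "b < u" "\<And>w. b < w \<Longrightarrow> w < u \<Longrightarrow> S w \<omega> = S u \<omega>"
      using left_constant[OF \<omega>, of u] unfolding eventually_at_left_field by auto
    have "\<forall>\<^sub>F n in sequentially. v / real (Suc n) < u - b"
      using b(1) by (intro order_tendstoD(2)[OF LIMSEQ_Suc[OF lim_const_over_n]]) simp
    then show ?thesis
    proof eventually_elim
      case (elim n)
      obtain c where "0 \<le> c" "c < u" "u - v / real (Suc n) \<le> c" "\<phi> n u \<omega> = h (S c \<omega>)"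
        using \<phi>_grid[OF True] by blast
      then show ?case
        using elim b(2)[of c] True by simp
    qed
  next
    case False
    then show ?thesis
      using \<phi>_outside by simp
  qed
  have \<phi>_bound: "\<phi> n u \<omega> \<le> ennreal C * indicator {0<..v} u" if "\<omega> \<in> space M" for n u \<omega>
  proof (cases "u \<in> {0<..v}")
    case True
    show ?thesis
    proof -
      obtain c where "0 \<le> c" "\<phi> n u \<omega> = h (S c \<omega>)"
        using \<phi>_grid[OF True] by blast
      then show ?thesis
        using True bound[OF S_space[OF _ that]] by simp
    qed
  next
    case False
    then show ?thesis
      using \<phi>_outside by simp
  qed
  have [measurable]: "(\<lambda>\<omega>. \<phi> n (ring_time \<epsilon> m \<omega>) \<omega>) \<in> borel_measurable M" for n m
    unfolding \<phi>_def by measurable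
  have [measurable]: "(\<lambda>\<omega>. \<phi> n u \<omega>) \<in> borel_measurable M" for n u
    unfolding \<phi>_def by measurable
  define \<Phi> where "\<Phi> n u = (\<integral>\<^sup>+\<omega>. \<phi> n u \<omega> \<partial>M)" for n u
  have \<Phi>_eq: "\<Phi> n u = (\<Sum>k<Suc n. indicator (cell n k) u * (\<integral>\<^sup>+\<omega>. h (S (s n k) \<omega>) \<partial>M))" for n u
    unfolding \<Phi>_def \<phi>_def by (simp add: nn_integral_sum nn_integral_cmult del: sum.lessThan_Suc)
  have [measurable]: "\<Phi> n \<in> borel_measurable lborel" for n
    unfolding \<Phi>_eq by measurable
  have discretized: "(\<integral>\<^sup>+\<omega>. (\<Sum>m. \<phi> n (ring_time \<epsilon> m \<omega>) \<omega>) \<partial>M) = ennreal (rate \<epsilon>) * (\<integral>\<^sup>+u. \<Phi> n u \<partial>lborel)" for n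
  proof -
    have "(\<Sum>m. \<phi> n (ring_time \<epsilon> m \<omega>) \<omega>) =
        (\<Sum>k<Suc n. h (S (s n k) \<omega>) * ennreal (real (tick_count tick \<epsilon> (s n k) (s n (Suc k)) \<omega>)))"
      if "\<omega> \<in> space M" for \<omega>
      unfolding \<phi>_def tick_count_eq_suminf[OF \<epsilon> that s(1)]
      by (subst suminf_sum) (auto simp: cell_def mult.commute simp del: sum.lessThan_Suc)
    then have "(\<integral>\<^sup>+\<omega>. (\<Sum>m. \<phi> n (ring_time \<epsilon> m \<omega>) \<omega>) \<partial>M) =
        (\<integral>\<^sup>+\<omega>. (\<Sum>k<Suc n. h (S (s n k) \<omega>) * ennreal (real (tick_count tick \<epsilon> (s n k) (s n (Suc k)) \<omega>))) \<partial>M)"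
      by (intro nn_integral_cong)
    also have "\<dots> = (\<Sum>k<Suc n. \<integral>\<^sup>+\<omega>. h (S (s n k) \<omega>) * ennreal (real (tick_count tick \<epsilon> (s n k) (s n (Suc k)) \<omega>)) \<partial>M)"
    proof (rule nn_integral_sum)
      fix k
      note [measurable] = tick_count_measurable[OF \<epsilon> s(1,2)[of n k]]
      show "(\<lambda>\<omega>. h (S (s n k) \<omega>) * ennreal (real (tick_count tick \<epsilon> (s n k) (s n (Suc k)) \<omega>))) \<in> borel_measurable M"
        by measurable
    qed
    also have "\<dots> = (\<Sum>k<Suc n. (\<integral>\<^sup>+\<omega>. h (S (s n k) \<omega>) \<partial>M) * (ennreal (rate \<epsilon>) * ennreal (v / real (Suc n))))"
    proof (rule sum.cong[OF refl])
      fix k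
      have "ennreal (rate \<epsilon> * (v / real (Suc n))) = ennreal (rate \<epsilon>) * ennreal (v / real (Suc n))"
        using rate_nonneg[OF \<epsilon>] by (rule ennreal_mult')
      then show "(\<integral>\<^sup>+\<omega>. h (S (s n k) \<omega>) * ennreal (real (tick_count tick \<epsilon> (s n k) (s n (Suc k)) \<omega>)) \<partial>M) =
          (\<integral>\<^sup>+\<omega>. h (S (s n k) \<omega>) \<partial>M) * (ennreal (rate \<epsilon>) * ennreal (v / real (Suc n)))"
        by (subst nn_integral_state_tick_count[OF \<epsilon> s(1,2)]) (simp_all only: s(3), measurable)
    qed
    also have "\<dots> = ennreal (rate \<epsilon>) * (\<Sum>k<Suc n. (\<integral>\<^sup>+\<omega>. h (S (s n k) \<omega>) \<partial>M) * emeasure lborel (cell n k))"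
      unfolding sum_distrib_left cell_def using s(2) by (intro sum.cong refl) (simp add: s(3) mult_ac)
    also have "\<dots> = ennreal (rate \<epsilon>) * (\<integral>\<^sup>+u. \<Phi> n u \<partial>lborel)"
      unfolding \<Phi>_eq
      by (subst nn_integral_sum) (auto simp: nn_integral_cmult_indicator nn_integral_multc mult.commute simp del: sum.lessThan_Suc)
    finally show ?thesis .
  qed
  \<comment> \<open>The majorant is \<open>C\<close> times the number of rings in
    \<open>(0, v]\<close>, which has finite mean by the Poisson law.\<close>
  have lim_rings: "(\<lambda>n. \<integral>\<^sup>+\<omega>. (\<Sum>m. \<phi> n (ring_time \<epsilon> m \<omega>) \<omega>) \<partial>M) \<longlonglongrightarrow>
      (\<integral>\<^sup>+\<omega>. (\<Sum>m. indicator {0<..v} (ring_time \<epsilon> m \<omega>) * h (S (ring_time \<epsilon> m \<omega>) \<omega>)) \<partial>M)"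
  proof (rule nn_integral_dominated_convergence[where w="\<lambda>\<omega>. ennreal C * (\<Sum>m. indicator {0<..v} (ring_time \<epsilon> m \<omega>))"])
    show "AE \<omega> in M. (\<Sum>m. \<phi> n (ring_time \<epsilon> m \<omega>) \<omega>) \<le> ennreal C * (\<Sum>m. indicator {0<..v} (ring_time \<epsilon> m \<omega>))" for n
      using AE_space by eventually_elim (auto simp flip: ennreal_suminf_cmult intro!: suminf_le \<phi>_bound)
    have "(\<integral>\<^sup>+\<omega>. (\<Sum>m. indicator {0<..v} (ring_time \<epsilon> m \<omega>)) \<partial>M) =
        (\<integral>\<^sup>+\<omega>. ennreal (real (tick_count tick \<epsilon> 0 v \<omega>)) \<partial>M)"
      by (intro nn_integral_cong) (simp add: tick_count_eq_suminf[OF \<epsilon> _ order_refl])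
    then have "(\<integral>\<^sup>+\<omega>. ennreal C * (\<Sum>m. indicator {0<..v} (ring_time \<epsilon> m \<omega>)) \<partial>M) =
        ennreal C * (\<integral>\<^sup>+\<omega>. ennreal (real (tick_count tick \<epsilon> 0 v \<omega>)) \<partial>M)"
      by (subst nn_integral_cmult) auto
    then show "(\<integral>\<^sup>+\<omega>. ennreal C * (\<Sum>m. indicator {0<..v} (ring_time \<epsilon> m \<omega>)) \<partial>M) < \<infinity>"
      using \<open>0 < v\<close> by (simp add: nn_integral_tick_count[OF \<epsilon>] ennreal_mult_less_top)
    show "AE \<omega> in M. (\<lambda>n. \<Sum>m. \<phi> n (ring_time \<epsilon> m \<omega>) \<omega>) \<longlonglongrightarrow>
        (\<Sum>m. indicator {0<..v} (ring_time \<epsilon> m \<omega>) * h (S (ring_time \<epsilon> m \<omega>) \<omega>))"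
      using AE_space
    proof eventually_elim
      case (elim \<omega>)
      \<comment> \<open>A path has finitely many rings in \<open>(0, v]\<close>, so one
        \<open>n\<close> is large enough for all of them; the other terms vanish on both
        sides.\<close>
      define I where "I = {m. ring_time \<epsilon> m \<omega> \<in> {0<..v}}"
      have "finite I"
        unfolding I_def by (rule finite_rings_interval[OF \<epsilon> elim order_refl])
      then have "\<forall>\<^sub>F n in sequentially. \<forall>m\<in>I. \<phi> n (ring_time \<epsilon> m \<omega>) \<omega> =
          indicator {0<..v} (ring_time \<epsilon> m \<omega>) * h (S (ring_time \<epsilon> m \<omega>) \<omega>)"
        by (intro eventually_ball_finite ballI \<phi>_eventually elim)
      then have "\<forall>\<^sub>F n in sequentially. (\<Sum>m. \<phi> n (ring_time \<epsilon> m \<omega>) \<omega>) =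
          (\<Sum>m. indicator {0<..v} (ring_time \<epsilon> m \<omega>) * h (S (ring_time \<epsilon> m \<omega>) \<omega>))"
      proof eventually_elim
        case (elim n)
        have "\<phi> n (ring_time \<epsilon> m \<omega>) \<omega> = indicator {0<..v} (ring_time \<epsilon> m \<omega>) * h (S (ring_time \<epsilon> m \<omega>) \<omega>)" for m
        proof (cases "m \<in> I")
          case False
          then show ?thesis
            using \<phi>_outside by (simp add: I_def)
        qed (use elim in blast)
        then show ?case
          by simp
      qed
      then show ?case
        by (rule tendsto_eventually)
    qed
  qed measurable
  have lim_time: "(\<lambda>n. ennreal (rate \<epsilon>) * (\<integral>\<^sup>+u. \<Phi> n u \<partial>lborel)) \<longlonglongrightarrow>
      ennreal (rate \<epsilon>) * (\<integral>\<^sup>+u. indicator {0<..v} u * (\<integral>\<^sup>+\<omega>. h (S u \<omega>) \<partial>M) \<partial>lborel)"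
  proof (intro ennreal_tendsto_cmult)
    have lim: "(\<lambda>n. \<Phi> n u) \<longlonglongrightarrow> indicator {0<..v} u * (\<integral>\<^sup>+\<omega>. h (S u \<omega>) \<partial>M)" for u
    proof (cases "u \<in> {0<..v}")
      case True
      have [measurable]: "S u \<in> M \<rightarrow>\<^sub>M E"
        using True by (intro S_measurable) auto
      have "(\<lambda>n. \<Phi> n u) \<longlonglongrightarrow> (\<integral>\<^sup>+\<omega>. h (S u \<omega>) \<partial>M)"
        unfolding \<Phi>_def
      proof (rule nn_integral_dominated_convergence[where w="\<lambda>_. ennreal C"])
        show "AE \<omega> in M. \<phi> n u \<omega> \<le> ennreal C" for n
          using AE_space
        proof eventually_elim
          case (elim \<omega>)
          then show ?case
            using \<phi>_bound[OF elim, of n u] True by simp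
        qed
        show "AE \<omega> in M. (\<lambda>n. \<phi> n u \<omega>) \<longlonglongrightarrow> h (S u \<omega>)"
          using AE_space
        proof eventually_elim
          case (elim \<omega>)
          then show ?case
            using \<phi>_eventually[OF elim, of u] True by (intro tendsto_eventually) simp
        qed
      qed (auto simp: emeasure_space_1)
      then show ?thesis
        using True by simp
    next
      case False
      then show ?thesis
        by (simp add: \<Phi>_def \<phi>_outside)
    qed
    \<comment> \<open>Measurability in time is inherited from the step functions
      \<open>\<Phi> n\<close>, whose pointwise limit this is.\<close>
    have [measurable]: "(\<lambda>u. indicator {0<..v} u * (\<integral>\<^sup>+\<omega>. h (S u \<omega>) \<partial>M)) \<in> borel_measurable lborel"
      by (rule borel_measurable_LIMSEQ_order[OF lim]) measurable
    show "(\<lambda>n. \<integral>\<^sup>+u. \<Phi> n u \<partial>lborel) \<longlonglongrightarrow> (\<integral>\<^sup>+u. indicator {0<..v} u * (\<integral>\<^sup>+\<omega>. h (S u \<omega>) \<partial>M) \<partial>lborel)"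
    proof (rule nn_integral_dominated_convergence[where w="\<lambda>u. ennreal C * indicator {0<..v} u"])
      show "AE u in lborel. \<Phi> n u \<le> ennreal C * indicator {0<..v} u" for n
      proof (rule AE_I2)
        fix u
        have "\<Phi> n u \<le> (\<integral>\<^sup>+\<omega>. ennreal C * indicator {0<..v} u \<partial>M)"
          unfolding \<Phi>_def by (intro nn_integral_mono \<phi>_bound)
        then show "\<Phi> n u \<le> ennreal C * indicator {0<..v} u"
          by (simp add: emeasure_space_1)
      qed
      show "(\<integral>\<^sup>+u. ennreal C * indicator {0<..v} u \<partial>lborel) < \<infinity>"
        using \<open>0 < v\<close> by (simp add: nn_integral_cmult_indicator ennreal_mult_less_top)
    qed (use lim in auto)
  qed simp
  show ?thesis
    by (rule LIMSEQ_unique[OF lim_rings[unfolded discretized] lim_time])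
qed

section \<open>The state after an event\<close>

lemma fst_state_measurable: "X \<in> M \<rightarrow>\<^sub>M E \<Longrightarrow> (\<lambda>\<omega>. fst (X \<omega>)) \<in> M \<rightarrow>\<^sub>M count_space UNIV"
  using measurable_compose[OF _ size_measurable] .

lemma kernel_prob_space: "\<epsilon> \<in> \<Xi> \<Longrightarrow> y \<in> space E \<Longrightarrow> prob_space (K \<epsilon> y)"
  using kernel[of \<epsilon>] by (auto dest!: measurable_space simp: space_prob_algebra)

lemma sets_kernel: "\<epsilon> \<in> \<Xi> \<Longrightarrow> y \<in> space E \<Longrightarrow> sets (K \<epsilon> y) = sets E"
  using kernel[of \<epsilon>] by (auto dest!: measurable_space simp: space_prob_algebra)

text \<open>Bounded above by \<open>v\<close>, unlike \<open>event_after\<close>: it is the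
  difference of two such sets, at the times \<open>0\<close> and \<open>v\<close>. A ring that never
  happens has \<open>ring_time\<close> 0 and is thereby excluded.\<close>

definition event_set :: "'c \<Rightarrow> nat \<Rightarrow> real \<Rightarrow> 'w set" where
  "event_set \<epsilon> m v = {\<omega> \<in> space M. ring_time \<epsilon> m \<omega> \<in> {0<..v} \<and> fst (S (ring_time \<epsilon> m \<omega>) \<omega>) = src \<epsilon>}"

lemma state_at_ring_measurable:
  assumes "\<epsilon> \<in> \<Xi>"
  shows "(\<lambda>\<omega>. S (ring_time \<epsilon> m \<omega>) \<omega>) \<in> M \<rightarrow>\<^sub>M E" "(\<lambda>\<omega>. post_state S (ring_time \<epsilon> m \<omega>) \<omega>) \<in> M \<rightarrow>\<^sub>M E"
  by (intro S_random_time_measurable post_state_random_time_measurable ring_measurable ring_nonneg assms; assumption)+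

lemma event_after_eq:
  assumes "\<epsilon> \<in> \<Xi>" "0 \<le> t"
  shows "event_after M src S tick \<epsilon> m t =
    {\<omega> \<in> space M. t < ring_time \<epsilon> m \<omega> \<and> fst (S (ring_time \<epsilon> m \<omega>) \<omega>) = src \<epsilon>}"
proof -
  have "ereal t < tick \<epsilon> m \<omega> \<and> tick \<epsilon> m \<omega> < \<infinity> \<longleftrightarrow> t < ring_time \<epsilon> m \<omega>" if "\<omega> \<in> space M" for \<omega>
    using tick_pos[OF assms(1) that, of m] assms(2) by (cases "tick \<epsilon> m \<omega>") auto
  then show ?thesis
    unfolding event_after_def by blast
qed

text \<open>\<open>post_law\<close> speaks of rings after a given time without an upper limit.
  Subtracting its instance at \<open>v\<close> from the one at \<open>0\<close>, both with the whole
  space as the event of the past, leaves the rings in \<open>(0, v]\<close>.\<close>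

lemma prob_event_set_post_state:
  assumes \<epsilon>: "\<epsilon> \<in> \<Xi>" and "0 \<le> v" and B: "B \<in> sets E"
  shows "prob {\<omega> \<in> event_set \<epsilon> m v. post_state S (ring_time \<epsilon> m \<omega>) \<omega> \<in> B} =
    (LINT \<omega>|M. indicator (event_set \<epsilon> m v) \<omega> * measure (K \<epsilon> (S (ring_time \<epsilon> m \<omega>) \<omega>)) B)"
proof -
  note [measurable] = state_at_ring_measurable[OF \<epsilon>] kernel[OF \<epsilon>] ring_measurable[OF \<epsilon>] B
    fst_state_measurable[OF state_at_ring_measurable(1)[OF \<epsilon>]]
  let ?A = "\<lambda>t. {\<omega> \<in> space M. t < ring_time \<epsilon> m \<omega> \<and> fst (S (ring_time \<epsilon> m \<omega>) \<omega>) = src \<epsilon>}"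
  let ?P = "\<lambda>A. {\<omega> \<in> A. post_state S (ring_time \<epsilon> m \<omega>) \<omega> \<in> B}"
  let ?k = "\<lambda>\<omega>. measure (K \<epsilon> (S (ring_time \<epsilon> m \<omega>) \<omega>)) B"
  have meas [measurable]: "?A t \<in> events" "?P (?A t) \<in> events" for t
    by measurable
  have k [measurable]: "?k \<in> borel_measurable M"
    by measurable
  have k_le: "\<bar>?k \<omega>\<bar> \<le> 1" if "\<omega> \<in> space M" for \<omega>
  proof -
    interpret K: prob_space "K \<epsilon> (S (ring_time \<epsilon> m \<omega>) \<omega>)"
      using that by (intro kernel_prob_space[OF \<epsilon>] S_space ring_nonneg[OF \<epsilon>])
    show ?thesis
      by simp
  qed
  have int: "integrable M (\<lambda>\<omega>. indicator (?A t) \<omega> * ?k \<omega>)" for t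
    using k_le by (intro integrable_const_bound[where B=1] AE_I2) (auto simp: indicator_def)
  have law: "prob (?P (?A t)) = (LINT \<omega>|M. indicator (?A t) \<omega> * ?k \<omega>)" if "0 \<le> t" for t
  proof -
    have "space M \<in> history M E \<Xi> S tick t"
      unfolding history_def by (rule sigma_sets_top)
    from post_law[OF \<epsilon> that this B, of m] have
      "prob (?P (space M \<inter> ?A t)) = (LINT \<omega>|M. indicator (space M \<inter> ?A t) \<omega> * ?k \<omega>)"
      unfolding event_after_eq[OF \<epsilon> that] .
    moreover have "space M \<inter> ?A t = ?A t"
      by blast
    ultimately show ?thesis
      by simp
  qed
  have diff: "event_set \<epsilon> m v = ?A 0 - ?A v" "?P (event_set \<epsilon> m v) = ?P (?A 0) - ?P (?A v)"
    unfolding event_set_def by auto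
  have "prob (?P (event_set \<epsilon> m v)) = prob (?P (?A 0)) - prob (?P (?A v))"
    unfolding diff(2) using \<open>0 \<le> v\<close> by (intro finite_measure_Diff meas) auto
  also have "\<dots> = (LINT \<omega>|M. indicator (?A 0) \<omega> * ?k \<omega> - indicator (?A v) \<omega> * ?k \<omega>)"
    unfolding law[OF \<open>0 \<le> v\<close>] law[OF order_refl] by (rule Bochner_Integration.integral_diff[symmetric]) (fact int)+
  also have "\<dots> = (LINT \<omega>|M. indicator (event_set \<epsilon> m v) \<omega> * ?k \<omega>)"
    unfolding diff(1) using \<open>0 \<le> v\<close> by (intro Bochner_Integration.integral_cong refl) (auto simp: indicator_def)
  finally show ?thesis .
qed

lemma event_set_measurable [measurable]: "\<epsilon> \<in> \<Xi> \<Longrightarrow> event_set \<epsilon> m v \<in> events"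
  using ring_measurable[of \<epsilon> m] fst_state_measurable[OF state_at_ring_measurable(1), of \<epsilon> m]
  unfolding event_set_def by measurable

text \<open>The identity for sets \<open>B\<close> says that two measures on the states agree: the
  law of the state after the event, and the mixture of the kernels over the state before it. Equal
  measures integrate every nonnegative function equally.\<close>

lemma nn_integral_post_state:
  fixes g :: "state \<Rightarrow> ennreal"
  assumes \<epsilon>: "\<epsilon> \<in> \<Xi>" and "0 \<le> v" and g [measurable]: "g \<in> borel_measurable E"
  shows "(\<integral>\<^sup>+\<omega>. indicator (event_set \<epsilon> m v) \<omega> * g (post_state S (ring_time \<epsilon> m \<omega>) \<omega>) \<partial>M) =
    (\<integral>\<^sup>+\<omega>. indicator (event_set \<epsilon> m v) \<omega> * (\<integral>\<^sup>+z. g z \<partial>K \<epsilon> (S (ring_time \<epsilon> m \<omega>) \<omega>)) \<partial>M)"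
proof -
  note [measurable] = state_at_ring_measurable[OF \<epsilon>] measurable_prob_algebraD[OF kernel[OF \<epsilon>]] event_set_measurable[OF \<epsilon>]
  let ?D = "density M (indicator (event_set \<epsilon> m v))"
  let ?post = "\<lambda>\<omega>. post_state S (ring_time \<epsilon> m \<omega>) \<omega>"
  let ?K = "\<lambda>\<omega>. K \<epsilon> (S (ring_time \<epsilon> m \<omega>) \<omega>)"
  have K [measurable]: "?K \<in> ?D \<rightarrow>\<^sub>M subprob_algebra E"
    by measurable
  have "distr ?D E ?post = ?D \<bind> ?K"
  proof (rule measure_eqI)
    show sets: "sets (distr ?D E ?post) = sets (?D \<bind> ?K)"
      by (subst sets_bind[where N=E]) (auto simp: sets_kernel S_space ring_nonneg \<epsilon> not_empty)
    fix B assume "B \<in> sets (distr ?D E ?post)"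
    then have B [measurable]: "B \<in> sets E"
      by simp
    have "emeasure (distr ?D E ?post) B = emeasure ?D (?post -` B \<inter> space M)"
      by (subst emeasure_distr) auto
    also have "\<dots> = (\<integral>\<^sup>+\<omega>. indicator (event_set \<epsilon> m v) \<omega> * indicator (?post -` B \<inter> space M) \<omega> \<partial>M)"
      by (subst emeasure_density) auto
    also have "\<dots> = (\<integral>\<^sup>+\<omega>. indicator {\<omega> \<in> event_set \<epsilon> m v. ?post \<omega> \<in> B} \<omega> \<partial>M)"
      by (intro nn_integral_cong) (auto simp: indicator_def)
    also have "\<dots> = emeasure M {\<omega> \<in> event_set \<epsilon> m v. ?post \<omega> \<in> B}"
    proof (rule nn_integral_indicator)
      have "{\<omega> \<in> event_set \<epsilon> m v. ?post \<omega> \<in> B} = event_set \<epsilon> m v \<inter> (?post -` B \<inter> space M)"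
        by (auto simp: event_set_def)
      also have "\<dots> \<in> events"
        by measurable
      finally show "{\<omega> \<in> event_set \<epsilon> m v. ?post \<omega> \<in> B} \<in> events" .
    qed
    also have "\<dots> = ennreal (LINT \<omega>|M. indicator (event_set \<epsilon> m v) \<omega> * measure (?K \<omega>) B)"
      unfolding emeasure_eq_measure prob_event_set_post_state[OF \<epsilon> \<open>0 \<le> v\<close> B] ..
    also have "\<dots> = (\<integral>\<^sup>+\<omega>. ennreal (indicator (event_set \<epsilon> m v) \<omega> * measure (?K \<omega>) B) \<partial>M)"
    proof (rule nn_integral_eq_integral[symmetric])
      have "\<bar>measure (?K \<omega>) B\<bar> \<le> 1" if "\<omega> \<in> space M" for \<omega>
        using prob_space.prob_le_1[OF kernel_prob_space[OF \<epsilon> S_space[OF ring_nonneg[OF \<epsilon> that] that]]] by simp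
      then show "integrable M (\<lambda>\<omega>. indicator (event_set \<epsilon> m v) \<omega> * measure (?K \<omega>) B)"
        by (intro integrable_const_bound[where B=1] AE_I2) (auto simp: indicator_def)
    qed auto
    also have "\<dots> = (\<integral>\<^sup>+\<omega>. indicator (event_set \<epsilon> m v) \<omega> * emeasure (?K \<omega>) B \<partial>M)"
    proof (rule nn_integral_cong)
      fix \<omega> assume \<omega>: "\<omega> \<in> space M"
      interpret K: prob_space "?K \<omega>"
        using \<omega> by (intro kernel_prob_space[OF \<epsilon>] S_space ring_nonneg[OF \<epsilon>])
      show "ennreal (indicator (event_set \<epsilon> m v) \<omega> * measure (?K \<omega>) B) = indicator (event_set \<epsilon> m v) \<omega> * emeasure (?K \<omega>) B"
        by (auto simp: indicator_def K.emeasure_eq_measure)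
    qed
    also have "\<dots> = (\<integral>\<^sup>+\<omega>. emeasure (?K \<omega>) B \<partial>?D)"
      by (subst nn_integral_density) auto
    also have "\<dots> = emeasure (?D \<bind> ?K) B"
      using K by (subst emeasure_bind[where N=E]) (auto simp: not_empty)
    finally show "emeasure (distr ?D E ?post) B = emeasure (?D \<bind> ?K) B" .
  qed
  then have "(\<integral>\<^sup>+z. g z \<partial>distr ?D E ?post) = (\<integral>\<^sup>+z. g z \<partial>(?D \<bind> ?K))"
    by simp
  also have "(\<integral>\<^sup>+z. g z \<partial>distr ?D E ?post) =
      (\<integral>\<^sup>+\<omega>. indicator (event_set \<epsilon> m v) \<omega> * g (?post \<omega>) \<partial>M)"
    by (subst nn_integral_distr) (auto simp: nn_integral_density)
  also have "(\<integral>\<^sup>+z. g z \<partial>(?D \<bind> ?K)) = (\<integral>\<^sup>+\<omega>. indicator (event_set \<epsilon> m v) \<omega> * (\<integral>\<^sup>+z. g z \<partial>?K \<omega>) \<partial>M)"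
    by (subst nn_integral_bind[OF g K]) (auto simp: nn_integral_density)
  finally show ?thesis .
qed

section \<open>Gains and losses along a path\<close>

lemma inj_on_ring_time:
  assumes \<omega>: "\<omega> \<in> space M"
    and distinct: "\<And>\<epsilon> \<epsilon>' m m'. \<epsilon> \<in> \<Xi> \<Longrightarrow> \<epsilon>' \<in> \<Xi> \<Longrightarrow> tick \<epsilon> m \<omega> = tick \<epsilon>' m' \<omega> \<Longrightarrow> tick \<epsilon> m \<omega> < \<infinity> \<Longrightarrow> \<epsilon> = \<epsilon>'"
  shows "inj_on (\<lambda>(\<epsilon>, m). ring_time \<epsilon> m \<omega>) {(\<epsilon>, m). \<epsilon> \<in> \<Xi> \<and> 0 < ring_time \<epsilon> m \<omega>}"
proof (rule inj_onI, clarify)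
  fix \<epsilon> m \<epsilon>' m'
  assume \<epsilon>: "\<epsilon> \<in> \<Xi>" "\<epsilon>' \<in> \<Xi>" and pos: "0 < ring_time \<epsilon> m \<omega>" "0 < ring_time \<epsilon>' m' \<omega>"
    and eq: "ring_time \<epsilon> m \<omega> = ring_time \<epsilon>' m' \<omega>"
  have fin: "tick \<epsilon> m \<omega> < \<infinity>" "tick \<epsilon>' m' \<omega> < \<infinity>"
    using pos ring_pos_iff[OF \<epsilon>(1) \<omega>] ring_pos_iff[OF \<epsilon>(2) \<omega>] by auto
  have tick_eq: "tick \<epsilon> m \<omega> = tick \<epsilon>' m' \<omega>"
    using tick_eq_ring[OF \<epsilon>(1) \<omega> fin(1)] tick_eq_ring[OF \<epsilon>(2) \<omega> fin(2)] eq by simp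
  then have same: "\<epsilon> = \<epsilon>'"
    using distinct \<epsilon> fin by blast
  \<comment> \<open>Ring times of one clock increase strictly as long as they are finite, so two
    rings at the same finite time have the same index.\<close>
  have less: "tick \<epsilon> a \<omega> < tick \<epsilon> b \<omega>" if "a < b" "tick \<epsilon> a \<omega> < \<infinity>" for a b
    using tick_strict[OF \<epsilon>(1) \<omega> that(2)] incseqD[OF tick_mono[OF \<epsilon>(1) \<omega>], of "Suc a" b] that(1)
    by (auto intro: less_le_trans)
  have "m = m'"
    using less[of m m'] less[of m' m] tick_eq fin same by (cases m m' rule: linorder_cases) auto
  with same show "\<epsilon> = \<epsilon>' \<and> m = m'"
    by simp
qed

text \<open>Losses are kept on the left and gains on the right so that both sides are nonnegative.\<close>

lemma AE_path_balance:
  fixes g :: "state \<Rightarrow> real"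
  assumes "0 \<le> v" and g_nonneg: "\<And>y. 0 \<le> g y"
  shows "AE \<omega> in M.
    ennreal (g (S v \<omega>)) +
      (\<integral>\<^sup>+\<epsilon>. (\<Sum>m. indicator (event_set \<epsilon> m v) \<omega> * ennreal (g (S (ring_time \<epsilon> m \<omega>) \<omega>))) \<partial>count_space \<Xi>) =
    ennreal (g (S 0 \<omega>)) +
      (\<integral>\<^sup>+\<epsilon>. (\<Sum>m. indicator (event_set \<epsilon> m v) \<omega> * ennreal (g (post_state S (ring_time \<epsilon> m \<omega>) \<omega>))) \<partial>count_space \<Xi>)"
  using AE_rings_distinct AE_no_ring_at[OF \<open>0 \<le> v\<close>] AE_space
proof eventually_elim
  case (elim \<omega>)
  note \<omega> = elim(3)
  define x y r where "x u = S u \<omega>" and "y u = post_state S u \<omega>" and "r = (\<lambda>(\<epsilon>, m). ring_time \<epsilon> m \<omega>)" for u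
  \<comment> \<open>\<open>I\<close> indexes the events, in \<open>(0, v]\<close>, and
    \<open>J\<close> holds the times of actual jumps, in \<open>[0, v)\<close>. The end points agree
    because no clock rings at 0 and, on this path, none at \<open>v\<close>.\<close>
  define I where "I = {(\<epsilon>, m). \<epsilon> \<in> \<Xi> \<and> \<omega> \<in> event_set \<epsilon> m v}"
  define J where "J = {u \<in> {0..<v}. y u \<noteq> x u}"
  have path: "finite J" "finite (x ` {0..v})" "g (x v) - g (x 0) = (\<Sum>u\<in>J. g (y u) - g (x u))"
    using piecewise_constant_path[of x y 0 v g] left_constant[OF \<omega>] eventually_post_state[OF \<omega>] \<open>0 \<le> v\<close>
    unfolding x_def y_def J_def by auto
  \<comment> \<open>The path visits finitely many states up to \<open>v\<close>, hence finitely many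
    sizes, and each size has finitely many clocks. So only the finite set \<open>X\<close> of clocks
    can have events, and all sums below are finite.\<close>
  define X where "X = (\<Union>n\<in>fst ` x ` {0..v}. {\<epsilon> \<in> \<Xi>. src \<epsilon> = n})"
  define R where "R \<epsilon> = {m. ring_time \<epsilon> m \<omega> \<in> {0<..v}}" for \<epsilon>
  have fin: "finite X" "finite (R \<epsilon>)" if "\<epsilon> \<in> X" for \<epsilon>
  proof -
    show "finite X"
      unfolding X_def using path(2) finite_clocks by blast
    show "finite (R \<epsilon>)"
      using that unfolding R_def by (intro finite_rings_interval[OF _ \<omega>]) (auto simp: X_def)
  qed
  have I_sub: "I \<subseteq> Sigma X R"
  proof (clarify)
    fix \<epsilon> m assume "(\<epsilon>, m) \<in> I"
    then have *: "\<epsilon> \<in> \<Xi>" "ring_time \<epsilon> m \<omega> \<in> {0<..v}" "fst (x (ring_time \<epsilon> m \<omega>)) = src \<epsilon>"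
      by (auto simp: I_def event_set_def x_def)
    then have "x (ring_time \<epsilon> m \<omega>) \<in> x ` {0..v}"
      by (intro imageI) simp
    with * show "\<epsilon> \<in> X \<and> m \<in> R \<epsilon>"
      unfolding X_def R_def by (metis (mono_tags, lifting) UN_I imageI mem_Collect_eq)
  qed
  have "finite X"
    unfolding X_def using path(2) finite_clocks by blast
  have "finite I"
    by (rule finite_subset[OF I_sub]) (intro finite_SigmaI \<open>finite X\<close> fin)
  have sum_I: "(\<integral>\<^sup>+\<epsilon>. (\<Sum>m. indicator (event_set \<epsilon> m v) \<omega> * ennreal (G (ring_time \<epsilon> m \<omega>))) \<partial>count_space \<Xi>) =
      ennreal (\<Sum>p\<in>I. G (r p))" if G: "\<And>u. 0 \<le> G u" for G
  proof -
    have "(\<integral>\<^sup>+\<epsilon>. (\<Sum>m. indicator (event_set \<epsilon> m v) \<omega> * ennreal (G (ring_time \<epsilon> m \<omega>))) \<partial>count_space \<Xi>) =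
        (\<Sum>\<epsilon>\<in>X. \<Sum>m. indicator (event_set \<epsilon> m v) \<omega> * ennreal (G (ring_time \<epsilon> m \<omega>)))"
    proof (rule nn_integral_count_space'[OF \<open>finite X\<close>])
      fix \<epsilon> assume "\<epsilon> \<in> \<Xi>" "\<epsilon> \<notin> X"
      then have "\<omega> \<notin> event_set \<epsilon> m v" for m
        using I_sub unfolding I_def by auto
      then show "(\<Sum>m. indicator (event_set \<epsilon> m v) \<omega> * ennreal (G (ring_time \<epsilon> m \<omega>))) = 0"
        by simp
    qed (auto simp: X_def)
    also have "\<dots> = (\<Sum>\<epsilon>\<in>X. \<Sum>m\<in>R \<epsilon>. indicator (event_set \<epsilon> m v) \<omega> * ennreal (G (ring_time \<epsilon> m \<omega>)))"
      by (intro sum.cong refl suminf_finite fin) (auto simp: R_def event_set_def)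
    also have "\<dots> = (\<Sum>p\<in>Sigma X R. indicator (event_set (fst p) (snd p) v) \<omega> * ennreal (G (r p)))"
      using \<open>finite X\<close> fin by (subst sum.Sigma) (auto simp: r_def split_beta)
    also have "\<dots> = (\<Sum>p\<in>I. ennreal (G (r p)))"
    proof (rule sum.mono_neutral_cong_right)
      show "finite (Sigma X R)"
        by (intro finite_SigmaI \<open>finite X\<close> fin)
      show "\<forall>p\<in>Sigma X R - I. indicator (event_set (fst p) (snd p) v) \<omega> * ennreal (G (r p)) = 0"
        by (auto simp: I_def X_def indicator_def)
      show "indicator (event_set (fst p) (snd p) v) \<omega> * ennreal (G (r p)) = ennreal (G (r p))" if "p \<in> I" for p
        using that by (auto simp: I_def)
    qed (fact I_sub)
    also have "\<dots> = ennreal (\<Sum>p\<in>I. G (r p))"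
      using G by (intro sum_ennreal) auto
    finally show ?thesis .
  qed
  have inj: "inj_on r I"
    unfolding r_def
    by (rule inj_on_subset[OF inj_on_ring_time[OF \<omega>]]) (use elim(1) in \<open>auto simp: I_def event_set_def\<close>)
  have "J \<subseteq> r ` I"
  proof
    fix u assume u: "u \<in> J"
    then obtain \<epsilon> m where \<epsilon>: "\<epsilon> \<in> \<Xi>" "fst (S u \<omega>) = src \<epsilon>" "tick \<epsilon> m \<omega> = ereal u"
      using jumps_at_events[OF \<omega>, of u] unfolding J_def x_def y_def by auto
    then have "ring_time \<epsilon> m \<omega> = u" "0 < u"
      using tick_pos[OF \<epsilon>(1) \<omega>, of m] by auto
    then have "(\<epsilon>, m) \<in> I" "r (\<epsilon>, m) = u"
      using u \<epsilon> \<omega> by (auto simp: I_def J_def event_set_def r_def)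
    then show "u \<in> r ` I"
      by force
  qed
  \<comment> \<open>An event may leave the state unchanged; its time is then missing from
    \<open>J\<close>, but its term in the sum is zero.\<close>
  moreover have "y u = x u" if u: "u \<in> r ` I - J" for u
  proof -
    obtain \<epsilon> m where \<epsilon>: "\<epsilon> \<in> \<Xi>" "u = ring_time \<epsilon> m \<omega>" "u \<in> {0<..v}"
      using u by (auto simp: I_def r_def event_set_def)
    then have "tick \<epsilon> m \<omega> = ereal u"
      using tick_eq_ring[OF \<epsilon>(1) \<omega>] ring_pos_iff[OF \<epsilon>(1) \<omega>] by auto
    then have "u \<noteq> v"
      using elim(2) \<epsilon>(1) by auto
    with \<epsilon>(3) u show ?thesis
      by (auto simp: J_def)
  qed
  ultimately have "(\<Sum>u\<in>J. g (y u) - g (x u)) = (\<Sum>u\<in>r ` I. g (y u) - g (x u))"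
    using \<open>finite I\<close> by (intro sum.mono_neutral_left) auto
  also have "\<dots> = (\<Sum>p\<in>I. g (y (r p))) - (\<Sum>p\<in>I. g (x (r p)))"
    by (simp add: sum.reindex[OF inj] sum_subtractf)
  finally have "g (x v) + (\<Sum>p\<in>I. g (x (r p))) = g (x 0) + (\<Sum>p\<in>I. g (y (r p)))"
    using path(3) by simp
  then have "ennreal (g (x v)) + ennreal (\<Sum>p\<in>I. g (x (r p))) = ennreal (g (x 0)) + ennreal (\<Sum>p\<in>I. g (y (r p)))"
    using g_nonneg by (simp add: sum_nonneg flip: ennreal_plus)
  then show ?case
    using sum_I[of "\<lambda>u. g (x u)"] sum_I[of "\<lambda>u. g (y u)"] g_nonneg by (simp add: x_def y_def)
qed

end

section \<open>The balance equation\<close>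

text \<open>As integrals over a counting measure the sums over clocks fall under Tonelli's theorem;
  the theorem itself uses the unordered sum. The two meet here.\<close>

lemma nn_integral_count_space_infsum:
  fixes f :: "'a \<Rightarrow> real"
  assumes "f summable_on A" "\<And>x. x \<in> A \<Longrightarrow> 0 \<le> f x"
  shows "(\<integral>\<^sup>+x. ennreal (f x) \<partial>count_space A) = ennreal (infsum f A)"
proof -
  have "(\<lambda>x. norm (f x)) summable_on A"
    using assms(1) by (rule summable_on_iff_abs_summable_on_real[THEN iffD1])
  then have "Infinite_Set_Sum.abs_summable_on f A"
    by (rule abs_summable_equivalent[THEN iffD1])
  then show ?thesis
    using nn_integral_conv_infsetsum[of f A] infsetsum_infsum[of f A] assms(2) by simp
qed

lemma nn_integral_Ioc_eq_integral:
  fixes f :: "real \<Rightarrow> real"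
  assumes cont: "continuous_on {a..b} f" and nonneg: "\<And>u. u \<in> {a..b} \<Longrightarrow> 0 \<le> f u"
  shows "(\<integral>\<^sup>+u. indicator {a<..b} u * ennreal (f u) \<partial>lborel) = ennreal (integral {a..b} f)"
proof -
  note int = borel_integrable_atLeastAtMost'[OF cont]
  have "(\<integral>\<^sup>+u. indicator {a<..b} u * ennreal (f u) \<partial>lborel) = (\<integral>\<^sup>+u. ennreal (indicator {a..b} u * f u) \<partial>lborel)"
    using AE_lborel_singleton[of a] by (intro nn_integral_cong_AE) (auto elim!: eventually_mono simp: indicator_def)
  also have "\<dots> = ennreal (LINT u:{a..b}|lborel. f u)"
    using int nonneg unfolding set_lebesgue_integral_def set_integrable_def
    by (subst nn_integral_eq_integral) (auto simp: indicator_def)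
  also have "\<dots> = ennreal (integral {a..b} f)"
    using set_borel_integral_eq_integral(2)[OF int] by simp
  finally show ?thesis .
qed

lemma borel_measurable_Ioc_continuous:
  fixes f :: "real \<Rightarrow> real"
  assumes "continuous_on {0..} f"
  shows "(\<lambda>u. indicator {0<..v} u * ennreal (f u)) \<in> borel_measurable lborel"
proof -
  have "(\<lambda>u. indicator {0<..v} u *\<^sub>R f u) \<in> borel_measurable borel"
    by (rule borel_measurable_continuous_on_indicator) (auto intro: continuous_on_subset[OF assms])
  then have "(\<lambda>u. ennreal (indicator {0<..v} u *\<^sub>R f u)) \<in> borel_measurable lborel"
    by simp
  moreover have "ennreal (indicator {0<..v} u *\<^sub>R f u) = indicator {0<..v} u * ennreal (f u)" for u
    by (auto simp: indicator_def)
  ultimately show ?thesis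
    by simp
qed

context clock_jump_process
begin

lemma kernel_expectation_bound:
  fixes h :: "state \<Rightarrow> real"
  assumes \<epsilon>: "\<epsilon> \<in> \<Xi>" and [measurable]: "h \<in> borel_measurable E"
    and bound: "\<And>y. y \<in> space E \<Longrightarrow> \<bar>h y\<bar> \<le> C" and y: "y \<in> space E"
  shows "integrable (K \<epsilon> y) h" "\<bar>LINT z|K \<epsilon> y. h z\<bar> \<le> C"
proof -
  interpret K: prob_space "K \<epsilon> y"
    by (rule kernel_prob_space[OF \<epsilon> y])
  note [measurable_cong] = sets_kernel[OF \<epsilon> y]
  have space: "space (K \<epsilon> y) = space E"
    using sets_kernel[OF \<epsilon> y] by (rule sets_eq_imp_space_eq)
  show int: "integrable (K \<epsilon> y) h"
    using bound by (intro K.integrable_const_bound[where B=C] AE_I2) (auto simp: space)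
  have "(LINT z|K \<epsilon> y. h z) \<le> C" "- C \<le> (LINT z|K \<epsilon> y. h z)"
    using bound by (intro K.integral_le_const K.integral_ge_const int AE_I2; force simp: space)+
  then show "\<bar>LINT z|K \<epsilon> y. h z\<bar> \<le> C"
    by simp
qed

lemma kernel_expectation_measurable:
  fixes h :: "state \<Rightarrow> real"
  assumes "\<epsilon> \<in> \<Xi>" and "h \<in> borel_measurable E"
  shows "(\<lambda>y. LINT z|K \<epsilon> y. h z) \<in> borel_measurable E"
  using measurable_compose[OF measurable_prob_algebraD[OF kernel[OF assms(1)]]
      integral_measurable_subprob_algebra[OF assms(2)]] .

text \<open>The product of conditional mean and size probability without the division: linear in
  bounded measurable \<open>h\<close>, and meaningful also where the probability of the size is
  0.\<close>

definition restricted_mean :: "nat \<Rightarrow> (state \<Rightarrow> real) \<Rightarrow> real \<Rightarrow> real" where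
  "restricted_mean n h u = (LINT \<omega>|M. indicator {n} (fst (S u \<omega>)) * h (S u \<omega>))"

lemma size_indicator_measurable [measurable]:
  "(\<lambda>y. indicator {n} (fst y) :: 'x :: {zero_neq_one, topological_space}) \<in> borel_measurable E"
  by (rule measurable_compose[OF size_measurable]) simp

lemma size_indicator_state_measurable:
  "0 \<le> u \<Longrightarrow> (\<lambda>\<omega>. indicator {n} (fst (S u \<omega>)) :: 'x :: {zero_neq_one, topological_space}) \<in> borel_measurable M"
  using measurable_compose[OF S_measurable size_indicator_measurable] .

lemma restricted_mean_continuous:
  assumes [measurable]: "h \<in> borel_measurable E" and bound: "\<And>y. y \<in> space E \<Longrightarrow> \<bar>h y\<bar> \<le> (C::real)"
  shows "continuous_on {0..} (restricted_mean n h)"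
  unfolding restricted_mean_def
proof (rule continuous_on_expectation)
  fix y assume y: "y \<in> space E"
  then have "0 \<le> C"
    using bound[of y] by linarith
  then show "\<bar>indicator {n} (fst y) * h y\<bar> \<le> C"
    using bound[OF y] by (simp add: indicator_def)
qed measurable

lemma restricted_mean_integrable:
  assumes h: "h \<in> borel_measurable E" and bound: "\<And>y. y \<in> space E \<Longrightarrow> \<bar>h y\<bar> \<le> (C::real)" and u: "0 \<le> u"
  shows "integrable M (\<lambda>\<omega>. indicator {n} (fst (S u \<omega>)) * h (S u \<omega>))"
proof (rule integrable_const_bound[where B=C])
  note [measurable] = S_measurable[OF u] size_indicator_state_measurable[OF u] h
  show "AE \<omega> in M. norm (indicator {n} (fst (S u \<omega>)) * h (S u \<omega>)) \<le> C"
  proof (rule AE_I2)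
    fix \<omega> assume \<omega>: "\<omega> \<in> space M"
    show "norm (indicator {n} (fst (S u \<omega>)) * h (S u \<omega>)) \<le> C"
      using bound[OF S_space[OF u \<omega>]] by (auto simp: indicator_def)
  qed
  show "(\<lambda>\<omega>. indicator {n} (fst (S u \<omega>)) * h (S u \<omega>)) \<in> borel_measurable M"
    by measurable
qed

lemma size_event_measurable: "0 \<le> u \<Longrightarrow> size_event M S n u \<in> events"
  using fst_state_measurable[OF S_measurable, of u] unfolding size_event_def by measurable

text \<open>Used in two ways: as the majorant of the gain terms by the inflow, and to see that a
  restricted mean vanishes with the probability of its size.\<close>

lemma restricted_mean_le_size_prob:
  assumes h: "h \<in> borel_measurable E" and bound: "\<And>y. y \<in> space E \<Longrightarrow> \<bar>h y\<bar> \<le> (C::real)" and u: "0 \<le> u"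
  shows "\<bar>restricted_mean n h u\<bar> \<le> C * size_prob M S n u"
proof -
  note [measurable] = size_event_measurable[OF u]
  note int = restricted_mean_integrable[OF h bound u]
  have "\<bar>restricted_mean n h u\<bar> \<le> (LINT \<omega>|M. \<bar>indicator {n} (fst (S u \<omega>)) * h (S u \<omega>)\<bar>)"
    unfolding restricted_mean_def by (rule integral_abs_bound)
  also have "\<dots> \<le> (LINT \<omega>|M. C * indicator (size_event M S n u) \<omega>)"
  proof (rule integral_mono)
    show "integrable M (\<lambda>\<omega>. \<bar>indicator {n} (fst (S u \<omega>)) * h (S u \<omega>)\<bar>)"
      using int by (rule integrable_abs)
    show "integrable M (\<lambda>\<omega>. C * indicator (size_event M S n u) \<omega>)"
      by (intro integrable_mult_right integrable_real_indicator) (auto simp: emeasure_eq_measure)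
    fix \<omega> assume \<omega>: "\<omega> \<in> space M"
    show "\<bar>indicator {n} (fst (S u \<omega>)) * h (S u \<omega>)\<bar> \<le> C * indicator (size_event M S n u) \<omega>"
      using bound[OF S_space[OF u \<omega>]] \<omega> by (auto simp: indicator_def size_event_def)
  qed
  also have "\<dots> = C * size_prob M S n u"
    by (simp add: size_prob_def)
  finally show ?thesis .
qed

lemma nn_integral_restricted_mean:
  assumes h: "h \<in> borel_measurable E" and bound: "\<And>y. y \<in> space E \<Longrightarrow> \<bar>h y\<bar> \<le> (C::real)"
    and nonneg: "\<And>y. y \<in> space E \<Longrightarrow> 0 \<le> h y" and u: "0 \<le> u"
  shows "(\<integral>\<^sup>+\<omega>. ennreal (indicator {n} (fst (S u \<omega>)) * h (S u \<omega>)) \<partial>M) = ennreal (restricted_mean n h u)"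
  unfolding restricted_mean_def
  by (intro nn_integral_eq_integral restricted_mean_integrable[OF h bound u] AE_I2)
    (auto intro!: mult_nonneg_nonneg nonneg S_space[OF u])

text \<open>Expectation of the balance along a path. In the gain, the state after a ring is first
  averaged over the kernel, which gives a function of the state before the ring; only for such
  functions is the formula for sums over rings available.\<close>

lemma nn_integral_balance:
  fixes g :: "state \<Rightarrow> real"
  assumes "0 < v" and g [measurable]: "g \<in> borel_measurable E"
    and g_nonneg: "\<And>y. 0 \<le> g y" and bound: "\<And>y. y \<in> space E \<Longrightarrow> g y \<le> C"
  shows "(\<integral>\<^sup>+\<omega>. ennreal (g (S v \<omega>)) \<partial>M) +
      (\<integral>\<^sup>+\<epsilon>. ennreal (rate \<epsilon>) * (\<integral>\<^sup>+u. indicator {0<..v} u *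
        (\<integral>\<^sup>+\<omega>. indicator {src \<epsilon>} (fst (S u \<omega>)) * ennreal (g (S u \<omega>)) \<partial>M) \<partial>lborel) \<partial>count_space \<Xi>) =
    (\<integral>\<^sup>+\<omega>. ennreal (g (S 0 \<omega>)) \<partial>M) +
      (\<integral>\<^sup>+\<epsilon>. ennreal (rate \<epsilon>) * (\<integral>\<^sup>+u. indicator {0<..v} u *
        (\<integral>\<^sup>+\<omega>. indicator {src \<epsilon>} (fst (S u \<omega>)) * (\<integral>\<^sup>+z. ennreal (g z) \<partial>K \<epsilon> (S u \<omega>)) \<partial>M) \<partial>lborel) \<partial>count_space \<Xi>)"
proof -
  have state_sum: "(\<integral>\<^sup>+\<omega>. (\<Sum>m. indicator (event_set \<epsilon> m v) \<omega> * h (S (ring_time \<epsilon> m \<omega>) \<omega>)) \<partial>M) =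
      ennreal (rate \<epsilon>) * (\<integral>\<^sup>+u. indicator {0<..v} u * (\<integral>\<^sup>+\<omega>. indicator {src \<epsilon>} (fst (S u \<omega>)) * h (S u \<omega>) \<partial>M) \<partial>lborel)"
    if \<epsilon>: "\<epsilon> \<in> \<Xi>" and [measurable]: "h \<in> borel_measurable E" and h_le: "\<And>y. y \<in> space E \<Longrightarrow> h y \<le> ennreal C" for \<epsilon> h
  proof -
    have "indicator (event_set \<epsilon> m v) \<omega> * h (S (ring_time \<epsilon> m \<omega>) \<omega>) = indicator {0<..v} (ring_time \<epsilon> m \<omega>) *
        (indicator {src \<epsilon>} (fst (S (ring_time \<epsilon> m \<omega>) \<omega>)) * h (S (ring_time \<epsilon> m \<omega>) \<omega>))" if "\<omega> \<in> space M" for m \<omega>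
      using that by (auto simp: event_set_def indicator_def)
    then have "(\<integral>\<^sup>+\<omega>. (\<Sum>m. indicator (event_set \<epsilon> m v) \<omega> * h (S (ring_time \<epsilon> m \<omega>) \<omega>)) \<partial>M) =
        (\<integral>\<^sup>+\<omega>. (\<Sum>m. indicator {0<..v} (ring_time \<epsilon> m \<omega>) *
          (indicator {src \<epsilon>} (fst (S (ring_time \<epsilon> m \<omega>) \<omega>)) * h (S (ring_time \<epsilon> m \<omega>) \<omega>))) \<partial>M)"
      by (intro nn_integral_cong suminf_cong)
    also have "\<dots> = ennreal (rate \<epsilon>) *
        (\<integral>\<^sup>+u. indicator {0<..v} u * (\<integral>\<^sup>+\<omega>. indicator {src \<epsilon>} (fst (S u \<omega>)) * h (S u \<omega>) \<partial>M) \<partial>lborel)"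
      using h_le by (intro nn_integral_sum_over_rings[OF \<epsilon> \<open>0 < v\<close>, of "\<lambda>y. indicator {src \<epsilon>} (fst y) * h y" C])
        (measurable, auto simp: indicator_def)
    finally show ?thesis .
  qed
  define L where "L \<epsilon> \<omega> = (\<Sum>m. indicator (event_set \<epsilon> m v) \<omega> * ennreal (g (S (ring_time \<epsilon> m \<omega>) \<omega>)))" for \<epsilon> \<omega>
  define G where "G \<epsilon> \<omega> = (\<Sum>m. indicator (event_set \<epsilon> m v) \<omega> * ennreal (g (post_state S (ring_time \<epsilon> m \<omega>) \<omega>)))" for \<epsilon> \<omega>
  have loss: "(\<integral>\<^sup>+\<omega>. L \<epsilon> \<omega> \<partial>M) = ennreal (rate \<epsilon>) * (\<integral>\<^sup>+u. indicator {0<..v} u *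
      (\<integral>\<^sup>+\<omega>. indicator {src \<epsilon>} (fst (S u \<omega>)) * ennreal (g (S u \<omega>)) \<partial>M) \<partial>lborel)" if "\<epsilon> \<in> \<Xi>" for \<epsilon>
    unfolding L_def using bound by (intro state_sum that) (auto intro: ennreal_leI)
  have gain: "(\<integral>\<^sup>+\<omega>. G \<epsilon> \<omega> \<partial>M) = ennreal (rate \<epsilon>) * (\<integral>\<^sup>+u. indicator {0<..v} u *
      (\<integral>\<^sup>+\<omega>. indicator {src \<epsilon>} (fst (S u \<omega>)) * (\<integral>\<^sup>+z. ennreal (g z) \<partial>K \<epsilon> (S u \<omega>)) \<partial>M) \<partial>lborel)" if \<epsilon>: "\<epsilon> \<in> \<Xi>" for \<epsilon>
  proof -
    note [measurable] = event_set_measurable[OF \<epsilon>] state_at_ring_measurable[OF \<epsilon>] measurable_prob_algebraD[OF kernel[OF \<epsilon>]]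
    have "(\<integral>\<^sup>+\<omega>. G \<epsilon> \<omega> \<partial>M) =
        (\<Sum>m. \<integral>\<^sup>+\<omega>. indicator (event_set \<epsilon> m v) \<omega> * ennreal (g (post_state S (ring_time \<epsilon> m \<omega>) \<omega>)) \<partial>M)"
      unfolding G_def by (rule nn_integral_suminf) measurable
    also have "\<dots> = (\<Sum>m. \<integral>\<^sup>+\<omega>. indicator (event_set \<epsilon> m v) \<omega> * (\<integral>\<^sup>+z. ennreal (g z) \<partial>K \<epsilon> (S (ring_time \<epsilon> m \<omega>) \<omega>)) \<partial>M)"
      using \<open>0 < v\<close> by (subst nn_integral_post_state[OF \<epsilon>]) auto
    also have "\<dots> = (\<integral>\<^sup>+\<omega>. (\<Sum>m. indicator (event_set \<epsilon> m v) \<omega> * (\<integral>\<^sup>+z. ennreal (g z) \<partial>K \<epsilon> (S (ring_time \<epsilon> m \<omega>) \<omega>))) \<partial>M)"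
      by (rule nn_integral_suminf[symmetric]) measurable
    also have "\<dots> = ennreal (rate \<epsilon>) * (\<integral>\<^sup>+u. indicator {0<..v} u *
      (\<integral>\<^sup>+\<omega>. indicator {src \<epsilon>} (fst (S u \<omega>)) * (\<integral>\<^sup>+z. ennreal (g z) \<partial>K \<epsilon> (S u \<omega>)) \<partial>M) \<partial>lborel)"
    proof (rule state_sum[OF \<epsilon>])
      fix y assume y: "y \<in> space E"
      interpret K: prob_space "K \<epsilon> y"
        by (rule kernel_prob_space[OF \<epsilon> y])
      have "(\<integral>\<^sup>+z. ennreal (g z) \<partial>K \<epsilon> y) \<le> (\<integral>\<^sup>+z. ennreal C \<partial>K \<epsilon> y)"
        using bound sets_eq_imp_space_eq[OF sets_kernel[OF \<epsilon> y]] by (intro nn_integral_mono ennreal_leI) auto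
      then show "(\<integral>\<^sup>+z. ennreal (g z) \<partial>K \<epsilon> y) \<le> ennreal C"
        by (simp add: K.emeasure_space_1)
    qed measurable
    finally show ?thesis .
  qed
  have L_meas: "L \<epsilon> \<in> borel_measurable M" if \<epsilon>: "\<epsilon> \<in> \<Xi>" for \<epsilon>
  proof -
    note [measurable] = event_set_measurable[OF \<epsilon>] state_at_ring_measurable[OF \<epsilon>]
    show ?thesis
      unfolding L_def by measurable
  qed
  have G_meas: "G \<epsilon> \<in> borel_measurable M" if \<epsilon>: "\<epsilon> \<in> \<Xi>" for \<epsilon>
  proof -
    note [measurable] = event_set_measurable[OF \<epsilon>] state_at_ring_measurable[OF \<epsilon>]
    show ?thesis
      unfolding G_def by measurable
  qed
  have [measurable]: "S v \<in> M \<rightarrow>\<^sub>M E" "S 0 \<in> M \<rightarrow>\<^sub>M E"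
    using \<open>0 < v\<close> by (auto intro: S_measurable)
  have meas_sum: "(\<lambda>\<omega>. \<integral>\<^sup>+\<epsilon>. Y \<epsilon> \<omega> \<partial>count_space \<Xi>) \<in> borel_measurable M"
    if "\<And>\<epsilon>. \<epsilon> \<in> \<Xi> \<Longrightarrow> Y \<epsilon> \<in> borel_measurable M" for Y :: "_ \<Rightarrow> _ \<Rightarrow> ennreal"
  proof -
    interpret sigma_finite_measure "count_space \<Xi>"
      by (rule sigma_finite_measure_count_space_countable[OF countable_clocks])
    have "(\<lambda>p. Y (snd p) (fst p)) \<in> borel_measurable (M \<Otimes>\<^sub>M count_space \<Xi>)"
      by (rule measurable_compose_countable'[where f="\<lambda>\<epsilon> p. Y \<epsilon> (fst p)", OF _ measurable_snd countable_clocks])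
        (rule measurable_compose[OF measurable_fst that])
    then have "(\<lambda>(\<omega>, \<epsilon>). Y \<epsilon> \<omega>) \<in> borel_measurable (M \<Otimes>\<^sub>M count_space \<Xi>)"
      by (simp add: split_beta')
    then show ?thesis
      by (rule borel_measurable_nn_integral)
  qed
  have "(\<integral>\<^sup>+\<omega>. ennreal (g (S v \<omega>)) + (\<integral>\<^sup>+\<epsilon>. L \<epsilon> \<omega> \<partial>count_space \<Xi>) \<partial>M) =
      (\<integral>\<^sup>+\<omega>. ennreal (g (S 0 \<omega>)) + (\<integral>\<^sup>+\<epsilon>. G \<epsilon> \<omega> \<partial>count_space \<Xi>) \<partial>M)"
    using AE_path_balance[OF less_imp_le[OF \<open>0 < v\<close>] g_nonneg] unfolding L_def G_def by (rule nn_integral_cong_AE)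
  then have "(\<integral>\<^sup>+\<omega>. ennreal (g (S v \<omega>)) \<partial>M) + (\<integral>\<^sup>+\<epsilon>. \<integral>\<^sup>+\<omega>. L \<epsilon> \<omega> \<partial>M \<partial>count_space \<Xi>) =
      (\<integral>\<^sup>+\<omega>. ennreal (g (S 0 \<omega>)) \<partial>M) + (\<integral>\<^sup>+\<epsilon>. \<integral>\<^sup>+\<omega>. G \<epsilon> \<omega> \<partial>M \<partial>count_space \<Xi>)"
    using L_meas G_meas
    by (simp add: nn_integral_add meas_sum nn_integral_count_space_nn_integral[OF countable_clocks, symmetric])
  then show ?thesis
    by (simp add: loss gain cong: nn_integral_cong_simp)
qed

text \<open>Infinitely many sizes may feed \<open>j\<close>, hence an unordered infinite sum. For
  bounded measurable \<open>h\<close>, summable inflow rules out the default value 0 of a divergent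
  \<open>infsum\<close>.\<close>

definition gain :: "nat \<Rightarrow> (state \<Rightarrow> real) \<Rightarrow> real \<Rightarrow> real" where
  "gain j h u = (\<Sum>\<^sub>\<infinity>\<epsilon>\<in>{\<epsilon> \<in> \<Xi>. arr \<epsilon> = j}. rate \<epsilon> * restricted_mean (src \<epsilon>) (\<lambda>y. LINT z|K \<epsilon> y. h z) u)"

definition loss :: "nat \<Rightarrow> (state \<Rightarrow> real) \<Rightarrow> real \<Rightarrow> real" where
  "loss j h u = (\<Sum>\<epsilon>\<in>{\<epsilon> \<in> \<Xi>. src \<epsilon> = j}. rate \<epsilon>) * restricted_mean j h u"

lemma restricted_mean_nonneg:
  "(\<And>y. y \<in> space E \<Longrightarrow> 0 \<le> h y) \<Longrightarrow> 0 \<le> u \<Longrightarrow> 0 \<le> restricted_mean n h u"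
  unfolding restricted_mean_def by (intro integral_nonneg_AE AE_I2) (simp add: S_space)

lemma restricted_mean_diff:
  assumes "h \<in> borel_measurable E" "\<And>y. y \<in> space E \<Longrightarrow> \<bar>h y\<bar> \<le> (C::real)"
    and "k \<in> borel_measurable E" "\<And>y. y \<in> space E \<Longrightarrow> \<bar>k y\<bar> \<le> (D::real)"
    and eq: "\<And>y. y \<in> space E \<Longrightarrow> f y = h y - k y" and u: "0 \<le> u"
  shows "restricted_mean n f u = restricted_mean n h u - restricted_mean n k u"
proof -
  have "restricted_mean n f u = (LINT \<omega>|M. indicator {n} (fst (S u \<omega>)) * h (S u \<omega>) - indicator {n} (fst (S u \<omega>)) * k (S u \<omega>))"
    unfolding restricted_mean_def
    by (intro Bochner_Integration.integral_cong refl) (simp add: eq S_space[OF u] right_diff_distrib)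
  also have "\<dots> = restricted_mean n h u - restricted_mean n k u"
    unfolding restricted_mean_def
    by (intro Bochner_Integration.integral_diff restricted_mean_integrable[OF assms(1,2) u] restricted_mean_integrable[OF assms(3,4) u])
  finally show ?thesis .
qed

section \<open>Differentiating the balance under uniform convergence of the inflow\<close>

context
  fixes j :: nat
  assumes inflow: "\<And>T. \<exists>r. uniform_limit {0..T}
        (\<lambda>X u. \<Sum>\<epsilon>\<in>X. rate \<epsilon> * size_prob M S (src \<epsilon>) u) r
        (finite_subsets_at_top {\<epsilon> \<in> \<Xi>. arr \<epsilon> = j})"
begin

lemma inflow_summable:
  assumes "0 \<le> u"
  shows "(\<lambda>\<epsilon>. rate \<epsilon> * size_prob M S (src \<epsilon>) u) summable_on {\<epsilon> \<in> \<Xi>. arr \<epsilon> = j}"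
proof -
  obtain r where r: "uniform_limit {0..u} (\<lambda>X u. \<Sum>\<epsilon>\<in>X. rate \<epsilon> * size_prob M S (src \<epsilon>) u) r
      (finite_subsets_at_top {\<epsilon> \<in> \<Xi>. arr \<epsilon> = j})"
    using inflow by blast
  have "((\<lambda>\<epsilon>. rate \<epsilon> * size_prob M S (src \<epsilon>) u) has_sum r u) {\<epsilon> \<in> \<Xi>. arr \<epsilon> = j}"
    unfolding has_sum_def using assms by (intro tendsto_uniform_limitI[OF r]) auto
  then show ?thesis
    by (rule has_sum_imp_summable)
qed

text \<open>A Weierstrass majorant: for bounded \<open>h\<close> the terms of the gain are dominated
  by \<open>C\<close> times those of the inflow, so the gain inherits absolute summability and
  uniform convergence.\<close>

lemma gain_term_bound:
  assumes h: "h \<in> borel_measurable E" and bound: "\<And>y. y \<in> space E \<Longrightarrow> \<bar>h y\<bar> \<le> (C::real)"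
    and \<epsilon>: "\<epsilon> \<in> \<Xi>" and u: "0 \<le> u"
  shows "\<bar>rate \<epsilon> * restricted_mean (src \<epsilon>) (\<lambda>y. LINT z|K \<epsilon> y. h z) u\<bar> \<le> C * (rate \<epsilon> * size_prob M S (src \<epsilon>) u)"
proof -
  have "\<bar>restricted_mean (src \<epsilon>) (\<lambda>y. LINT z|K \<epsilon> y. h z) u\<bar> \<le> C * size_prob M S (src \<epsilon>) u"
    by (intro restricted_mean_le_size_prob kernel_expectation_measurable kernel_expectation_bound \<epsilon> h bound u)
  from mult_left_mono[OF this rate_nonneg[OF \<epsilon>]] show ?thesis
    using rate_nonneg[OF \<epsilon>] by (simp add: abs_mult mult.left_commute)
qed

lemma gain_abs_summable:
  assumes "h \<in> borel_measurable E" and "\<And>y. y \<in> space E \<Longrightarrow> \<bar>h y\<bar> \<le> (C::real)" and "0 \<le> u"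
  shows "(\<lambda>\<epsilon>. \<bar>rate \<epsilon> * restricted_mean (src \<epsilon>) (\<lambda>y. LINT z|K \<epsilon> y. h z) u\<bar>) summable_on {\<epsilon> \<in> \<Xi>. arr \<epsilon> = j}"
  by (rule summable_on_comparison_test[OF summable_on_cmult_right[OF inflow_summable[OF assms(3)], of C]])
    (auto intro!: gain_term_bound assms)

lemma gain_summable:
  assumes "h \<in> borel_measurable E" and "\<And>y. y \<in> space E \<Longrightarrow> \<bar>h y\<bar> \<le> (C::real)" and "0 \<le> u"
  shows "(\<lambda>\<epsilon>. rate \<epsilon> * restricted_mean (src \<epsilon>) (\<lambda>y. LINT z|K \<epsilon> y. h z) u) summable_on {\<epsilon> \<in> \<Xi>. arr \<epsilon> = j}"
  using gain_abs_summable[OF assms] unfolding real_norm_def[symmetric] by (rule abs_summable_summable)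

text \<open>The tail of the gain outside a finite set of clocks is at most \<open>C\<close> times
  the tail of the inflow, uniformly on \<open>{0..T}\<close>. So the gain is a uniform limit of
  finite sums of continuous functions.\<close>

lemma gain_continuous:
  assumes h: "h \<in> borel_measurable E" and bound: "\<And>y. y \<in> space E \<Longrightarrow> \<bar>h y\<bar> \<le> (C::real)"
  shows "continuous_on {0..} (gain j h)"
proof -
  define A where "A = {\<epsilon> \<in> \<Xi>. arr \<epsilon> = j}"
  define q where "q u \<epsilon> = rate \<epsilon> * size_prob M S (src \<epsilon>) u" for u \<epsilon>
  define p where "p u \<epsilon> = rate \<epsilon> * restricted_mean (src \<epsilon>) (\<lambda>y. LINT z|K \<epsilon> y. h z) u" for u \<epsilon>
  have "0 \<le> C"
  proof -
    obtain \<omega> where "\<omega> \<in> space M"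
      using not_empty by blast
    then show ?thesis
      using bound[OF S_space[of 0 \<omega>]] by linarith
  qed
  have q_summable: "q u summable_on A" if "0 \<le> u" for u
    using inflow_summable[OF that] by (simp add: q_def[abs_def] A_def)
  have p_summable: "p u summable_on A" "(\<lambda>\<epsilon>. norm (p u \<epsilon>)) summable_on A" if "0 \<le> u" for u
    using gain_summable[OF h bound that] gain_abs_summable[OF h bound that] by (simp_all add: p_def[abs_def] A_def)
  have p_le: "norm (p u \<epsilon>) \<le> C * q u \<epsilon>" if "0 \<le> u" "\<epsilon> \<in> A" for u \<epsilon>
    using gain_term_bound[OF h bound _ that(1), of \<epsilon>] that(2) by (simp add: p_def q_def A_def)
  have "continuous_on {0..T} (gain j h)" for T
  proof (rule uniform_limit_theorem)
    obtain r where r: "uniform_limit {0..T} (\<lambda>X u. sum (q u) X) r (finite_subsets_at_top A)"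
      using inflow[of T] unfolding q_def A_def by blast
    have r_eq: "r u = infsum (q u) A" if "u \<in> {0..T}" for u
      using tendsto_uniform_limitI[OF r that] by (intro infsumI[symmetric]) (simp add: has_sum_def)
    show "uniform_limit {0..T} (\<lambda>X u. sum (p u) X) (gain j h) (finite_subsets_at_top A)"
    proof (rule uniform_limitI)
      fix e :: real assume "0 < e"
      \<comment> \<open>The denominator is \<open>C + 1\<close> because \<open>C\<close> may be
        0.\<close>
      then have "0 < e / (C + 1)"
        using \<open>0 \<le> C\<close> by simp
      from uniform_limitD[OF r this]
      have "\<forall>\<^sub>F X in finite_subsets_at_top A. (\<forall>u\<in>{0..T}. dist (sum (q u) X) (r u) < e / (C + 1)) \<and> finite X \<and> X \<subseteq> A"
        by (rule eventually_conj) (auto intro: eventually_finite_subsets_at_top_weakI)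
      then show "\<forall>\<^sub>F X in finite_subsets_at_top A. \<forall>u\<in>{0..T}. dist (sum (p u) X) (gain j h u) < e"
      proof eventually_elim
        case (elim X)
        show ?case
        proof
          fix u assume u: "u \<in> {0..T}"
          then have "0 \<le> u" by simp
          have X: "finite X" "X \<subseteq> A"
            using elim by auto
          have tail: "p u summable_on (A - X)" "(\<lambda>\<epsilon>. norm (p u \<epsilon>)) summable_on (A - X)" "q u summable_on (A - X)"
            using p_summable[OF \<open>0 \<le> u\<close>] q_summable[OF \<open>0 \<le> u\<close>]
            by (auto intro: summable_on_subset_banach)
          have "gain j h u - sum (p u) X = infsum (p u) (A - X)"
            using X p_summable[OF \<open>0 \<le> u\<close>] by (subst infsum_Diff) (auto simp: gain_def p_def[abs_def] A_def)
          then have "dist (sum (p u) X) (gain j h u) = norm (infsum (p u) (A - X))"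
            by (simp add: dist_norm norm_minus_commute)
          also have "\<dots> \<le> infsum (\<lambda>\<epsilon>. norm (p u \<epsilon>)) (A - X)"
            by (rule norm_infsum_bound[OF tail(2)])
          also have "\<dots> \<le> infsum (\<lambda>\<epsilon>. C * q u \<epsilon>) (A - X)"
            using tail p_le[OF \<open>0 \<le> u\<close>] by (intro infsum_mono summable_on_cmult_right) auto
          also have "\<dots> = C * infsum (q u) (A - X)"
            by (rule infsum_cmult_right) (use tail in auto)
          also have "infsum (q u) (A - X) = r u - sum (q u) X"
            using X q_summable[OF \<open>0 \<le> u\<close>] by (subst infsum_Diff) (auto simp: r_eq[OF u])
          also have "C * (r u - sum (q u) X) \<le> C * (e / (C + 1))"
          proof (rule mult_left_mono[OF _ \<open>0 \<le> C\<close>])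
            have "dist (sum (q u) X) (r u) < e / (C + 1)"
              using elim u by blast
            then show "r u - sum (q u) X \<le> e / (C + 1)"
              by (simp add: dist_real_def)
          qed
          also have "\<dots> < e"
            using \<open>0 \<le> C\<close> \<open>0 < e\<close> by (simp add: field_simps)
          finally show "dist (sum (p u) X) (gain j h u) < e" .
        qed
      qed
    qed
    have "continuous_on {0..T} (\<lambda>u. p u \<epsilon>)" if "\<epsilon> \<in> A" for \<epsilon>
    proof -
      have "continuous_on {0..} (restricted_mean (src \<epsilon>) (\<lambda>y. LINT z|K \<epsilon> y. h z))"
        using that kernel_expectation_measurable[OF _ h] kernel_expectation_bound(2)[OF _ h bound]
        by (intro restricted_mean_continuous[where C=C]) (auto simp: A_def)
      then show ?thesis
        unfolding p_def by (intro continuous_intros) (auto elim: continuous_on_subset)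
    qed
    then show "\<forall>\<^sub>F X in finite_subsets_at_top A. continuous_on {0..T} (\<lambda>u. sum (p u) X)"
      by (intro eventually_finite_subsets_at_top_weakI continuous_on_sum) auto
  qed simp
  \<comment> \<open>Passing from every \<open>{0..T}\<close> to \<open>{0..}\<close>: near
    \<open>t\<close> the horizon \<open>t + 1\<close> is not visible.\<close>
  moreover have "at t within {0..t + 1} = at t within {0..}" if "0 \<le> t" for t :: real
    using that by (intro at_within_nhd[of _ "{..<t + 1}"]) auto
  ultimately show ?thesis
    unfolding continuous_on_def by (metis atLeastAtMost_iff atLeast_iff le_add_same_cancel1 order_refl zero_le_one)
qed

text \<open>\<open>nn_integral_balance\<close> for \<open>h\<close> cut off outside size
  \<open>j\<close>. The cut-off leaves the loss to the finitely many clocks with source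
  \<open>j\<close>, and the gain to those with arrival \<open>j\<close>; a clock with both occurs on
  both sides. All four terms are then finite, so the identity descends to the reals.\<close>

lemma nonneg_balance:
  assumes h: "h \<in> borel_measurable E" and h_nonneg: "\<And>y. 0 \<le> h y" and h_le: "\<And>y. y \<in> space E \<Longrightarrow> h y \<le> (C::real)"
    and "0 < v"
  shows "restricted_mean j h v + integral {0..v} (loss j h) = restricted_mean j h 0 + integral {0..v} (gain j h)"
proof -
  note [measurable] = h
  have bound: "\<bar>h y\<bar> \<le> C" if "y \<in> space E" for y
    using h_nonneg[of y] h_le[OF that] by simp
  define g where "g y = indicator {j} (fst y) * h y" for y
  have g [measurable]: "g \<in> borel_measurable E" and g_nonneg: "0 \<le> g y" for y
    unfolding g_def using h_nonneg by auto
  have g_le: "g y \<le> C" if "y \<in> space E" for y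
    using h_le[OF that] h_nonneg[of y] by (auto simp: g_def indicator_def)
  define Kh where "Kh \<epsilon> y = (LINT z|K \<epsilon> y. h z)" for \<epsilon> y
  have Kh: "Kh \<epsilon> \<in> borel_measurable E" "\<And>y. y \<in> space E \<Longrightarrow> \<bar>Kh \<epsilon> y\<bar> \<le> C" "0 \<le> Kh \<epsilon> y" if "\<epsilon> \<in> \<Xi>" for \<epsilon> y
    unfolding Kh_def using h_nonneg kernel_expectation_measurable[OF that h] kernel_expectation_bound(2)[OF that h bound]
    by auto
  have state: "(\<integral>\<^sup>+\<omega>. ennreal (g (S u \<omega>)) \<partial>M) = ennreal (restricted_mean j h u)" if "0 \<le> u" for u
    unfolding g_def by (intro nn_integral_restricted_mean[OF h bound h_nonneg that])
  have loss_term: "ennreal (rate \<epsilon>) * (\<integral>\<^sup>+u. indicator {0<..v} u *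
        (\<integral>\<^sup>+\<omega>. indicator {src \<epsilon>} (fst (S u \<omega>)) * ennreal (g (S u \<omega>)) \<partial>M) \<partial>lborel) =
      (if src \<epsilon> = j then ennreal (rate \<epsilon> * integral {0..v} (restricted_mean j h)) else 0)" if \<epsilon>: "\<epsilon> \<in> \<Xi>" for \<epsilon>
  proof (cases "src \<epsilon> = j")
    case True
    have "indicator {src \<epsilon>} (fst y) * ennreal (g y) = ennreal (g y)" for y
      using True by (auto simp: g_def indicator_def)
    then have "(\<integral>\<^sup>+u. indicator {0<..v} u *
        (\<integral>\<^sup>+\<omega>. indicator {src \<epsilon>} (fst (S u \<omega>)) * ennreal (g (S u \<omega>)) \<partial>M) \<partial>lborel) =
        (\<integral>\<^sup>+u. indicator {0<..v} u * ennreal (restricted_mean j h u) \<partial>lborel)"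
      using state by (intro nn_integral_cong) (auto simp: indicator_def)
    also have "\<dots> = ennreal (integral {0..v} (restricted_mean j h))"
      using h_nonneg by (intro nn_integral_Ioc_eq_integral continuous_on_subset[OF restricted_mean_continuous[OF h bound]])
        (auto intro: restricted_mean_nonneg)
    finally show ?thesis
      using True rate_nonneg[OF \<epsilon>] by (simp add: ennreal_mult')
  next
    case False
    then have zero: "indicator {src \<epsilon>} (fst y) * ennreal (g y) = 0" for y
      by (auto simp: g_def indicator_def)
    show ?thesis
      using False by (simp only: zero if_False) simp
  qed
  have integral_nonneg: "0 \<le> integral {0..v} (restricted_mean j h)"
    using h_nonneg by (intro Henstock_Kurzweil_Integration.integral_nonneg integrable_continuous_real
        continuous_on_subset[OF restricted_mean_continuous[OF h bound]]) (auto intro: restricted_mean_nonneg)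
  have loss_sum: "(\<integral>\<^sup>+\<epsilon>. ennreal (rate \<epsilon>) * (\<integral>\<^sup>+u. indicator {0<..v} u *
        (\<integral>\<^sup>+\<omega>. indicator {src \<epsilon>} (fst (S u \<omega>)) * ennreal (g (S u \<omega>)) \<partial>M) \<partial>lborel) \<partial>count_space \<Xi>) =
      ennreal (integral {0..v} (loss j h))"
  proof -
    have "(\<integral>\<^sup>+\<epsilon>. ennreal (rate \<epsilon>) * (\<integral>\<^sup>+u. indicator {0<..v} u *
        (\<integral>\<^sup>+\<omega>. indicator {src \<epsilon>} (fst (S u \<omega>)) * ennreal (g (S u \<omega>)) \<partial>M) \<partial>lborel) \<partial>count_space \<Xi>) =
        (\<integral>\<^sup>+\<epsilon>. (if src \<epsilon> = j then ennreal (rate \<epsilon> * integral {0..v} (restricted_mean j h)) else 0) \<partial>count_space \<Xi>)"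
      by (intro nn_integral_cong loss_term) simp
    also have "\<dots> = (\<Sum>\<epsilon>\<in>{\<epsilon> \<in> \<Xi>. src \<epsilon> = j}. if src \<epsilon> = j then ennreal (rate \<epsilon> * integral {0..v} (restricted_mean j h)) else 0)"
      by (rule nn_integral_count_space'[OF finite_clocks]) auto
    also have "\<dots> = (\<Sum>\<epsilon>\<in>{\<epsilon> \<in> \<Xi>. src \<epsilon> = j}. ennreal (rate \<epsilon> * integral {0..v} (restricted_mean j h)))"
      by (intro sum.cong) auto
    also have "\<dots> = ennreal (\<Sum>\<epsilon>\<in>{\<epsilon> \<in> \<Xi>. src \<epsilon> = j}. rate \<epsilon> * integral {0..v} (restricted_mean j h))"
      using integral_nonneg rate_nonneg by (intro sum_ennreal) auto
    also have "(\<Sum>\<epsilon>\<in>{\<epsilon> \<in> \<Xi>. src \<epsilon> = j}. rate \<epsilon> * integral {0..v} (restricted_mean j h)) = integral {0..v} (loss j h)"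
      unfolding loss_def sum_distrib_right[symmetric] by simp
    finally show ?thesis .
  qed
  \<comment> \<open>After an event the size is \<open>arr \<epsilon>\<close> almost surely, so the
    cut-off at \<open>j\<close> either does nothing under the kernel or annihilates the whole
    average.\<close>
  have kernel_g: "indicator {src \<epsilon>} (fst y) * (\<integral>\<^sup>+z. ennreal (g z) \<partial>K \<epsilon> y) =
      (if arr \<epsilon> = j then ennreal (indicator {src \<epsilon>} (fst y) * Kh \<epsilon> y) else 0)" if \<epsilon>: "\<epsilon> \<in> \<Xi>" and y: "y \<in> space E" for \<epsilon> y
  proof (cases "fst y = src \<epsilon>")
    case True
    note size = kernel_size[OF \<epsilon> y True]
    show ?thesis
    proof (cases "arr \<epsilon> = j")
      case True
      have "(\<integral>\<^sup>+z. ennreal (g z) \<partial>K \<epsilon> y) = (\<integral>\<^sup>+z. ennreal (h z) \<partial>K \<epsilon> y)"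
        using size by (intro nn_integral_cong_AE) (auto elim!: eventually_mono simp: g_def True)
      also have "\<dots> = ennreal (Kh \<epsilon> y)"
        unfolding Kh_def using h_nonneg by (intro nn_integral_eq_integral kernel_expectation_bound(1)[OF \<epsilon> h bound y]) auto
      finally show ?thesis
        using True \<open>fst y = src \<epsilon>\<close> by simp
    next
      case False
      then have "(\<integral>\<^sup>+z. ennreal (g z) \<partial>K \<epsilon> y) = (\<integral>\<^sup>+z. 0 \<partial>K \<epsilon> y)"
        using size by (intro nn_integral_cong_AE) (auto elim!: eventually_mono simp: g_def)
      then show ?thesis
        using False by simp
    qed
  qed simp
  have gain_term: "ennreal (rate \<epsilon>) * (\<integral>\<^sup>+u. indicator {0<..v} u *
        (\<integral>\<^sup>+\<omega>. indicator {src \<epsilon>} (fst (S u \<omega>)) * (\<integral>\<^sup>+z. ennreal (g z) \<partial>K \<epsilon> (S u \<omega>)) \<partial>M) \<partial>lborel) =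
      (if arr \<epsilon> = j then \<integral>\<^sup>+u. indicator {0<..v} u * ennreal (rate \<epsilon> * restricted_mean (src \<epsilon>) (Kh \<epsilon>) u) \<partial>lborel else 0)" if \<epsilon>: "\<epsilon> \<in> \<Xi>" for \<epsilon>
  proof -
    have inner: "(\<integral>\<^sup>+\<omega>. indicator {src \<epsilon>} (fst (S u \<omega>)) * (\<integral>\<^sup>+z. ennreal (g z) \<partial>K \<epsilon> (S u \<omega>)) \<partial>M) =
        (if arr \<epsilon> = j then ennreal (restricted_mean (src \<epsilon>) (Kh \<epsilon>) u) else 0)" if "0 \<le> u" for u
    proof -
      have "(\<integral>\<^sup>+\<omega>. indicator {src \<epsilon>} (fst (S u \<omega>)) * (\<integral>\<^sup>+z. ennreal (g z) \<partial>K \<epsilon> (S u \<omega>)) \<partial>M) =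
          (\<integral>\<^sup>+\<omega>. (if arr \<epsilon> = j then ennreal (indicator {src \<epsilon>} (fst (S u \<omega>)) * Kh \<epsilon> (S u \<omega>)) else 0) \<partial>M)"
        using that by (intro nn_integral_cong kernel_g[OF \<epsilon>] S_space)
      then show ?thesis
        using nn_integral_restricted_mean[OF Kh[OF \<epsilon>] that] by simp
    qed
    have [measurable]: "(\<lambda>u. indicator {0<..v} u * ennreal (restricted_mean (src \<epsilon>) (Kh \<epsilon>) u)) \<in> borel_measurable lborel"
      by (intro borel_measurable_Ioc_continuous restricted_mean_continuous[where C=C] Kh(1,2)[OF \<epsilon>])
    have "(\<integral>\<^sup>+u. indicator {0<..v} u *
        (\<integral>\<^sup>+\<omega>. indicator {src \<epsilon>} (fst (S u \<omega>)) * (\<integral>\<^sup>+z. ennreal (g z) \<partial>K \<epsilon> (S u \<omega>)) \<partial>M) \<partial>lborel) =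
        (\<integral>\<^sup>+u. (if arr \<epsilon> = j then indicator {0<..v} u * ennreal (restricted_mean (src \<epsilon>) (Kh \<epsilon>) u) else 0) \<partial>lborel)"
    proof (rule nn_integral_cong)
      fix u :: real
      show "indicator {0<..v} u * (\<integral>\<^sup>+\<omega>. indicator {src \<epsilon>} (fst (S u \<omega>)) * (\<integral>\<^sup>+z. ennreal (g z) \<partial>K \<epsilon> (S u \<omega>)) \<partial>M) =
          (if arr \<epsilon> = j then indicator {0<..v} u * ennreal (restricted_mean (src \<epsilon>) (Kh \<epsilon>) u) else 0)"
      proof (cases "u \<in> {0<..v}")
        case True
        then have "0 \<le> u" by simp
        show ?thesis
          unfolding inner[OF \<open>0 \<le> u\<close>] by simp
      qed simp
    qed
    then show ?thesis
      using rate_nonneg[OF \<epsilon>] by (auto simp: nn_integral_cmult[symmetric] ennreal_mult' mult.left_commute)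
  qed
  have gain_nonneg: "0 \<le> gain j h u" if "0 \<le> u" for u
    unfolding gain_def using that rate_nonneg Kh(3)
    by (intro infsum_nonneg mult_nonneg_nonneg restricted_mean_nonneg) (auto simp: Kh_def)
  have gain_sum: "(\<integral>\<^sup>+\<epsilon>. ennreal (rate \<epsilon>) * (\<integral>\<^sup>+u. indicator {0<..v} u *
        (\<integral>\<^sup>+\<omega>. indicator {src \<epsilon>} (fst (S u \<omega>)) * (\<integral>\<^sup>+z. ennreal (g z) \<partial>K \<epsilon> (S u \<omega>)) \<partial>M) \<partial>lborel) \<partial>count_space \<Xi>) =
      ennreal (integral {0..v} (gain j h))"
  proof -
    let ?A = "{\<epsilon> \<in> \<Xi>. arr \<epsilon> = j}"
    have "(\<integral>\<^sup>+\<epsilon>. ennreal (rate \<epsilon>) * (\<integral>\<^sup>+u. indicator {0<..v} u *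
        (\<integral>\<^sup>+\<omega>. indicator {src \<epsilon>} (fst (S u \<omega>)) * (\<integral>\<^sup>+z. ennreal (g z) \<partial>K \<epsilon> (S u \<omega>)) \<partial>M) \<partial>lborel) \<partial>count_space \<Xi>) =
        (\<integral>\<^sup>+\<epsilon>. (if arr \<epsilon> = j then \<integral>\<^sup>+u. indicator {0<..v} u * ennreal (rate \<epsilon> * restricted_mean (src \<epsilon>) (Kh \<epsilon>) u) \<partial>lborel else 0) \<partial>count_space \<Xi>)"
      by (intro nn_integral_cong gain_term) simp
    also have "\<dots> = (\<integral>\<^sup>+\<epsilon>. (if arr \<epsilon> = j then \<integral>\<^sup>+u. indicator {0<..v} u * ennreal (rate \<epsilon> * restricted_mean (src \<epsilon>) (Kh \<epsilon>) u) \<partial>lborel else 0) \<partial>count_space ?A)"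
      by (rule nn_integral_count_space_eq) auto
    also have "\<dots> = (\<integral>\<^sup>+\<epsilon>. (\<integral>\<^sup>+u. indicator {0<..v} u * ennreal (rate \<epsilon> * restricted_mean (src \<epsilon>) (Kh \<epsilon>) u) \<partial>lborel) \<partial>count_space ?A)"
      by (intro nn_integral_cong) simp
    \<comment> \<open>Tonelli for countably many clocks brings the sum under the time integral,
      where it becomes the gain at a single time.\<close>
    also have "\<dots> = (\<integral>\<^sup>+u. (\<integral>\<^sup>+\<epsilon>. indicator {0<..v} u * ennreal (rate \<epsilon> * restricted_mean (src \<epsilon>) (Kh \<epsilon>) u) \<partial>count_space ?A) \<partial>lborel)"
    proof (rule nn_integral_count_space_nn_integral[symmetric])
      show "countable ?A"
        using countable_clocks by (rule countable_subset[rotated]) auto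
      show "(\<lambda>u. indicator {0<..v} u * ennreal (rate \<epsilon> * restricted_mean (src \<epsilon>) (Kh \<epsilon>) u)) \<in> borel_measurable lborel" if "\<epsilon> \<in> ?A" for \<epsilon>
        using that by (intro borel_measurable_Ioc_continuous continuous_on_mult_left restricted_mean_continuous[where C=C] Kh(1,2)) auto
    qed
    also have "\<dots> = (\<integral>\<^sup>+u. indicator {0<..v} u * ennreal (gain j h u) \<partial>lborel)"
    proof (rule nn_integral_cong)
      fix u :: real
      show "(\<integral>\<^sup>+\<epsilon>. indicator {0<..v} u * ennreal (rate \<epsilon> * restricted_mean (src \<epsilon>) (Kh \<epsilon>) u) \<partial>count_space ?A) =
          indicator {0<..v} u * ennreal (gain j h u)"
      proof (cases "u \<in> {0<..v}")
        case True
        then have "0 \<le> u" by simp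
        have "(\<integral>\<^sup>+\<epsilon>. ennreal (rate \<epsilon> * restricted_mean (src \<epsilon>) (Kh \<epsilon>) u) \<partial>count_space ?A) = ennreal (gain j h u)"
        proof -
          have gain_eq: "gain j h u = (\<Sum>\<^sub>\<infinity>\<epsilon>\<in>?A. rate \<epsilon> * restricted_mean (src \<epsilon>) (Kh \<epsilon>) u)"
            by (simp add: gain_def Kh_def[abs_def])
          have summable: "(\<lambda>\<epsilon>. rate \<epsilon> * restricted_mean (src \<epsilon>) (Kh \<epsilon>) u) summable_on ?A"
            using gain_summable[OF h bound \<open>0 \<le> u\<close>] by (simp add: Kh_def[abs_def])
          show ?thesis
            unfolding gain_eq using \<open>0 \<le> u\<close> rate_nonneg Kh(3)
            by (intro nn_integral_count_space_infsum[OF summable] mult_nonneg_nonneg restricted_mean_nonneg) auto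
        qed
        then show ?thesis
          using True by simp
      qed simp
    qed
    also have "\<dots> = ennreal (integral {0..v} (gain j h))"
      by (intro nn_integral_Ioc_eq_integral continuous_on_subset[OF gain_continuous[OF h bound]] gain_nonneg) auto
    finally show ?thesis .
  qed
  have "ennreal (restricted_mean j h v) + ennreal (integral {0..v} (loss j h)) =
      ennreal (restricted_mean j h 0) + ennreal (integral {0..v} (gain j h))"
    using nn_integral_balance[OF \<open>0 < v\<close> g g_nonneg g_le] \<open>0 < v\<close>
    unfolding loss_sum gain_sum by (simp add: state)
  moreover have "0 \<le> integral {0..v} (loss j h)"
    using mult_nonneg_nonneg[OF sum_nonneg integral_nonneg, of "{\<epsilon> \<in> \<Xi>. src \<epsilon> = j}" rate] rate_nonneg
    by (simp add: loss_def[abs_def])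
  moreover have "0 \<le> integral {0..v} (gain j h)"
    by (intro Henstock_Kurzweil_Integration.integral_nonneg integrable_continuous_real
        continuous_on_subset[OF gain_continuous[OF h bound]] gain_nonneg) auto
  moreover have "0 \<le> restricted_mean j h u" if "0 \<le> u" for u
    using h_nonneg that by (intro restricted_mean_nonneg)
  ultimately show ?thesis
    using \<open>0 < v\<close> by (simp flip: ennreal_plus)
qed

text \<open>The fundamental theorem of calculus for the integrated balance: the net flow is
  continuous, so the derivative exists at every time and not merely at almost every time.\<close>

lemma nonneg_derivative:
  assumes h: "h \<in> borel_measurable E" and h_nonneg: "\<And>y. 0 \<le> h y" and h_le: "\<And>y. y \<in> space E \<Longrightarrow> h y \<le> (C::real)"
    and "0 \<le> t"
  shows "(restricted_mean j h has_real_derivative gain j h t - loss j h t) (at t within {0..})"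
proof -
  have bound: "\<bar>h y\<bar> \<le> C" if "y \<in> space E" for y
    using h_nonneg[of y] h_le[OF that] by simp
  have cont_loss: "continuous_on {0..} (loss j h)"
    unfolding loss_def by (intro continuous_on_mult_left restricted_mean_continuous[OF h bound])
  note cont_gain = gain_continuous[OF h bound]
  let ?net = "\<lambda>u. gain j h u - loss j h u"
  have cont: "continuous_on {0..T} ?net" for T
    using cont_gain cont_loss by (intro continuous_on_diff) (auto elim: continuous_on_subset)
  have mean_eq: "restricted_mean j h u = restricted_mean j h 0 + integral {0..u} ?net" if "u \<in> {0..}" for u
  proof (cases "u = 0")
    case False
    with that have "0 < u" by simp
    have "integral {0..u} ?net = integral {0..u} (gain j h) - integral {0..u} (loss j h)"
      using cont_gain cont_loss
      by (intro Henstock_Kurzweil_Integration.integral_diff integrable_continuous_real) (auto elim: continuous_on_subset)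
    then show ?thesis
      using nonneg_balance[OF h h_nonneg h_le \<open>0 < u\<close>] by simp
  qed simp
  have "((\<lambda>u. integral {0..u} ?net) has_vector_derivative ?net t) (at t within {0..t + 1})"
    using \<open>0 \<le> t\<close> by (intro integral_has_vector_derivative cont) auto
  \<comment> \<open>The horizon \<open>t + 1\<close> leaves room to the right of \<open>t\<close>,
    so the derivative within the compact interval is the one within \<open>{0..}\<close>.\<close>
  moreover have "at t within {0..t + 1} = at t within {0..}"
    by (rule at_within_nhd[of _ "{..<t + 1}"]) auto
  ultimately have "((\<lambda>u. integral {0..u} ?net) has_real_derivative ?net t) (at t within {0..})"
    by (simp add: has_real_derivative_iff_has_vector_derivative)
  from DERIV_add[OF DERIV_const[of "restricted_mean j h 0"] this]
  have "((\<lambda>u. restricted_mean j h 0 + integral {0..u} ?net) has_real_derivative ?net t) (at t within {0..})"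
    by simp
  then show ?thesis
    by (rule has_field_derivative_transform_within[OF _ zero_less_one]) (use \<open>0 \<le> t\<close> mean_eq[symmetric] in auto)
qed

text \<open>Mean, gain and loss are linear in bounded \<open>h\<close>, so the nonnegative case is
  applied to \<open>h + C\<close> and to the constant \<open>C\<close>, and the two results are
  subtracted.\<close>

lemma restricted_mean_derivative:
  assumes h: "h \<in> borel_measurable E" and bound: "\<And>y. y \<in> space E \<Longrightarrow> \<bar>h y\<bar> \<le> (C::real)" and t: "0 \<le> t"
  shows "(restricted_mean j h has_real_derivative gain j h t - loss j h t) (at t within {0..})"
proof -
  \<comment> \<open>On \<open>space E\<close> this is just \<open>h y + C\<close>; the maximum makes
    \<open>h'\<close> nonnegative at all states, also outside \<open>space E\<close>, as
    \<open>nonneg_derivative\<close> demands.\<close>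
  define h' where "h' y = max 0 (h y + C)" for y
  have "0 \<le> C"
  proof -
    obtain \<omega> where "\<omega> \<in> space M"
      using not_empty by blast
    then show ?thesis
      using bound[OF S_space[of 0 \<omega>]] by linarith
  qed
  have h' [measurable]: "h' \<in> borel_measurable E"
    using h unfolding h'_def by measurable
  have h'_eq: "h' y = h y + C" "h' y \<le> 2 * C" "\<bar>h' y\<bar> \<le> 2 * C" if "y \<in> space E" for y
    using bound[OF that] by (auto simp: h'_def)
  have C: "(\<lambda>y. C) \<in> borel_measurable E" "\<And>y. y \<in> space E \<Longrightarrow> \<bar>C\<bar> \<le> C"
    using \<open>0 \<le> C\<close> by auto
  have mean_eq: "restricted_mean n h u = restricted_mean n h' u - restricted_mean n (\<lambda>_. C) u" if "0 \<le> u" for n u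
    using that by (intro restricted_mean_diff[OF h' h'_eq(3) C]) (auto simp: h'_eq)
  have "rate \<epsilon> * restricted_mean (src \<epsilon>) (\<lambda>y. LINT z|K \<epsilon> y. h' z) t =
      rate \<epsilon> * restricted_mean (src \<epsilon>) (\<lambda>y. LINT z|K \<epsilon> y. h z) t +
      rate \<epsilon> * restricted_mean (src \<epsilon>) (\<lambda>y. LINT z|K \<epsilon> y. C) t" if \<epsilon>: "\<epsilon> \<in> \<Xi>" for \<epsilon>
  proof -
    have "(LINT z|K \<epsilon> y. h z) = (LINT z|K \<epsilon> y. h' z) - (LINT z|K \<epsilon> y. C)" if y: "y \<in> space E" for y
    proof -
      have "(LINT z|K \<epsilon> y. h z) = (LINT z|K \<epsilon> y. h' z - C)"
        using h'_eq(1) sets_eq_imp_space_eq[OF sets_kernel[OF \<epsilon> y]] by (intro Bochner_Integration.integral_cong) auto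
      also have "\<dots> = (LINT z|K \<epsilon> y. h' z) - (LINT z|K \<epsilon> y. C)"
        by (intro Bochner_Integration.integral_diff kernel_expectation_bound(1)[OF \<epsilon> h' h'_eq(3) y] kernel_expectation_bound(1)[OF \<epsilon> C y])
      finally show ?thesis .
    qed
    then have "restricted_mean (src \<epsilon>) (\<lambda>y. LINT z|K \<epsilon> y. h z) t =
        restricted_mean (src \<epsilon>) (\<lambda>y. LINT z|K \<epsilon> y. h' z) t - restricted_mean (src \<epsilon>) (\<lambda>y. LINT z|K \<epsilon> y. C) t"
      by (intro restricted_mean_diff[OF kernel_expectation_measurable[OF \<epsilon> h'] kernel_expectation_bound(2)[OF \<epsilon> h' h'_eq(3)]
            kernel_expectation_measurable[OF \<epsilon> C(1)] kernel_expectation_bound(2)[OF \<epsilon> C]] t)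
    then have "restricted_mean (src \<epsilon>) (\<lambda>y. LINT z|K \<epsilon> y. h' z) t =
        restricted_mean (src \<epsilon>) (\<lambda>y. LINT z|K \<epsilon> y. h z) t + restricted_mean (src \<epsilon>) (\<lambda>y. LINT z|K \<epsilon> y. C) t"
      by linarith
    then show ?thesis
      by (simp only: distrib_left)
  qed
  then have "gain j h' t = (\<Sum>\<^sub>\<infinity>\<epsilon>\<in>{\<epsilon> \<in> \<Xi>. arr \<epsilon> = j}.
      rate \<epsilon> * restricted_mean (src \<epsilon>) (\<lambda>y. LINT z|K \<epsilon> y. h z) t +
      rate \<epsilon> * restricted_mean (src \<epsilon>) (\<lambda>y. LINT z|K \<epsilon> y. C) t)"
    unfolding gain_def by (intro infsum_cong) blast
  also have "\<dots> = gain j h t + gain j (\<lambda>_. C) t"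
    unfolding gain_def by (rule infsum_add[OF gain_summable[OF h bound t] gain_summable[OF C t]])
  finally have gain_eq: "gain j h t = gain j h' t - gain j (\<lambda>_. C) t"
    by simp
  have "((\<lambda>u. restricted_mean j h' u - restricted_mean j (\<lambda>_. C) u) has_real_derivative
      (gain j h' t - loss j h' t) - (gain j (\<lambda>_. C) t - loss j (\<lambda>_. C) t)) (at t within {0..})"
    using \<open>0 \<le> C\<close>
    by (intro DERIV_diff nonneg_derivative[OF h' _ h'_eq(2) t] nonneg_derivative[OF C(1) _ _ t]) (auto simp: h'_def)
  moreover have "(gain j h' t - loss j h' t) - (gain j (\<lambda>_. C) t - loss j (\<lambda>_. C) t) = gain j h t - loss j h t"
    unfolding gain_eq loss_def mean_eq[OF t] by (simp add: algebra_simps)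
  ultimately have "((\<lambda>u. restricted_mean j h' u - restricted_mean j (\<lambda>_. C) u) has_real_derivative
      gain j h t - loss j h t) (at t within {0..})"
    by simp
  then show ?thesis
    by (rule has_field_derivative_transform_within[OF _ zero_less_one]) (use t mean_eq in auto)
qed

end

end

section \<open>The bound on the gain\<close>

text \<open>Holds for null sets \<open>A\<close> as well: \<open>uniform_measure\<close> is then the
  null measure, and the right-hand side is a division by 0, which gives 0.\<close>

lemma (in finite_measure) integral_uniform_measure:
  fixes X :: "'a \<Rightarrow> real"
  assumes A: "A \<in> sets M" and X: "X \<in> borel_measurable M"
  shows "integral\<^sup>L (uniform_measure M A) X = (LINT \<omega>|M. indicator A \<omega> * X \<omega>) / measure M A"
proof (cases "measure M A = 0")
  case True
  then have "AE \<omega> in M. \<omega> \<notin> A"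
    using A by (intro AE_not_in null_setsI) (simp_all add: emeasure_eq_measure)
  then have "AE \<omega> in uniform_measure M A. X \<omega> = 0"
    unfolding uniform_measure_def using A by (subst AE_density) (auto elim!: eventually_mono)
  then have "integral\<^sup>L (uniform_measure M A) X = 0"
    by (rule integral_eq_zero_AE)
  then show ?thesis
    using True by simp
next
  case False
  then have "0 < measure M A"
    using measure_nonneg[of M A] by linarith
  then have "indicator A \<omega> / emeasure M A = ennreal (indicator A \<omega> / measure M A)" for \<omega>
    by (cases "\<omega> \<in> A") (simp_all add: emeasure_eq_measure divide_ennreal[of 1, simplified])
  then have "uniform_measure M A = density M (\<lambda>\<omega>. ennreal (indicator A \<omega> / measure M A))"
    unfolding uniform_measure_def by simp
  then have "integral\<^sup>L (uniform_measure M A) X = (LINT \<omega>|M. indicator A \<omega> / measure M A * X \<omega>)"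
    using A X by (simp add: integral_real_density)
  then show ?thesis
    by simp
qed

section \<open>Conditional means and the law of an event\<close>

context clock_jump_process
begin

text \<open>Multiplication by the probability of the size undoes the normalisation of the
  conditional law. If that probability is 0, both sides are 0, in agreement with the convention for
  the product.\<close>

lemma integral_uniform_size_event:
  fixes h :: "state \<Rightarrow> real"
  assumes [measurable]: "h \<in> borel_measurable E" and u: "0 \<le> u"
  shows "size_prob M S n u * (LINT \<omega>|uniform_measure M (size_event M S n u). h (S u \<omega>)) = restricted_mean n h u"
proof -
  note [measurable] = S_measurable[OF u] size_event_measurable[OF u]
  have "(LINT \<omega>|M. indicator (size_event M S n u) \<omega> * h (S u \<omega>)) = restricted_mean n h u"
    unfolding restricted_mean_def
    by (intro Bochner_Integration.integral_cong refl) (simp add: indicator_def size_event_def)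
  moreover have "restricted_mean n h u = 0" if "size_prob M S n u = 0"
  proof -
    have "AE \<omega> in M. \<omega> \<notin> size_event M S n u"
      using that by (intro AE_not_in null_setsI) (simp_all add: emeasure_eq_measure size_prob_def)
    then have "AE \<omega> in M. indicator {n} (fst (S u \<omega>)) * h (S u \<omega>) = 0"
      using AE_space by eventually_elim (auto simp: size_event_def)
    then show ?thesis
      unfolding restricted_mean_def by (rule integral_eq_zero_AE)
  qed
  ultimately show ?thesis
    by (subst integral_uniform_measure) (auto simp: size_prob_def)
qed

context
  fixes f :: "state \<Rightarrow> real ^ 'd" and C :: real
  assumes f: "f \<in> borel_measurable E" and f_bound: "\<And>y. y \<in> space E \<Longrightarrow> norm (f y) \<le> C"
begin

lemma component_measurable: "(\<lambda>y. f y $ i) \<in> borel_measurable E"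
  using measurable_compose[OF f borel_measurable_continuous_onI[of "\<lambda>x. x $ i"]] by (simp add: continuous_intros)

lemma component_bound: "y \<in> space E \<Longrightarrow> \<bar>f y $ i\<bar> \<le> C"
  using component_le_norm_cart[of "f y" i] f_bound[of y] by simp

lemma integrable_uniform_size_event:
  assumes "0 \<le> u" "size_prob M S n u > 0"
  shows "prob_space (uniform_measure M (size_event M S n u))"
    "integrable (uniform_measure M (size_event M S n u)) (\<lambda>\<omega>. f (S u \<omega>))"
proof -
  note [measurable] = S_measurable[OF assms(1)] f
  show "prob_space (uniform_measure M (size_event M S n u))"
    using assms(2) by (intro prob_space_uniform_measure) (auto simp: emeasure_eq_measure size_prob_def)
  then interpret U: prob_space "uniform_measure M (size_event M S n u)" .
  show "integrable (uniform_measure M (size_event M S n u)) (\<lambda>\<omega>. f (S u \<omega>))"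
    using f_bound S_space[OF assms(1)] by (intro U.integrable_const_bound[where B=C] AE_I2) auto
qed

lemma size_prob_mult_size_mean:
  assumes u: "0 \<le> u"
  shows "size_prob M S n u * size_mean M S f n u $ i = restricted_mean n (\<lambda>y. f y $ i) u"
proof (cases "size_prob M S n u > 0")
  case True
  have "size_mean M S f n u $ i = (LINT \<omega>|uniform_measure M (size_event M S n u). f (S u \<omega>) $ i)"
    unfolding size_mean_def
    by (rule integral_bounded_linear[OF bounded_linear_vec_nth integrable_uniform_size_event(2)[OF u True], symmetric])
  then show ?thesis
    using integral_uniform_size_event[OF component_measurable u] by simp
next
  case False
  then have "size_prob M S n u = 0"
    using measure_nonneg[of M "size_event M S n u"] by (simp add: size_prob_def)
  then show ?thesis
    using restricted_mean_le_size_prob[OF component_measurable component_bound u, where n=n] by simp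
qed

text \<open>Disintegration of the joint law: average over the state before the event, then over a
  draw from the kernel. The law is a \<open>bind\<close> of probability kernels, and the bound on
  \<open>\<phi>\<close> is what makes the integral over the \<open>bind\<close> an iterated
  one.\<close>

lemma event_law_integral:
  fixes \<phi> :: "state \<times> state \<Rightarrow> real"
  assumes \<epsilon>: "\<epsilon> \<in> \<Xi>" and u: "0 \<le> u" and pos: "size_prob M S (src \<epsilon>) u > 0"
    and \<phi>: "\<phi> \<in> borel_measurable (E \<Otimes>\<^sub>M E)" and bound: "\<And>p. p \<in> space (E \<Otimes>\<^sub>M E) \<Longrightarrow> \<bar>\<phi> p\<bar> \<le> B"
  shows "prob_space (event_law M E src K S \<epsilon> u)" "sets (event_law M E src K S \<epsilon> u) = sets (E \<Otimes>\<^sub>M E)"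
    "integrable (event_law M E src K S \<epsilon> u) \<phi>"
    "integral\<^sup>L (event_law M E src K S \<epsilon> u) \<phi> =
      (LINT \<omega>|uniform_measure M (size_event M S (src \<epsilon>) u). LINT z|K \<epsilon> (S u \<omega>). \<phi> (S u \<omega>, z))"
proof -
  note [measurable] = S_measurable[OF u] measurable_prob_algebraD[OF kernel[OF \<epsilon>]] \<phi>
  interpret U: prob_space "uniform_measure M (size_event M S (src \<epsilon>) u)"
    by (rule integrable_uniform_size_event[OF u pos])
  define D where "D = distr (uniform_measure M (size_event M S (src \<epsilon>) u)) E (S u)"
  interpret D: prob_space D
    unfolding D_def by (rule U.prob_space_distr) measurable
  have [measurable_cong]: "sets D = sets E"
    by (simp add: D_def)
  have space_D: "space D = space E"
    by (simp add: D_def)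
  define \<kappa> where "\<kappa> y = distr (K \<epsilon> y) (E \<Otimes>\<^sub>M E) (Pair y)" for y
  have \<kappa>_E: "\<kappa> \<in> E \<rightarrow>\<^sub>M subprob_algebra (E \<Otimes>\<^sub>M E)"
    unfolding \<kappa>_def by (rule measurable_distr2[where M=E]) measurable
  then have \<kappa>: "\<kappa> \<in> D \<rightarrow>\<^sub>M subprob_algebra (E \<Otimes>\<^sub>M E)"
    by measurable
  have Pair_meas: "Pair y \<in> K \<epsilon> y \<rightarrow>\<^sub>M E \<Otimes>\<^sub>M E" if "y \<in> space E" for y
    using that by (simp add: measurable_cong_sets[OF sets_kernel[OF \<epsilon> that] refl])
  have \<kappa>_prob: "prob_space (\<kappa> y)" if "y \<in> space E" for y
    unfolding \<kappa>_def using kernel_prob_space[OF \<epsilon> that] Pair_meas[OF that] by (rule prob_space.prob_space_distr)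
  have law: "event_law M E src K S \<epsilon> u = D \<bind> \<kappa>"
    by (simp add: event_law_def D_def \<kappa>_def[abs_def])
  show "prob_space (event_law M E src K S \<epsilon> u)"
    unfolding law using \<kappa>_prob by (intro D.prob_space_bind[OF _ \<kappa>] AE_I2) (simp add: space_D)
  show "sets (event_law M E src K S \<epsilon> u) = sets (E \<Otimes>\<^sub>M E)"
    unfolding law by (rule sets_bind) (auto simp: \<kappa>_def D.not_empty)
  have mass: "AE y in D. emeasure (\<kappa> y) (space (\<kappa> y)) \<le> ennreal 1"
    using \<kappa>_prob prob_space.emeasure_space_1 by (intro AE_I2) (fastforce simp: space_D)
  show "integrable (event_law M E src K S \<epsilon> u) \<phi>"
    unfolding law by (rule integrable_bind[OF \<phi> bound \<kappa> D.finite_measure_axioms mass])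
  have "integral\<^sup>L (event_law M E src K S \<epsilon> u) \<phi> = (LINT y|D. integral\<^sup>L (\<kappa> y) \<phi>)"
    unfolding law by (rule integral_bind[OF \<phi> bound \<kappa> D.finite_measure_axioms mass])
  also have "\<dots> = (LINT \<omega>|uniform_measure M (size_event M S (src \<epsilon>) u). integral\<^sup>L (\<kappa> (S u \<omega>)) \<phi>)"
    unfolding D_def
  proof (rule integral_distr)
    show "S u \<in> uniform_measure M (size_event M S (src \<epsilon>) u) \<rightarrow>\<^sub>M E"
      by measurable
    show "(\<lambda>y. integral\<^sup>L (\<kappa> y) \<phi>) \<in> borel_measurable E"
      by (rule measurable_compose[OF \<kappa>_E integral_measurable_subprob_algebra[OF \<phi>]])
  qed
  also have "\<dots> = (LINT \<omega>|uniform_measure M (size_event M S (src \<epsilon>) u). LINT z|K \<epsilon> (S u \<omega>). \<phi> (S u \<omega>, z))"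
    unfolding \<kappa>_def
    by (intro Bochner_Integration.integral_cong refl integral_distr[OF Pair_meas \<phi>] S_space u) simp
  finally show "integral\<^sup>L (event_law M E src K S \<epsilon> u) \<phi> =
      (LINT \<omega>|uniform_measure M (size_event M S (src \<epsilon>) u). LINT z|K \<epsilon> (S u \<omega>). \<phi> (S u \<omega>, z))" .
qed

text \<open>By the tower property, conditioning on \<open>f(S(t))\<close> does not change the mean
  of \<open>f(S(t+))\<close> under the law of the event, so the assumed bound can be integrated. The
  affine bound depends on the state before the event only, and its mean is the same affine function
  of \<open>size_mean\<close>. If the source size has probability 0, both sides vanish.\<close>

lemma kernel_mean_le:
  fixes A :: "real ^ 'd ^ 'd" and b :: "real ^ 'd"
  assumes \<epsilon>: "\<epsilon> \<in> \<Xi>" and u: "0 \<le> u"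
    and event_bound: "size_prob M S (src \<epsilon>) u > 0 \<Longrightarrow> AE (y, z) in event_law M E src K S \<epsilon> u.
        event_cond_exp M E src K S f \<epsilon> u (y, z) \<le> A *v f y + b"
  shows "restricted_mean (src \<epsilon>) (\<lambda>y. LINT z|K \<epsilon> y. f z $ i) u \<le>
    (size_prob M S (src \<epsilon>) u *\<^sub>R (A *v size_mean M S f (src \<epsilon>) u + b)) $ i"
proof (cases "size_prob M S (src \<epsilon>) u > 0")
  case False
  then have "size_prob M S (src \<epsilon>) u = 0"
    using measure_nonneg[of M "size_event M S (src \<epsilon>) u"] by (simp add: size_prob_def)
  then show ?thesis
    using restricted_mean_le_size_prob[OF kernel_expectation_measurable[OF \<epsilon> component_measurable]
        kernel_expectation_bound(2)[OF \<epsilon> component_measurable component_bound] u, where n="src \<epsilon>"] by simp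
next
  case pos: True
  define U where "U = uniform_measure M (size_event M S (src \<epsilon>) u)"
  interpret U: prob_space U
    unfolding U_def by (rule integrable_uniform_size_event(1)[OF u pos])
  have f_int: "integrable U (\<lambda>\<omega>. f (S u \<omega>))"
    unfolding U_def by (rule integrable_uniform_size_event(2)[OF u pos])
  define Q where "Q = event_law M E src K S \<epsilon> u"
  define \<psi> where "\<psi> y = (A *v f y + b) $ i" for y
  \<comment> \<open>A component of the matrix product is a bounded linear functional. Hence the
    affine bound is measurable and bounded, with constant \<open>N\<close>, and later the functional
    can be moved out of the integral.\<close>
  have lin: "bounded_linear (\<lambda>x. (A *v x) $ i)"
    by (rule bounded_linear_compose[OF bounded_linear_vec_nth matrix_vector_mul_bounded_linear])
  then obtain N where N: "\<And>x. norm ((A *v x) $ i) \<le> norm x * N" "0 < N"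
    using bounded_linear.pos_bounded by blast
  have \<psi>_meas: "\<psi> \<in> borel_measurable E"
    using measurable_compose[OF f borel_measurable_continuous_onI[OF linear_continuous_on[OF lin]]] by (simp add: \<psi>_def[abs_def])
  have \<psi>_bound: "\<bar>\<psi> y\<bar> \<le> C * N + \<bar>b $ i\<bar>" if "y \<in> space E" for y
  proof -
    have "\<bar>(A *v f y) $ i\<bar> \<le> norm (f y) * N"
      using N(1)[of "f y"] by simp
    also have "\<dots> \<le> C * N"
      using f_bound[OF that] N(2) by (intro mult_right_mono) auto
    finally show ?thesis
      by (simp add: \<psi>_def)
  qed
  have pre: "(\<lambda>p. \<psi> (fst p)) \<in> borel_measurable (E \<Otimes>\<^sub>M E)" "\<And>p. p \<in> space (E \<Otimes>\<^sub>M E) \<Longrightarrow> \<bar>\<psi> (fst p)\<bar> \<le> C * N + \<bar>b $ i\<bar>"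
    using measurable_compose[OF measurable_fst \<psi>_meas] \<psi>_bound by (auto simp: space_pair_measure)
  have post: "(\<lambda>p. f (snd p) $ i) \<in> borel_measurable (E \<Otimes>\<^sub>M E)" "\<And>p. p \<in> space (E \<Otimes>\<^sub>M E) \<Longrightarrow> \<bar>f (snd p) $ i\<bar> \<le> C"
    using measurable_compose[OF measurable_snd component_measurable] component_bound by (auto simp: space_pair_measure)
  note pre_law = event_law_integral[OF \<epsilon> u pos pre, folded Q_def U_def]
  note post_law = event_law_integral[OF \<epsilon> u pos post, folded Q_def U_def]
  interpret Q: prob_space Q
    by (rule post_law(1))
  \<comment> \<open>The information in the conditioning is the value of \<open>f\<close> before the
    event, coarser than the state itself. Measurability of \<open>f\<close> makes it a subalgebra of
    \<open>Q\<close>, as the tower property requires.\<close>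
  define G where "G = vimage_algebra (space Q) (\<lambda>(y, z). f y) (borel :: (real ^ 'd) measure)"
  have "(\<lambda>(y, z). f y) \<in> borel_measurable Q"
    using measurable_compose[OF measurable_fst f, of E] by (simp add: split_beta' measurable_cong_sets[OF post_law(2) refl])
  then have "subalgebra Q G"
    unfolding subalgebra_def G_def by (simp add: measurable_iff_sets)
  then interpret Q: finite_measure_subalgebra Q G
    by unfold_locales
  have ce: "event_cond_exp M E src K S f \<epsilon> u p $ i = real_cond_exp Q G (\<lambda>(y, z). f z $ i) p" for p
    by (simp add: event_cond_exp_def Q_def[symmetric] G_def[symmetric] Let_def)
  have int_post: "integrable Q (\<lambda>(y, z). f z $ i)"
    using post_law(3) by (simp add: split_beta')
  have "restricted_mean (src \<epsilon>) (\<lambda>y. LINT z|K \<epsilon> y. f z $ i) u =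
      size_prob M S (src \<epsilon>) u * (LINT \<omega>|U. LINT z|K \<epsilon> (S u \<omega>). f z $ i)"
    unfolding U_def by (rule integral_uniform_size_event[OF kernel_expectation_measurable[OF \<epsilon> component_measurable] u, symmetric])
  also have "(LINT \<omega>|U. LINT z|K \<epsilon> (S u \<omega>). f z $ i) = (LINT p|Q. real_cond_exp Q G (\<lambda>(y, z). f z $ i) p)"
    using post_law(4) Q.real_cond_exp_int(2)[OF int_post] by (simp add: split_beta')
  also have "\<dots> \<le> (LINT p|Q. \<psi> (fst p))"
  proof (rule integral_mono_AE)
    show "AE p in Q. real_cond_exp Q G (\<lambda>(y, z). f z $ i) p \<le> \<psi> (fst p)"
      using event_bound[OF pos] unfolding Q_def[symmetric]
      by eventually_elim (auto simp: \<psi>_def less_eq_vec_def simp flip: ce)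
  qed (rule Q.real_cond_exp_int(1)[OF int_post], rule pre_law(3))
  also have "\<dots> = (LINT \<omega>|U. LINT z|K \<epsilon> (S u \<omega>). \<psi> (fst (S u \<omega>, z)))"
    by (rule pre_law(4))
  also have "\<dots> = (LINT \<omega>|U. \<psi> (S u \<omega>))"
  proof (rule Bochner_Integration.integral_cong[OF refl])
    fix \<omega> assume "\<omega> \<in> space U"
    then interpret K: prob_space "K \<epsilon> (S u \<omega>)"
      by (intro kernel_prob_space[OF \<epsilon>] S_space u) (simp add: U_def)
    show "(LINT z|K \<epsilon> (S u \<omega>). \<psi> (fst (S u \<omega>, z))) = \<psi> (S u \<omega>)"
      by (simp add: K.prob_space)
  qed
  also have "\<dots> = (LINT \<omega>|U. (A *v f (S u \<omega>)) $ i) + b $ i"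
    unfolding \<psi>_def using integrable_bounded_linear[OF lin f_int] by (simp add: U.prob_space)
  also have "(LINT \<omega>|U. (A *v f (S u \<omega>)) $ i) = (A *v size_mean M S f (src \<epsilon>) u) $ i"
    unfolding size_mean_def U_def[symmetric] by (rule integral_bounded_linear[OF lin f_int])
  finally show ?thesis
    using pos by simp
qed

end

end

text \<open>
  The excess \<open>y - x\<close> always has a sum in \<open>ereal\<close>, possibly \<open>\<infinity>\<close>, so the junk value \<open>0\<close> of a divergent sum
  does not arise.
\<close>

lemma infsum_ereal_ge:
  fixes x y :: "'a \<Rightarrow> real"
  assumes x: "x summable_on A" and le: "\<And>a. a \<in> A \<Longrightarrow> x a \<le> y a"
  shows "ereal (infsum x A) \<le> (\<Sum>\<^sub>\<infinity>a\<in>A. ereal (y a))"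
proof -
  define L where "L = (\<Sum>\<^sub>\<infinity>a\<in>A. ereal (y a - x a))"
  have "(\<lambda>a. ereal (y a - x a)) summable_on A"
    using le by (intro nonneg_summable_on_complete) simp
  then have "((\<lambda>a. ereal (y a - x a)) has_sum L) A"
    unfolding L_def by (rule has_sum_infsum)
  then have excess: "((\<lambda>X. \<Sum>a\<in>X. ereal (y a - x a)) \<longlongrightarrow> L) (finite_subsets_at_top A)"
    unfolding has_sum_def .
  have "0 \<le> L"
    unfolding L_def using le by (intro infsum_nonneg) simp
  have "((\<lambda>X. ereal (sum x X)) \<longlongrightarrow> ereal (infsum x A)) (finite_subsets_at_top A)"
    using has_sum_infsum[OF x] by (intro tendsto_ereal) (simp add: has_sum_def)
  then have "((\<lambda>X. ereal (sum x X) + (\<Sum>a\<in>X. ereal (y a - x a))) \<longlongrightarrow> ereal (infsum x A) + L) (finite_subsets_at_top A)"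
    using excess \<open>0 \<le> L\<close> by (intro tendsto_add_ereal_nonneg) auto
  moreover have "ereal (sum x X) + (\<Sum>a\<in>X. ereal (y a - x a)) = (\<Sum>a\<in>X. ereal (y a))" for X
    by (simp add: sum_subtractf)
  ultimately have "((\<lambda>a. ereal (y a)) has_sum (ereal (infsum x A) + L)) A"
    unfolding has_sum_def by (simp only:)
  then have "(\<Sum>\<^sub>\<infinity>a\<in>A. ereal (y a)) = ereal (infsum x A) + L"
    by (rule infsumI)
  then show ?thesis
    using add_left_mono[OF \<open>0 \<le> L\<close>, of "ereal (infsum x A)"] by simp
qed

lemma has_vector_derivative_componentwise_cart:
  fixes f :: "real \<Rightarrow> real ^ 'd"
  assumes "\<And>i. ((\<lambda>x. f x $ i) has_real_derivative D $ i) (at a within S)"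
  shows "(f has_vector_derivative D) (at a within S)"
  unfolding has_vector_derivative_def
proof (subst has_derivative_componentwise_within, rule ballI)
  fix k :: "real ^ 'd" assume "k \<in> Basis"
  then obtain i where k: "k = axis i 1"
    by (auto simp: Basis_vec_def)
  have "(*) (D $ i) = (\<lambda>x. x * D $ i)"
    by (simp add: fun_eq_iff mult.commute)
  then have "((\<lambda>x. f x $ i) has_derivative (\<lambda>x. x * D $ i)) (at a within S)"
    using assms[of i] by (simp add: has_field_derivative_def)
  then show "((\<lambda>x. f x \<bullet> k) has_derivative (\<lambda>x. (x *\<^sub>R D) \<bullet> k)) (at a within S)"
    by (simp add: k inner_axis)
qed

text \<open>The bounding sum over clocks is taken in \<open>ereal\<close> because it may diverge to
  infinity while the gain itself converges; since the gain bounds it from below, it is never minus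
  infinity. At \<open>t = 0\<close> the derivative is the one-sided one.\<close>

theorem proposition2:
  fixes M :: "'w measure" and E :: "state measure"
    and \<Xi> :: "'c set" and rate :: "'c \<Rightarrow> real" and src arr :: "'c \<Rightarrow> nat"
    and K :: "'c \<Rightarrow> state \<Rightarrow> state measure"
    and S :: "real \<Rightarrow> 'w \<Rightarrow> state" and tick :: "'c \<Rightarrow> nat \<Rightarrow> 'w \<Rightarrow> ereal"
    and f :: "state \<Rightarrow> real ^ 'd"
    and A :: "'c \<Rightarrow> real ^ 'd ^ 'd" and b :: "'c \<Rightarrow> real ^ 'd"
    and j :: nat and t :: real
  defines "\<pi> \<equiv> size_prob M S" and "F \<equiv> size_mean M S f"
  assumes process: "clock_jump_process M E \<Xi> rate src arr K S tick"
    and f_measurable: "f \<in> borel_measurable E"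
    and f_bounded: "bounded (f ` space E)"
    and event_bound: "\<And>\<epsilon> u. \<epsilon> \<in> \<Xi> \<Longrightarrow> 0 \<le> u \<Longrightarrow> \<pi> (src \<epsilon>) u > 0 \<Longrightarrow>
      AE (y, z) in event_law M E src K S \<epsilon> u.
        event_cond_exp M E src K S f \<epsilon> u (y, z) \<le> A \<epsilon> *v f y + b \<epsilon>"
    and inflow: "\<And>T. \<exists>r. uniform_limit {0..T}
        (\<lambda>X u. \<Sum>\<epsilon>\<in>X. rate \<epsilon> * \<pi> (src \<epsilon>) u) r
        (finite_subsets_at_top {\<epsilon> \<in> \<Xi>. arr \<epsilon> = j})"
    and t: "0 \<le> t"
  shows "\<exists>D. ((\<lambda>u. \<pi> j u *\<^sub>R F j u) has_vector_derivative D) (at t within {0..}) \<and>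
    (\<forall>i. ereal (D $ i) \<le>
      (\<Sum>\<^sub>\<infinity>\<epsilon>\<in>{\<epsilon> \<in> \<Xi>. arr \<epsilon> = j}.
         ereal ((rate \<epsilon> *\<^sub>R \<pi> (src \<epsilon>) t *\<^sub>R (A \<epsilon> *v F (src \<epsilon>) t + b \<epsilon>)) $ i))
      - ereal ((\<Sum>\<epsilon>\<in>{\<epsilon> \<in> \<Xi>. src \<epsilon> = j}. rate \<epsilon> *\<^sub>R \<pi> j t *\<^sub>R F j t) $ i))"
proof -
  interpret clock_jump_process M E \<Xi> rate src arr K S tick
    by (rule process)
  obtain C where C: "\<And>y. y \<in> space E \<Longrightarrow> norm (f y) \<le> C"
    using f_bounded unfolding bounded_iff by blast
  note inflow' = inflow[unfolded \<pi>_def]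
  have comp: "(\<lambda>y. f y $ i) \<in> borel_measurable E" "\<And>y. y \<in> space E \<Longrightarrow> \<bar>f y $ i\<bar> \<le> C" for i
    using component_measurable[where C=C, OF f_measurable] component_bound[where C=C, OF f_measurable] C by blast+
  have product: "(\<pi> n u *\<^sub>R F n u) $ i = restricted_mean n (\<lambda>y. f y $ i) u" if "0 \<le> u" for n u i
    unfolding \<pi>_def F_def using size_prob_mult_size_mean[where C=C, OF f_measurable _ that] C by simp
  \<comment> \<open>The witness is the exact derivative, gain minus loss in each component; the
    inequality comes solely from the bound on the gain terms.\<close>
  define D where "D = (\<chi> i. gain j (\<lambda>y. f y $ i) t - loss j (\<lambda>y. f y $ i) t)"
  have "((\<lambda>u. (\<pi> j u *\<^sub>R F j u) $ i) has_real_derivative D $ i) (at t within {0..})" for i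
  proof (rule has_field_derivative_transform_within[OF _ zero_less_one])
    show "(restricted_mean j (\<lambda>y. f y $ i) has_real_derivative D $ i) (at t within {0..})"
      unfolding D_def vec_lambda_beta by (rule restricted_mean_derivative[OF inflow' comp t])
    show "restricted_mean j (\<lambda>y. f y $ i) u = (\<pi> j u *\<^sub>R F j u) $ i" if "u \<in> {0..}" for u
      by (rule product[symmetric]) (use that in simp)
  qed (use t in simp)
  then have deriv: "((\<lambda>u. \<pi> j u *\<^sub>R F j u) has_vector_derivative D) (at t within {0..})"
    by (rule has_vector_derivative_componentwise_cart)
  have "ereal (D $ i) \<le>
      (\<Sum>\<^sub>\<infinity>\<epsilon>\<in>{\<epsilon> \<in> \<Xi>. arr \<epsilon> = j}.
         ereal ((rate \<epsilon> *\<^sub>R \<pi> (src \<epsilon>) t *\<^sub>R (A \<epsilon> *v F (src \<epsilon>) t + b \<epsilon>)) $ i))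
      - ereal ((\<Sum>\<epsilon>\<in>{\<epsilon> \<in> \<Xi>. src \<epsilon> = j}. rate \<epsilon> *\<^sub>R \<pi> j t *\<^sub>R F j t) $ i)" for i
  proof -
    have gain_le: "rate \<epsilon> * restricted_mean (src \<epsilon>) (\<lambda>y. LINT z|K \<epsilon> y. f z $ i) t \<le>
        (rate \<epsilon> *\<^sub>R \<pi> (src \<epsilon>) t *\<^sub>R (A \<epsilon> *v F (src \<epsilon>) t + b \<epsilon>)) $ i" if \<epsilon>: "\<epsilon> \<in> \<Xi>" for \<epsilon>
    proof -
      have "restricted_mean (src \<epsilon>) (\<lambda>y. LINT z|K \<epsilon> y. f z $ i) t \<le>
          (\<pi> (src \<epsilon>) t *\<^sub>R (A \<epsilon> *v F (src \<epsilon>) t + b \<epsilon>)) $ i"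
        unfolding \<pi>_def F_def
        by (rule kernel_mean_le[where C=C, OF f_measurable _ \<epsilon> t event_bound[OF \<epsilon> t, unfolded \<pi>_def]]) (rule C)
      from mult_left_mono[OF this rate_nonneg[OF \<epsilon>]] show ?thesis
        by simp
    qed
    have "ereal (gain j (\<lambda>y. f y $ i) t) \<le> (\<Sum>\<^sub>\<infinity>\<epsilon>\<in>{\<epsilon> \<in> \<Xi>. arr \<epsilon> = j}.
         ereal ((rate \<epsilon> *\<^sub>R \<pi> (src \<epsilon>) t *\<^sub>R (A \<epsilon> *v F (src \<epsilon>) t + b \<epsilon>)) $ i))"
      unfolding gain_def
    proof (rule infsum_ereal_ge[OF gain_summable[OF inflow' comp t]])
      fix \<epsilon> assume "\<epsilon> \<in> {\<epsilon> \<in> \<Xi>. arr \<epsilon> = j}"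
      then have "\<epsilon> \<in> \<Xi>"
        by simp
      then show "rate \<epsilon> * restricted_mean (src \<epsilon>) (\<lambda>y. LINT z|K \<epsilon> y. f z $ i) t \<le>
          (rate \<epsilon> *\<^sub>R \<pi> (src \<epsilon>) t *\<^sub>R (A \<epsilon> *v F (src \<epsilon>) t + b \<epsilon>)) $ i"
        by (rule gain_le)
    qed
    moreover have "loss j (\<lambda>y. f y $ i) t = (\<Sum>\<epsilon>\<in>{\<epsilon> \<in> \<Xi>. src \<epsilon> = j}. rate \<epsilon> *\<^sub>R \<pi> j t *\<^sub>R F j t) $ i"
      unfolding loss_def product[OF t, symmetric] by (simp add: sum_distrib_right mult.assoc)
    moreover have "ereal (D $ i) = ereal (gain j (\<lambda>y. f y $ i) t) - ereal (loss j (\<lambda>y. f y $ i) t)"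
      by (simp add: D_def)
    ultimately show ?thesis
      by (simp only: ereal_minus_mono order_refl)
  qed
  with deriv show ?thesis
    by blast
qed

end
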